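(* There exist a compact metrizable Hausdorff space $X$, a normal uniform algebra $B$ on $X$, and a point $x\in X$ such that $B$ has a nondegenerate bounded point derivation of infinite order at $x$, and $B$ has bounded relative units at every point of $X\setminus\{x\}$.
   Context: A uniform algebra on a compact Hausdorff space $X$ is a subalgebra of $C(X)$ (continuous complex-valued functions, supremum norm) that is closed, contains the constant functions, and separates the points of $X$. The maximal ideal space $\mathfrak{M}_B$ is the set of nonzero multiplicative linear functionals on $B$ with the Gelfand (weak-* ) topology; points of $X$ are identified with the corresponding point evaluations, so $X\subset\mathfrak{M}_B$, and $\hat f$ denotes the Gelfand transform of $f$. A uniform algebra $B$ is normal on $X$ if for each pair of disjoint closed subsets $K_0,K_1$ of $X$ there is $f\in B$ with $f|K_0=0$ and $f|K_1=1$. (In that case $X=\mathfrak{M}_B$.) For $\phi\in\mathfrak{M}_B$, $J_\phi=\{f\in B:\hat f^{-1}(0)\text{ contains a neighborhood of }\phi\text{ in }\mathfrak{M}_B\}$. The uniform algebra $B$ on $X$ has bounded relative units at $y\in X$ if there is a constant $C>0$ such that for each compact $K\subset X\setminus\{y\}$ there is $f\in J_y$ with $f|K=1$ and $\|f\|\le C$. A point derivation of infinite order at $\phi\in\mathfrak{M}_B$ is a sequence $d=(d^{(k)})_{k=0}^\infty$ of linear functionals on $B$ such that for all $f,g\in B$: $d^{(0)}f=\hat f(\phi)$, and $d^{(k)}(fg)=\sum_{j=0}^k (d^{(j)}f)(d^{(k-j)}g)$ for all $k=1,2,\ldots$. It is bounded if every $d^{(k)}$ is bounded, and nondegenerate if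 $d^{(1)}\ne0$. *)

theory Defs
  imports "HOL-Analysis.Analysis"
begin

(* C(X) is the library space cfunspace X euclidean_metric. Its elements are extensional:
   they take the value undefined off topspace X. Hence the algebra operations are pointwise
   operations restricted to topspace X. For compact X every continuous function is bounded,
   so nothing is lost, and the metric of cfunspace is the supremum distance. *)

abbreviation cont_fun_metric :: "'a topology \<Rightarrow> ('a \<Rightarrow> complex) metric" where
  "cont_fun_metric X \<equiv> cfunspace X euclidean_metric"

definition fun_add :: "'a topology \<Rightarrow> ('a \<Rightarrow> complex) \<Rightarrow> ('a \<Rightarrow> complex) \<Rightarrow> 'a \<Rightarrow> complex" where
  "fun_add X f g = (\<lambda>x\<in>topspace X. f x + g x)"

definition fun_mult :: "'a topology \<Rightarrow> ('a \<Rightarrow> complex) \<Rightarrow> ('a \<Rightarrow> complex) \<Rightarrow> 'a \<Rightarrow> complex" where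
  "fun_mult X f g = (\<lambda>x\<in>topspace X. f x * g x)"

definition fun_scale :: "'a topology \<Rightarrow> complex \<Rightarrow> ('a \<Rightarrow> complex) \<Rightarrow> 'a \<Rightarrow> complex" where
  "fun_scale X c f = (\<lambda>x\<in>topspace X. c * f x)"

definition fun_const :: "'a topology \<Rightarrow> complex \<Rightarrow> 'a \<Rightarrow> complex" where
  "fun_const X c = (\<lambda>x\<in>topspace X. c)"

definition sup_norm :: "'a topology \<Rightarrow> ('a \<Rightarrow> complex) \<Rightarrow> real" where
  "sup_norm X f = (SUP x\<in>topspace X. cmod (f x))"

definition uniform_algebra :: "'a topology \<Rightarrow> ('a \<Rightarrow> complex) set \<Rightarrow> bool" where
  "uniform_algebra X B \<longleftrightarrow>
     compact_space X \<and> Hausdorff_space X \<and>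
     B \<subseteq> mspace (cont_fun_metric X) \<and>
     (\<forall>f\<in>B. \<forall>g\<in>B. fun_add X f g \<in> B) \<and>
     (\<forall>f\<in>B. \<forall>g\<in>B. fun_mult X f g \<in> B) \<and>
     (\<forall>c. \<forall>f\<in>B. fun_scale X c f \<in> B) \<and>
     closedin (mtopology_of (cont_fun_metric X)) B \<and>
     (\<forall>c. fun_const X c \<in> B) \<and>
     (\<forall>x\<in>topspace X. \<forall>y\<in>topspace X. x \<noteq> y \<longrightarrow> (\<exists>f\<in>B. f x \<noteq> f y))"

definition normal_on :: "'a topology \<Rightarrow> ('a \<Rightarrow> complex) set \<Rightarrow> bool" where
  "normal_on X B \<longleftrightarrow>
     (\<forall>K0 K1. closedin X K0 \<and> closedin X K1 \<and> disjnt K0 K1 \<longrightarrow>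
        (\<exists>f\<in>B. (\<forall>x\<in>K0. f x = 0) \<and> (\<forall>x\<in>K1. f x = 1)))"

definition linear_functional ::
    "'a topology \<Rightarrow> ('a \<Rightarrow> complex) set \<Rightarrow> (('a \<Rightarrow> complex) \<Rightarrow> complex) \<Rightarrow> bool" where
  "linear_functional X B l \<longleftrightarrow>
     (\<forall>f\<in>B. \<forall>g\<in>B. l (fun_add X f g) = l f + l g) \<and>
     (\<forall>c. \<forall>f\<in>B. l (fun_scale X c f) = c * l f)"

definition bounded_functional ::
    "'a topology \<Rightarrow> ('a \<Rightarrow> complex) set \<Rightarrow> (('a \<Rightarrow> complex) \<Rightarrow> complex) \<Rightarrow> bool" where
  "bounded_functional X B l \<longleftrightarrow> (\<exists>M. \<forall>f\<in>B. cmod (l f) \<le> M * sup_norm X f)"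

(* Functionals on B are made extensional on B here, so that each character is represented
   by exactly one HOL function. *)

definition characters ::
    "'a topology \<Rightarrow> ('a \<Rightarrow> complex) set \<Rightarrow> (('a \<Rightarrow> complex) \<Rightarrow> complex) set" where
  "characters X B =
     {\<phi> \<in> extensional B. linear_functional X B \<phi> \<and>
        (\<forall>f\<in>B. \<forall>g\<in>B. \<phi> (fun_mult X f g) = \<phi> f * \<phi> g) \<and>
        (\<exists>f\<in>B. \<phi> f \<noteq> 0)}"

(* The weak-* topology is that of pointwise convergence on B, i.e. the topology induced by
   the product of copies of the complex plane indexed by B. *)

definition max_ideal_space ::
    "'a topology \<Rightarrow> ('a \<Rightarrow> complex) set \<Rightarrow> (('a \<Rightarrow> complex) \<Rightarrow> complex) topology" where
  "max_ideal_space X B =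
     subtopology (product_topology (\<lambda>_. euclidean) B) (characters X B)"

definition gelfand :: "('a \<Rightarrow> complex) \<Rightarrow> (('a \<Rightarrow> complex) \<Rightarrow> complex) \<Rightarrow> complex" where
  "gelfand f \<phi> = \<phi> f"

definition point_eval :: "('a \<Rightarrow> complex) set \<Rightarrow> 'a \<Rightarrow> ('a \<Rightarrow> complex) \<Rightarrow> complex" where
  "point_eval B x = (\<lambda>f\<in>B. f x)"

definition J_ideal ::
    "'a topology \<Rightarrow> ('a \<Rightarrow> complex) set \<Rightarrow> (('a \<Rightarrow> complex) \<Rightarrow> complex) \<Rightarrow> ('a \<Rightarrow> complex) set" where
  "J_ideal X B \<phi> =
     {f \<in> B. \<exists>U. openin (max_ideal_space X B) U \<and> \<phi> \<in> U \<and> (\<forall>\<psi>\<in>U. gelfand f \<psi> = 0)}"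

definition bounded_relative_units_at ::
    "'a topology \<Rightarrow> ('a \<Rightarrow> complex) set \<Rightarrow> 'a \<Rightarrow> bool" where
  "bounded_relative_units_at X B y \<longleftrightarrow>
     (\<exists>C>0. \<forall>K. compactin X K \<and> K \<subseteq> topspace X - {y} \<longrightarrow>
        (\<exists>f \<in> J_ideal X B (point_eval B y). (\<forall>x\<in>K. f x = 1) \<and> sup_norm X f \<le> C))"

definition infinite_order_point_derivation ::
    "'a topology \<Rightarrow> ('a \<Rightarrow> complex) set \<Rightarrow> (('a \<Rightarrow> complex) \<Rightarrow> complex)
      \<Rightarrow> (nat \<Rightarrow> ('a \<Rightarrow> complex) \<Rightarrow> complex) \<Rightarrow> bool" where
  "infinite_order_point_derivation X B \<phi> d \<longleftrightarrow>
     \<phi> \<in> topspace (max_ideal_space X B) \<and>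
     (\<forall>k. linear_functional X B (d k)) \<and>
     (\<forall>f\<in>B. d 0 f = gelfand f \<phi>) \<and>
     (\<forall>f\<in>B. \<forall>g\<in>B. \<forall>k\<ge>1. d k (fun_mult X f g) = (\<Sum>j=0..k. d j f * d (k - j) g))"

definition bounded_derivation ::
    "'a topology \<Rightarrow> ('a \<Rightarrow> complex) set \<Rightarrow> (nat \<Rightarrow> ('a \<Rightarrow> complex) \<Rightarrow> complex) \<Rightarrow> bool" where
  "bounded_derivation X B d \<longleftrightarrow> (\<forall>k. bounded_functional X B (d k))"

definition nondegenerate_derivation ::
    "('a \<Rightarrow> complex) set \<Rightarrow> (nat \<Rightarrow> ('a \<Rightarrow> complex) \<Rightarrow> complex) \<Rightarrow> bool" where
  "nondegenerate_derivation B d \<longleftrightarrow> (\<exists>f\<in>B. d 1 f \<noteq> 0)"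

(* HOL cannot quantify existentially over the type carrying X. Every compact metrizable
   space embeds in the Hilbert cube, so a topology whose underlying set is some subset of
   this type (not necessarily with the product topology) represents any of them up to
   homeomorphism. *)

type_synonym hilbert_carrier = "nat \<Rightarrow> real"

end

theory Submission
  imports Defs "HOL-Complex_Analysis.Complex_Analysis"
begin

text \<open>In the coordinate \<open>w = 1 / z\<close>, remove from the plane a disc around \<open>0\<close> and countably many small
  discs with rapidly decreasing radii. A function of \<open>z\<close> that is holomorphic off finitely many removed
  points has Taylor coefficients at \<open>z = 0\<close> given by integrals of \<open>f (1 / w) * w ^ k / w\<close> over the
  boundaries of finitely many discs; so they are bounded by the supremum norm on the remaining compact set
  \<open>K\<close>. Choosing the discs around the poles of rational functions that converge uniformly to the
  indicator of a small neighbourhood yields a normal uniform algebra on \<open>K\<close> with a bounded point derivation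
  of infinite order at \<open>0\<close>.

  To this algebra adjoin an \<open>N i\<close>-th root of each of countably many bump functions \<open>v i\<close> vanishing
  near \<open>0\<close>, where \<open>\<parallel>v i\<parallel> \<le> 2 ^ N i\<close>. Averaging over the choices of the roots is a projection of norm
  one onto the old algebra, and since \<open>v i\<close> has vanishing Taylor data, composing the derivation with it
  gives a derivation satisfying the same bounds. Where \<open>v i = 1\<close>, its root is locally a constant of modulus
  one, but the norm of the root is at most \<open>2\<close> however large \<open>\<parallel>v i\<parallel>\<close> is. Multiplying it by indicators of
  branches of other roots gives functions of norm at most \<open>2\<close> that are \<open>1\<close> near a given point and vanish
  outside a prescribed neighbourhood of it, provided the point does not lie over \<open>0\<close>.\<close>

section \<open>Relations between functions and Taylor data\<close>

text \<open>The planar algebra alone is not enough because the construction bounds its bump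
  functions individually but not uniformly: a kernel is bounded by \<open>8 / \<kappa>\<close>, and
  \<open>\<kappa>\<close> must be small for the removed radii to stay summable against every power
  of the centres. Roots cure the norms but put many points over one planar point, and these have to
  be told apart without losing the bound. Over a small planar set the values of a root of a nearly
  constant nonzero \<open>v i\<close> fall into separated branches, whose indicators are limits of
  polynomials there. Being idempotents, they can be multiplied in any finite number within norm 1,
  and a root of a bump function supported over the small set makes the product global. As all this
  is local, a single round of root adjunctions suffices. The exceptional point has the same origin:
  all \<open>v i\<close> vanish near 0, so only one point lies over 0 and no root of a bump function
  can act as a cutoff there. Boundedness does double duty throughout: it makes Taylor data unique
  and lets uniform limits inherit them.\<close>

text \<open>A point derivation of infinite order is a homomorphism into formal power series. It is represented
  by a set of pairs of a function and its Taylor data; that such a set is single-valued is a consequence of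
  boundedness only.\<close>

definition fps_alg :: "'a set \<Rightarrow> (('a \<Rightarrow> complex) \<times> complex fps) set \<Rightarrow> bool" where
  "fps_alg S G \<longleftrightarrow>
     (\<forall>c. (\<lambda>_. c, fps_const c) \<in> G) \<and>
     (\<forall>f s g t. (f, s) \<in> G \<longrightarrow> (g, t) \<in> G \<longrightarrow>
        (\<lambda>x. f x + g x, s + t) \<in> G \<and> (\<lambda>x. f x * g x, s * t) \<in> G) \<and>
     (\<forall>f s. (f, s) \<in> G \<longrightarrow> (\<exists>M. \<forall>x\<in>S. norm (f x) \<le> M))"

definition fps_bounded :: "'a set \<Rightarrow> (('a \<Rightarrow> complex) \<times> complex fps) set \<Rightarrow> bool" where
  "fps_bounded S G \<longleftrightarrow>
     (\<forall>k. \<exists>C. \<forall>f s M. (f, s) \<in> G \<longrightarrow> (\<forall>x\<in>S. norm (f x) \<le> M) \<longrightarrow> 0 \<le> M \<longrightarrow>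
        norm (fps_nth s k) \<le> C * M)"

text \<open>Closure of the graph for uniform convergence on \<open>S\<close> and coefficientwise
  convergence of the data. The cutoff \<open>n\<close> allows a single tolerance \<open>e\<close>
  for both.\<close>

definition fps_closure :: "'a set \<Rightarrow> (('a \<Rightarrow> complex) \<times> complex fps) set
    \<Rightarrow> (('a \<Rightarrow> complex) \<times> complex fps) set" where
  "fps_closure S G =
     {(f, s). \<forall>n. \<forall>e>0. \<exists>g t. (g, t) \<in> G \<and> (\<forall>x\<in>S. norm (f x - g x) \<le> e) \<and>
        (\<forall>k\<le>n. norm (fps_nth s k - fps_nth t k) \<le> e)}"

lemma fps_algD:
  assumes "fps_alg S G"
  shows "(\<lambda>_. c, fps_const c) \<in> G"
    and "(f, s) \<in> G \<Longrightarrow> (g, t) \<in> G \<Longrightarrow> (\<lambda>x. f x + g x, s + t) \<in> G"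
    and "(f, s) \<in> G \<Longrightarrow> (g, t) \<in> G \<Longrightarrow> (\<lambda>x. f x * g x, s * t) \<in> G"
    and "(f, s) \<in> G \<Longrightarrow> \<exists>M. \<forall>x\<in>S. norm (f x) \<le> M"
  using assms unfolding fps_alg_def by blast+

lemma fps_alg_scale:
  assumes "fps_alg S G" "(f, s) \<in> G"
  shows "(\<lambda>x. c * f x, fps_const c * s) \<in> G"
  using fps_algD(3)[OF assms(1) fps_algD(1)[OF assms(1)] assms(2)] .

lemma fps_alg_diff:
  assumes "fps_alg S G" "(f, s) \<in> G" "(g, t) \<in> G"
  shows "(\<lambda>x. f x - g x, s - t) \<in> G"
proof -
  have "fps_const (- 1) * t = - t"
    by (simp add: fps_const_neg [symmetric] del: fps_const_neg)
  with fps_algD(2)[OF assms(1,2) fps_alg_scale[OF assms(1,3), of "-1"]] show ?thesis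
    by simp
qed

lemma fps_boundedE:
  assumes "fps_bounded S G"
  obtains C where "0 \<le> C"
    "\<And>f s M. (f, s) \<in> G \<Longrightarrow> (\<And>x. x \<in> S \<Longrightarrow> norm (f x) \<le> M) \<Longrightarrow> 0 \<le> M \<Longrightarrow> norm (fps_nth s k) \<le> C * M"
proof -
  obtain C where C: "\<And>f s M. (f, s) \<in> G \<Longrightarrow> (\<forall>x\<in>S. norm (f x) \<le> M) \<Longrightarrow> 0 \<le> M \<Longrightarrow> norm (fps_nth s k) \<le> C * M"
    using assms unfolding fps_bounded_def by meson
  show ?thesis
  proof (rule that[of "max C 0"])
    fix f s and M :: real
    assume "(f, s) \<in> G" "\<And>x. x \<in> S \<Longrightarrow> norm (f x) \<le> M" "0 \<le> M"
    then have "norm (fps_nth s k) \<le> C * M" using C by blast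
    also have "\<dots> \<le> max C 0 * M" using \<open>0 \<le> M\<close> by (intro mult_right_mono) auto
    finally show "norm (fps_nth s k) \<le> max C 0 * M" .
  qed simp
qed

lemma fps_closureD:
  assumes "(f, s) \<in> fps_closure S G" "0 < e"
  obtains g t where "(g, t) \<in> G" "\<And>x. x \<in> S \<Longrightarrow> norm (f x - g x) \<le> e"
    "\<And>k. k \<le> n \<Longrightarrow> norm (fps_nth s k - fps_nth t k) \<le> e"
proof -
  have "\<exists>g t. (g, t) \<in> G \<and> (\<forall>x\<in>S. norm (f x - g x) \<le> e) \<and> (\<forall>k\<le>n. norm (fps_nth s k - fps_nth t k) \<le> e)"
    using assms unfolding fps_closure_def by simp
  then show ?thesis using that by blast
qed

lemma fps_closure_superset: "G \<subseteq> fps_closure S G"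
proof (clarify)
  fix f s assume "(f, s) \<in> G"
  then show "(f, s) \<in> fps_closure S G"
    unfolding fps_closure_def
    by (clarify) (rule exI[of _ f], rule exI[of _ s], simp)
qed

lemma fps_closure_antimono: "T \<subseteq> S \<Longrightarrow> fps_closure S G \<subseteq> fps_closure T G"
proof clarify
  fix f s assume "T \<subseteq> S" "(f, s) \<in> fps_closure S G"
  then show "(f, s) \<in> fps_closure T G"
    unfolding fps_closure_def by (simp only: mem_Collect_eq prod.case) (meson subsetD)
qed

lemma fps_closure_mono: "G \<subseteq> H \<Longrightarrow> fps_closure S G \<subseteq> fps_closure S H"
proof clarify
  fix f s assume "G \<subseteq> H" "(f, s) \<in> fps_closure S G"
  then show "(f, s) \<in> fps_closure S H"
    unfolding fps_closure_def by (simp only: mem_Collect_eq prod.case) (meson subsetD)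
qed

text \<open>An approximant is bounded by \<open>M + d\<close> on \<open>S\<close> and its
  coefficient is off by at most \<open>d\<close>. The resulting error \<open>C * d + d\<close> is
  arbitrarily small, so the constant \<open>C\<close> itself survives.\<close>

lemma fps_closure_bound:
  assumes G: "\<And>f s M. (f, s) \<in> G \<Longrightarrow> (\<And>x. x \<in> S \<Longrightarrow> norm (f x) \<le> M) \<Longrightarrow> 0 \<le> M \<Longrightarrow> norm (fps_nth s k) \<le> C * M"
    and "0 \<le> C" "(f, s) \<in> fps_closure S G" "\<And>x. x \<in> S \<Longrightarrow> norm (f x) \<le> M" "0 \<le> M"
  shows "norm (fps_nth s k) \<le> C * M"
proof (rule field_le_epsilon)
  fix e :: real assume "0 < e"
  define d where "d = e / (C + 1)"
  have "(C + 1) * d = e" using \<open>0 \<le> C\<close> by (simp add: d_def)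
  moreover have "0 < d" using \<open>0 < e\<close> \<open>0 \<le> C\<close> by (simp add: d_def)
  ultimately have d: "0 < d" "C * d + d = e" by (simp_all add: distrib_right)
  obtain g t where gt: "(g, t) \<in> G" "\<And>x. x \<in> S \<Longrightarrow> norm (f x - g x) \<le> d"
    "\<And>j. j \<le> k \<Longrightarrow> norm (fps_nth s j - fps_nth t j) \<le> d"
    by (rule fps_closureD[OF assms(3) d(1), where n=k]) blast
  have "norm (g x) \<le> M + d" if "x \<in> S" for x
    using gt(2)[OF that] assms(4)[OF that] norm_triangle_ineq3[of "f x" "g x"] by linarith
  then have "norm (fps_nth t k) \<le> C * (M + d)"
    using G[OF gt(1)] d(1) \<open>0 \<le> M\<close> by simp
  moreover have "norm (fps_nth s k) \<le> norm (fps_nth t k) + d"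
    using gt(3)[of k] norm_triangle_ineq2[of "fps_nth s k" "fps_nth t k"] by simp
  ultimately show "norm (fps_nth s k) \<le> C * M + e"
    using d(2) by (simp add: algebra_simps)
qed

lemma fps_bounded_closure:
  assumes "fps_bounded S G"
  shows "fps_bounded S (fps_closure S G)"
  unfolding fps_bounded_def
proof
  fix k
  obtain C where C: "0 \<le> C"
    "\<And>f s M. (f, s) \<in> G \<Longrightarrow> (\<And>x. x \<in> S \<Longrightarrow> norm (f x) \<le> M) \<Longrightarrow> 0 \<le> M \<Longrightarrow> norm (fps_nth s k) \<le> C * M"
    by (rule fps_boundedE[OF assms, where k=k]) blast
  show "\<exists>C. \<forall>f s M. (f, s) \<in> fps_closure S G \<longrightarrow> (\<forall>x\<in>S. norm (f x) \<le> M) \<longrightarrow> 0 \<le> M \<longrightarrow> norm (fps_nth s k) \<le> C * M"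
  proof (intro exI allI impI)
    fix f s and M :: real
    assume "(f, s) \<in> fps_closure S G" "\<forall>x\<in>S. norm (f x) \<le> M" "0 \<le> M"
    then show "norm (fps_nth s k) \<le> C * M"
      by (intro fps_closure_bound[OF C(2) C(1)]) auto
  qed
qed

lemma fps_closure_eval:
  assumes "\<And>f s. (f, s) \<in> G \<Longrightarrow> fps_nth s 0 = f a" "a \<in> S" and f: "(f, s) \<in> fps_closure S G"
  shows "fps_nth s 0 = f a"
proof -
  have "norm (fps_nth s 0 - f a) \<le> 0"
  proof (rule field_le_epsilon)
    fix e :: real assume "0 < e"
    then have "0 < e / 2" by simp
    then obtain g t where g: "(g, t) \<in> G" "\<And>x. x \<in> S \<Longrightarrow> norm (f x - g x) \<le> e / 2"
      "\<And>k. k \<le> 0 \<Longrightarrow> norm (fps_nth s k - fps_nth t k) \<le> e / 2"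
      by (rule fps_closureD[OF f, where n = 0]) blast
    have "norm (fps_nth s 0 - f a) \<le> norm (fps_nth s 0 - fps_nth t 0) + norm (f a - g a)"
      using norm_triangle_ineq4[of "fps_nth s 0 - fps_nth t 0" "f a - g a"] assms(1)[OF g(1)] by simp
    then show "norm (fps_nth s 0 - f a) \<le> 0 + e" using g(2)[OF assms(2)] g(3)[of 0] by simp
  qed
  then show ?thesis by simp
qed

lemma fps_closure_cong:
  assumes "(f, s) \<in> fps_closure S G" "\<And>x. x \<in> S \<Longrightarrow> f x = f' x"
  shows "(f', s) \<in> fps_closure S G"
  using assms unfolding fps_closure_def by simp

lemma norm_mult_diff_le:
  fixes a b c d :: "'a::real_normed_algebra"
  assumes "norm a \<le> M" "norm b \<le> M" "norm (a - c) \<le> e" "norm (b - d) \<le> e" "e \<le> 1"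
  shows "norm (a * b - c * d) \<le> (2 * M + 1) * e"
proof -
  have "0 \<le> e" "0 \<le> M"
    using order_trans[OF norm_ge_zero assms(3)] order_trans[OF norm_ge_zero assms(1)] by simp_all
  have "norm d \<le> M + 1"
    using assms(2,4,5) norm_triangle_ineq3[of b d] by linarith
  have "a * b - c * d = a * (b - d) + (a - c) * d" by (simp add: algebra_simps)
  then have "norm (a * b - c * d) \<le> norm (a * (b - d)) + norm ((a - c) * d)"
    using norm_triangle_ineq by metis
  moreover have "norm (a * (b - d)) \<le> M * e"
    by (rule order_trans[OF norm_mult_ineq mult_mono[OF assms(1,4) \<open>0 \<le> M\<close> norm_ge_zero]])
  moreover have "norm ((a - c) * d) \<le> e * (M + 1)"
    by (rule order_trans[OF norm_mult_ineq mult_mono[OF assms(3) \<open>norm d \<le> M + 1\<close> \<open>0 \<le> e\<close> norm_ge_zero]])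
  moreover have "M * e + e * (M + 1) = (2 * M + 1) * e" by (simp add: algebra_simps)
  ultimately show ?thesis by linarith
qed

lemma fps_closure_bdd:
  assumes G: "fps_alg S G" and f: "(f, s) \<in> fps_closure S G"
  shows "\<exists>M. \<forall>x\<in>S. norm (f x) \<le> M"
proof -
  obtain g t where g: "(g, t) \<in> G" "\<And>x. x \<in> S \<Longrightarrow> norm (f x - g x) \<le> 1"
    by (rule fps_closureD[OF f zero_less_one, where n=0]) blast
  obtain M where M: "\<forall>x\<in>S. norm (g x) \<le> M" using fps_algD(4)[OF G g(1)] by blast
  show ?thesis
  proof (intro exI ballI)
    fix x assume "x \<in> S"
    then have "norm (f x - g x) \<le> 1" "norm (g x) \<le> M" using g(2) M by auto
    then show "norm (f x) \<le> M + 1"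
      using norm_triangle_ineq2[of "f x" "g x"] by linarith
  qed
qed

lemma fps_alg_closure:
  assumes G: "fps_alg S G"
  shows "fps_alg S (fps_closure S G)"
  unfolding fps_alg_def
proof (intro conjI allI impI)
  fix c show "(\<lambda>_. c, fps_const c) \<in> fps_closure S G"
    using fps_algD(1)[OF G] fps_closure_superset by blast
next
  fix f s assume f: "(f, s) \<in> fps_closure S G"
  show "\<exists>M. \<forall>x\<in>S. norm (f x) \<le> M" by (rule fps_closure_bdd[OF G f])
next
  fix f s g t assume f: "(f, s) \<in> fps_closure S G" and g: "(g, t) \<in> fps_closure S G"
  show "(\<lambda>x. f x + g x, s + t) \<in> fps_closure S G"
    unfolding fps_closure_def
  proof (clarify)
    fix n and e :: real assume "0 < e"
    then have e2: "0 < e / 2" by simp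
    obtain f' s' where 1: "(f', s') \<in> G" "\<And>x. x \<in> S \<Longrightarrow> norm (f x - f' x) \<le> e/2"
      "\<And>k. k \<le> n \<Longrightarrow> norm (fps_nth s k - fps_nth s' k) \<le> e/2"
      by (rule fps_closureD[OF f e2, where n=n]) blast
    obtain g' t' where 2: "(g', t') \<in> G" "\<And>x. x \<in> S \<Longrightarrow> norm (g x - g' x) \<le> e/2"
      "\<And>k. k \<le> n \<Longrightarrow> norm (fps_nth t k - fps_nth t' k) \<le> e/2"
      by (rule fps_closureD[OF g e2, where n=n]) blast
    have add: "norm (a + b - (c + d)) \<le> e" if "norm (a - c) \<le> e/2" "norm (b - d) \<le> e/2" for a b c d :: complex
      using norm_diff_triangle_ineq[of a b c d] that by linarith
    show "\<exists>h u. (h, u) \<in> G \<and> (\<forall>x\<in>S. norm (f x + g x - h x) \<le> e) \<and> (\<forall>k\<le>n. norm (fps_nth (s + t) k - fps_nth u k) \<le> e)"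
    proof (intro exI conjI ballI allI impI)
      show "(\<lambda>x. f' x + g' x, s' + t') \<in> G" by (rule fps_algD(2)[OF G 1(1) 2(1)])
    qed (use 1 2 in \<open>simp_all add: add\<close>)
  qed
  obtain M1 M2 where "\<forall>x\<in>S. norm (f x) \<le> M1" "\<forall>x\<in>S. norm (g x) \<le> M2"
    using fps_closure_bdd[OF G f] fps_closure_bdd[OF G g] by blast
  then have "\<exists>M. (\<forall>x\<in>S. norm (f x) \<le> M) \<and> (\<forall>x\<in>S. norm (g x) \<le> M)"
    by (intro exI[of _ "max M1 M2"]) fastforce
  then obtain M0 where M0: "\<forall>x\<in>S. norm (f x) \<le> M0" "\<forall>x\<in>S. norm (g x) \<le> M0" by blast
  show "(\<lambda>x. f x * g x, s * t) \<in> fps_closure S G"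
    unfolding fps_closure_def
  proof (clarify)
    fix n and e :: real assume "0 < e"
    \<comment> \<open>One \<open>M\<close> dominates both functions on \<open>S\<close> and all
      coefficients up to \<open>n\<close>, so the same product estimate serves the pointwise product
      and each term of the Cauchy product. The factor \<open>n + 1\<close> in \<open>d\<close>
      counts the terms of that sum.\<close>
    define M where "M = \<bar>M0\<bar> + (\<Sum>k\<le>n. norm (fps_nth s k)) + (\<Sum>k\<le>n. norm (fps_nth t k))"
    have nn: "0 \<le> (\<Sum>k\<le>n. norm (fps_nth s k))" "0 \<le> (\<Sum>k\<le>n. norm (fps_nth t k))"
      by (simp_all add: sum_nonneg)
    have Mf: "norm (f x) \<le> M" "norm (g x) \<le> M" if "x \<in> S" for x
      using bspec[OF M0(1) that] bspec[OF M0(2) that] nn unfolding M_def by linarith+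
    have Ms: "norm (fps_nth s k) \<le> M" "norm (fps_nth t k) \<le> M" if "k \<le> n" for k
      using nn that member_le_sum[of k "{..n}" "\<lambda>k. norm (fps_nth s k)"]
        member_le_sum[of k "{..n}" "\<lambda>k. norm (fps_nth t k)"]
      unfolding M_def by auto
    have M: "0 \<le> M" using nn unfolding M_def by simp
    define d where "d = min 1 (e / (real (n + 1) * (2 * M + 1)))"
    have d: "0 < d" "d \<le> 1" using \<open>0 < e\<close> M by (auto simp: d_def)
    have dn: "real (n + 1) * ((2 * M + 1) * d) \<le> e"
    proof -
      have "d \<le> e / (real (n + 1) * (2 * M + 1))" by (simp add: d_def)
      then have "d * (real (n + 1) * (2 * M + 1)) \<le> e"
        using M by (subst (asm) pos_le_divide_eq) (auto intro!: mult_pos_pos)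
      then show ?thesis by (simp add: mult_ac)
    qed
    have d1: "(2 * M + 1) * d \<le> e"
    proof -
      have "1 * ((2 * M + 1) * d) \<le> real (n + 1) * ((2 * M + 1) * d)"
        using M d by (intro mult_right_mono) auto
      then show ?thesis using dn by linarith
    qed
    obtain f' s' where 1: "(f', s') \<in> G" "\<And>x. x \<in> S \<Longrightarrow> norm (f x - f' x) \<le> d"
      "\<And>k. k \<le> n \<Longrightarrow> norm (fps_nth s k - fps_nth s' k) \<le> d"
      by (rule fps_closureD[OF f d(1), where n=n]) blast
    obtain g' t' where 2: "(g', t') \<in> G" "\<And>x. x \<in> S \<Longrightarrow> norm (g x - g' x) \<le> d"
      "\<And>k. k \<le> n \<Longrightarrow> norm (fps_nth t k - fps_nth t' k) \<le> d"
      by (rule fps_closureD[OF g d(1), where n=n]) blast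
    have "norm (f x * g x - f' x * g' x) \<le> e" if "x \<in> S" for x
      using norm_mult_diff_le[OF Mf[OF that] 1(2)[OF that] 2(2)[OF that] d(2)] d1 by linarith
    moreover have "norm (fps_nth (s * t) k - fps_nth (s' * t') k) \<le> e" if "k \<le> n" for k
    proof -
      have "norm (fps_nth (s * t) k - fps_nth (s' * t') k)
          = norm (\<Sum>i=0..k. fps_nth s i * fps_nth t (k - i) - fps_nth s' i * fps_nth t' (k - i))"
        by (simp add: fps_mult_nth sum_subtractf)
      also have "\<dots> \<le> (\<Sum>i=0..k. (2 * M + 1) * d)"
        using that d(2) by (intro sum_norm_le norm_mult_diff_le Ms 1(3) 2(3)) auto
      also have "\<dots> = real (k + 1) * ((2 * M + 1) * d)" by simp
      also have "\<dots> \<le> real (n + 1) * ((2 * M + 1) * d)"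
        using that M d by (intro mult_right_mono) auto
      finally show ?thesis using dn by linarith
    qed
    ultimately show "\<exists>h u. (h, u) \<in> G \<and> (\<forall>x\<in>S. norm (f x * g x - h x) \<le> e) \<and> (\<forall>k\<le>n. norm (fps_nth (s * t) k - fps_nth u k) \<le> e)"
      using fps_algD(3)[OF G 1(1) 2(1)]
      by (intro exI[of _ "\<lambda>x. f' x * g' x"] exI[of _ "s' * t'"] conjI ballI allI impI)
  qed
qed

text \<open>Applied to differences, \<open>fps_bounded\<close> turns uniform convergence into the
  Cauchy property of each coefficient, so a uniform limit acquires Taylor data. Functions obtained
  by pure approximation enter the closed algebra in this way, without any computation of
  coefficients.\<close>

lemma fps_closure_complete:
  assumes G: "fps_alg S G" and bd: "fps_bounded S G"
    and f: "\<And>e. 0 < e \<Longrightarrow> \<exists>g t. (g, t) \<in> G \<and> (\<forall>x\<in>S. norm (f x - g x) \<le> e)"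
  obtains s where "(f, s) \<in> fps_closure S G"
proof -
  have "\<exists>g t. (g, t) \<in> G \<and> (\<forall>x\<in>S. norm (f x - g x) \<le> inverse (Suc n))" for n :: nat
    by (rule f) simp
  then obtain g t where g: "\<And>n. (g n, t n) \<in> G" "\<And>n x. x \<in> S \<Longrightarrow> norm (f x - g n x) \<le> inverse (Suc n)"
    by metis
  have conv: "convergent (\<lambda>n. fps_nth (t n) k)" for k
  proof -
    obtain C where C: "0 \<le> C"
      "\<And>f s M. (f, s) \<in> G \<Longrightarrow> (\<And>x. x \<in> S \<Longrightarrow> norm (f x) \<le> M) \<Longrightarrow> 0 \<le> M \<Longrightarrow> norm (fps_nth s k) \<le> C * M"
      by (rule fps_boundedE[OF bd, where k=k]) blast
    have diff: "norm (fps_nth (t m) k - fps_nth (t n) k) \<le> C * (inverse (Suc m) + inverse (Suc n))" for m n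
    proof -
      have "norm (g m x - g n x) \<le> inverse (Suc m) + inverse (Suc n)" if "x \<in> S" for x
        using norm_triangle_ineq4[of "f x - g n x" "f x - g m x"] g(2)[OF that, of m] g(2)[OF that, of n] by simp
      then have "norm (fps_nth (t m - t n) k) \<le> C * (inverse (Suc m) + inverse (Suc n))"
        using C(2)[OF fps_alg_diff[OF G g(1)[of m] g(1)[of n]]] by simp
      then show ?thesis by simp
    qed
    have "Cauchy (\<lambda>n. fps_nth (t n) k)"
    proof (rule metric_CauchyI)
      fix e :: real assume "0 < e"
      define d where "d = e / (2 * (C + 1))"
      have "0 < d" using \<open>0 < e\<close> C by (simp add: d_def)
      then obtain N where N: "inverse (Suc N) < d"
        using reals_Archimedean by blast
      have "dist (fps_nth (t m) k) (fps_nth (t n) k) < e" if "N \<le> m" "N \<le> n" for m n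
      proof -
        have le: "inverse (real (Suc m)) < d" "inverse (real (Suc n)) < d"
          using that N by (auto intro!: le_less_trans[OF le_imp_inverse_le N])
        have "C * (inverse (Suc m) + inverse (Suc n)) \<le> C * (2 * d)"
          using le C by (intro mult_left_mono) auto
        also have "\<dots> < (C + 1) * (2 * d)" using \<open>0 < d\<close> by (simp add: algebra_simps)
        also have "\<dots> = e" using C by (simp add: d_def field_simps)
        finally show ?thesis using diff[of m n] by (simp add: dist_norm)
      qed
      then show "\<exists>N. \<forall>m\<ge>N. \<forall>n\<ge>N. dist (fps_nth (t m) k) (fps_nth (t n) k) < e" by blast
    qed
    then show ?thesis by (simp add: Cauchy_convergent_iff)
  qed
  define s where "s = Abs_fps (\<lambda>k. lim (\<lambda>n. fps_nth (t n) k))"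
  have lim: "(\<lambda>n. fps_nth (t n) k) \<longlonglongrightarrow> fps_nth s k" for k
    using conv[of k] by (simp add: s_def convergent_LIMSEQ_iff)
  have "(f, s) \<in> fps_closure S G"
    unfolding fps_closure_def
  proof clarify
    fix n and e :: real assume "0 < e"
    have "\<forall>\<^sub>F m in sequentially. \<forall>k\<in>{..n}. dist (fps_nth (t m) k) (fps_nth s k) < e"
      using lim \<open>0 < e\<close> by (intro eventually_ball_finite) (auto simp: tendsto_iff)
    moreover have "\<forall>\<^sub>F m in sequentially. inverse (real (Suc m)) < e"
      by (rule order_tendstoD(2)[OF LIMSEQ_inverse_real_of_nat \<open>0 < e\<close>])
    ultimately have "\<forall>\<^sub>F m in sequentially. (\<forall>k\<in>{..n}. dist (fps_nth (t m) k) (fps_nth s k) < e) \<and> inverse (real (Suc m)) < e"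
      by (rule eventually_conj)
    then obtain m where m: "\<forall>k\<in>{..n}. dist (fps_nth (t m) k) (fps_nth s k) < e" "inverse (real (Suc m)) < e"
      using eventually_happens'[OF sequentially_bot] by fast
    show "\<exists>g t. (g, t) \<in> G \<and> (\<forall>x\<in>S. norm (f x - g x) \<le> e) \<and> (\<forall>k\<le>n. norm (fps_nth s k - fps_nth t k) \<le> e)"
    proof (intro exI conjI ballI allI impI)
      show "(g m, t m) \<in> G" by (rule g)
      show "norm (f x - g m x) \<le> e" if "x \<in> S" for x
        using g(2)[OF that, of m] m(2) by linarith
      show "norm (fps_nth s k - fps_nth (t m) k) \<le> e" if "k \<le> n" for k
        using bspec[OF m(1), of k] that by (simp add: dist_norm norm_minus_commute)
    qed
  qed
  then show ?thesis by (rule that)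
qed

text \<open>The difference is bounded by 0 on \<open>S\<close>, so boundedness annihilates all its
  coefficients.\<close>

lemma fps_alg_unique:
  assumes G: "fps_alg S G" and bd: "fps_bounded S G"
    and "(f, s) \<in> G" "(g, t) \<in> G" "\<And>x. x \<in> S \<Longrightarrow> f x = g x"
  shows "s = t"
proof (rule fps_ext)
  fix k
  obtain C where C:
      "\<And>f s M. (f, s) \<in> G \<Longrightarrow> (\<And>x. x \<in> S \<Longrightarrow> norm (f x) \<le> M) \<Longrightarrow> 0 \<le> M \<Longrightarrow> norm (fps_nth s k) \<le> C * M"
    by (rule fps_boundedE[OF bd, where k=k]) blast
  have "norm (fps_nth (s - t) k) \<le> C * 0"
    using C[OF fps_alg_diff[OF G assms(3,4)], of 0] assms(5) by simp
  then show "fps_nth s k = fps_nth t k" by simp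
qed

section \<open>Taylor coefficients on Swiss cheeses\<close>

text \<open>The discs around removed points may overlap, whereas residues are to be collected on
  disjoint circles that avoid all of them. Enclosing discs of radius \<open>sum r S\<close> keep the
  total circumference unchanged, and the final estimate is measured by that length.\<close>

lemma merge_discs:
  fixes p :: "'i \<Rightarrow> 'a::real_normed_vector"
  assumes fin: "finite J" and r: "\<And>j. j \<in> J \<Longrightarrow> 0 < r j"
  shows "\<exists>P c. partition_on J P \<and> (\<forall>S\<in>P. \<forall>j\<in>S. dist (c S) (p j) + r j \<le> sum r S) \<and>
    (\<forall>S\<in>P. \<forall>T\<in>P. S \<noteq> T \<longrightarrow> sum r S + sum r T < dist (c S) (c T))"
proof -
  \<comment> \<open>In a partition of least cardinality, two enclosing discs cannot meet: they could be merged.\<close>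
  define Q where "Q P \<longleftrightarrow> partition_on J P \<and> (\<forall>S\<in>P. \<exists>a. \<forall>j\<in>S. dist a (p j) + r j \<le> sum r S)" for P
  have "Q ((\<lambda>j. {j}) ` J)"
    unfolding Q_def by (auto simp: partition_on_singletons intro: exI[of _ "p j" for j])
  then obtain P where P: "Q P" and least: "\<And>P'. Q P' \<Longrightarrow> card P \<le> card P'"
    using ex_has_least_nat[of Q _ card] by blast
  from P obtain c where part: "partition_on J P"
    and c: "\<And>S j. S \<in> P \<Longrightarrow> j \<in> S \<Longrightarrow> dist (c S) (p j) + r j \<le> sum r S"
    unfolding Q_def by metis
  have finP: "finite P" using finite_elements[OF fin part] .
  have sub: "S \<subseteq> J" "finite S" "S \<noteq> {}" if "S \<in> P" for S
    using that part fin by (auto simp: partition_on_def intro: finite_subset)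
  have "sum r S + sum r T < dist (c S) (c T)" if ST: "S \<in> P" "T \<in> P" "S \<noteq> T" for S T
  proof (rule ccontr)
    assume "\<not> ?thesis"
    then have le: "dist (c S) (c T) \<le> sum r S + sum r T" by simp
    have disj: "S \<inter> T = {}" using part ST by (auto simp: partition_on_def disjoint_def)
    have "0 < sum r U" if "U \<in> P" for U
      using sub[OF that] r by (intro sum_pos) auto
    then have pos: "0 < sum r S" "0 < sum r T" using ST by auto
    define R where "R = sum r S + sum r T"
    have R: "0 < R" "sum r (S \<union> T) = R"
      using pos disj sub ST by (auto simp: R_def sum.union_disjoint)
    define l where "l = sum r T / R"
    have l: "0 \<le> l" "l \<le> 1" "l * R = sum r T" "(1 - l) * R = sum r S"
      using pos R(1) by (auto simp: l_def R_def field_simps)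
    \<comment> \<open>Moving from \<open>c S\<close> towards \<open>c T\<close> by the fraction
      \<open>sum r T / R\<close> leaves \<open>a\<close> within \<open>sum r T\<close> of
      \<open>c S\<close> and within \<open>sum r S\<close> of \<open>c T\<close>, so the disc of
      radius \<open>R\<close> about \<open>a\<close> contains both discs.\<close>
    define a where "a = (1 - l) *\<^sub>R c S + l *\<^sub>R c T"
    have "a - c S = l *\<^sub>R (c T - c S)" "a - c T = (1 - l) *\<^sub>R (c S - c T)"
      by (simp_all add: a_def algebra_simps)
    then have "dist a (c S) = l * dist (c S) (c T)" "dist a (c T) = (1 - l) * dist (c S) (c T)"
      using l by (simp_all add: dist_norm norm_minus_commute)
    then have a: "dist a (c S) \<le> sum r T" "dist a (c T) \<le> sum r S"
      using le l mult_left_mono[OF le, of l] mult_left_mono[OF le, of "1 - l"]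
      by (simp_all add: R_def)
    define P' where "P' = insert (S \<union> T) (P - {S, T})"
    have "partition_on J P'"
    proof (rule partition_onI)
      show "\<Union> P' = J" using part ST by (auto simp: P'_def partition_on_def)
      show "{} \<notin> P'" using part sub ST by (auto simp: P'_def partition_on_def)
      have dP: "disjnt U V" if "U \<in> P" "V \<in> P" "U \<noteq> V" for U V
        using that part by (auto simp: partition_on_def disjoint_def disjnt_def)
      have dST: "disjnt (S \<union> T) V" if "V \<in> P" "V \<noteq> S" "V \<noteq> T" for V
        using dP[OF ST(1) that(1)] dP[OF ST(2) that(1)] that(2,3) by (simp add: disjnt_Un1)
      fix U V assume "U \<in> P'" "V \<in> P'" "U \<noteq> V"
      then consider "U = S \<union> T" "V \<in> P" "V \<noteq> S" "V \<noteq> T" | "V = S \<union> T" "U \<in> P" "U \<noteq> S" "U \<noteq> T"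
        | "U \<in> P" "V \<in> P" "U \<noteq> V"
        unfolding P'_def by blast
      then show "disjnt U V"
        by cases (use dST dP disjnt_sym in blast)+
    qed
    moreover have "\<forall>U\<in>P'. \<exists>a. \<forall>j\<in>U. dist a (p j) + r j \<le> sum r U"
    proof
      fix U assume "U \<in> P'"
      then consider "U = S \<union> T" | "U \<in> P" unfolding P'_def by auto
      then show "\<exists>a. \<forall>j\<in>U. dist a (p j) + r j \<le> sum r U"
      proof cases
        case 1
        have "dist a (p j) + r j \<le> R" if "j \<in> S \<union> T" for j
        proof (cases "j \<in> S")
          case True
          then show ?thesis
            using c[OF ST(1) True] a(1) dist_triangle[of a "p j" "c S"] unfolding R_def by linarith
        next
          case False
          then have "j \<in> T" using that by simp
          then show ?thesis
            using c[OF ST(2) \<open>j \<in> T\<close>] a(2) dist_triangle[of a "p j" "c T"] unfolding R_def by linarith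
        qed
        then show ?thesis using 1 R(2) by blast
      qed (use c in blast)
    qed
    ultimately have "card P \<le> card P'" by (intro least) (simp add: Q_def)
    moreover have "card P' < card P"
    proof -
      have "card P' \<le> Suc (card (P - {S, T}))" unfolding P'_def by (rule card_insert_le_m1) auto
      moreover have "card (P - {S, T}) = card P - 2"
        using ST finP by (subst card_Diff_subset) auto
      moreover have "2 \<le> card P"
        using card_mono[OF finP, of "{S, T}"] ST by simp
      ultimately show ?thesis by linarith
    qed
    ultimately show False by simp
  qed
  note sep = this
  show ?thesis
    by (intro exI[of _ P] exI[of _ c] conjI ballI impI part c sep)
qed

text \<open>Under \<open>w = 1 / z\<close> the form \<open>dw / w\<close> becomes
  \<open>- dz / z\<close> and the circle is reversed. The signs cancel, and Cauchy's formula for the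
  \<open>k\<close>-th coefficient on the circle of radius \<open>\<rho>\<close> remains.\<close>

lemma contour_integral_inverse_circle:
  fixes f :: "complex \<Rightarrow> complex"
  assumes "0 < \<rho>" "continuous_on (cball 0 \<rho>) f" "f holomorphic_on ball 0 \<rho>" "f has_fps_expansion s"
  shows "contour_integral (circlepath 0 (1 / \<rho>)) (\<lambda>w. f (1 / w) * w ^ k / w) = 2 * pi * \<i> * fps_nth s k"
proof -
  define F where "F = (\<lambda>z. f z / (z - 0) ^ Suc k)"
  define e where "e = (\<lambda>x::real. exp (2 * of_real pi * \<i> * of_real x))"
  have e_minus: "e (1 - x) = 1 / e x" for x
    by (simp add: e_def algebra_simps exp_diff)
  have e0: "e x \<noteq> 0" for x by (simp add: e_def)
  let ?g = "reversepath (circlepath 0 \<rho>)"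
  have g: "?g x = \<rho> / e x" for x
    using e_minus[of x] by (simp add: reversepath_def circlepath e_def)
  have g': "vector_derivative ?g (at x) = - (2 * pi * \<i> * \<rho> / e x)" for x
  proof (rule vector_derivative_at)
    have "(circlepath 0 \<rho> \<circ> (\<lambda>x. 1 - x) has_vector_derivative (-1) *\<^sub>R (2 * pi * \<i> * \<rho> * e (1 - x))) (at x)"
      unfolding e_def
      by (intro vector_diff_chain_at has_vector_derivative_circlepath) (auto intro!: derivative_eq_intros)
    then show "(?g has_vector_derivative - (2 * pi * \<i> * \<rho> / e x)) (at x)"
      by (simp add: reversepath_def o_def e_minus)
  qed
  have "contour_integral (circlepath 0 (1 / \<rho>)) (\<lambda>w. f (1 / w) * w ^ k / w)
      = integral {0..1} (\<lambda>x. f (\<rho> / e x) * (e x / \<rho>) ^ k / (e x / \<rho>) * (2 * pi * \<i> * (e x / \<rho>)))"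
    unfolding contour_integral_integral vector_derivative_circlepath
    by (simp add: circlepath e_def mult_ac)
  also have "\<dots> = integral {0..1} (\<lambda>x. - (F (?g x) * vector_derivative ?g (at x)))"
    using assms(1) by (simp add: g' F_def g e0 field_simps)
  also have "\<dots> = - contour_integral ?g F"
    unfolding contour_integral_integral by simp
  also have "\<dots> = contour_integral (circlepath 0 \<rho>) F"
    by (simp add: contour_integral_reversepath)
  also have "\<dots> = 2 * pi * \<i> * (deriv ^^ k) f 0 / fact k"
    unfolding F_def using assms by (intro Cauchy_contour_integral_circlepath) auto
  also have "\<dots> = 2 * pi * \<i> * fps_nth s k"
    by (simp add: fps_nth_fps_expansion[OF assms(4)])
  finally show ?thesis .
qed

section \<open>Swiss cheeses in the coordinate 1/z\<close>

text \<open>The inequality is \<open>r j \<le> norm (1 / z - p j)\<close> multiplied by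
  \<open>norm z\<close>: in the coordinate \<open>w = 1 / z\<close> the open disc about
  \<open>p j\<close> is removed. In this form \<open>z = 0\<close>, that is
  \<open>w = \<infinity>\<close>, always belongs to the set, and a radius 0 removes nothing.\<close>

definition swiss :: "('i \<Rightarrow> complex) \<Rightarrow> ('i \<Rightarrow> real) \<Rightarrow> 'i set \<Rightarrow> complex set" where
  "swiss p r J = {z. \<forall>j\<in>J. r j * norm z \<le> norm (1 - p j * z)}"

text \<open>The singularities may be essential, since only residues are taken at them. Nothing is
  prescribed at \<open>z = \<infinity>\<close>; this is \<open>w = 0\<close>, which is covered by a
  removed disc in every application.\<close>

definition merom_on :: "complex set \<Rightarrow> ((complex \<Rightarrow> complex) \<times> complex fps) set" where
  "merom_on K = {(f, s). \<exists>P. finite P \<and> P \<inter> K = {} \<and> f holomorphic_on - P \<and> f has_fps_expansion s}"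

lemma zero_in_swiss [simp]: "0 \<in> swiss p r J"
  by (simp add: swiss_def)

lemma closed_swiss: "closed (swiss p r J)"
proof -
  have "swiss p r J = (\<Inter>j\<in>J. {z. r j * norm z \<le> norm (1 - p j * z)})" by (auto simp: swiss_def)
  also have "closed \<dots>"
    by (intro closed_INT ballI closed_Collect_le continuous_intros)
  finally show ?thesis .
qed

lemma inverse_in_swiss_iff:
  assumes "w \<noteq> 0"
  shows "1 / w \<in> swiss p r J \<longleftrightarrow> (\<forall>j\<in>J. w \<notin> ball (p j) (r j))"
proof -
  have "r j * norm (1 / w) \<le> norm (1 - p j * (1 / w)) \<longleftrightarrow> w \<notin> ball (p j) (r j)" for j
  proof -
    have "1 - p j * (1 / w) = (w - p j) / w" using assms by (simp add: field_simps)
    then have "norm (1 - p j * (1 / w)) = norm (w - p j) / norm w" by (simp add: norm_divide)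
    then show ?thesis using assms by (simp add: norm_divide divide_simps dist_norm norm_minus_commute not_less)
  qed
  then show ?thesis by (simp add: swiss_def)
qed

lemma contour_integral_circle_residues:
  fixes h :: "complex \<Rightarrow> complex"
  assumes "finite Q" "h holomorphic_on - Q" "0 < R" "sphere a R \<inter> Q = {}"
  shows "contour_integral (circlepath a R) h = 2 * pi * \<i> * (\<Sum>q\<in>Q \<inter> ball a R. residue h q)"
proof -
  have "contour_integral (circlepath a R) h
      = 2 * pi * \<i> * (\<Sum>q\<in>Q. winding_number (circlepath a R) q * residue h q)"
    using assms by (intro Residue_theorem[where S = UNIV]) (auto simp: Compl_eq_Diff_UNIV)
  also have "(\<Sum>q\<in>Q. winding_number (circlepath a R) q * residue h q) = (\<Sum>q\<in>Q \<inter> ball a R. residue h q)"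
  proof (rule sum.mono_neutral_cong_right)
    show "\<forall>q\<in>Q - Q \<inter> ball a R. winding_number (circlepath a R) q * residue h q = 0"
    proof
      fix q assume "q \<in> Q - Q \<inter> ball a R"
      then have "q \<notin> cball a R" using assms(4) by (auto simp: sphere_def)
      then have "winding_number (circlepath a R) q = 0"
        using assms(3) by (intro winding_number_zero_outside[of _ "cball a R"]) auto
      then show "winding_number (circlepath a R) q * residue h q = 0" by simp
    qed
    show "winding_number (circlepath a R) q * residue h q = residue h q" if "q \<in> Q \<inter> ball a R" for q
      using that by (simp add: winding_number_circlepath dist_norm norm_minus_commute)
  qed (use assms in auto)
  finally show ?thesis .
qed

text \<open>A huge circle in \<open>w\<close> yields the coefficient, and by residues its integral
  equals the sum over the merged circles. There \<open>1 / w\<close> lies in the cheese, so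
  \<open>f\<close> is at most \<open>M\<close>; \<open>norm w\<close> is at least
  \<open>r j0\<close> and at most \<open>norm (p j) + 2 * sum r J\<close> for each enclosed
  \<open>j\<close>; and the length splits into the parts \<open>2 * pi * r j\<close>. The estimate
  sees \<open>J\<close> only through sums over the radii, which is why it survives the passage to
  infinitely many discs.\<close>

lemma merom_bound_finite:
  assumes fin: "finite J" and r: "\<And>j. j \<in> J \<Longrightarrow> 0 < r j" and j0: "j0 \<in> J" "p j0 = 0"
    and P: "finite P" "P \<inter> swiss p r J = {}" "f holomorphic_on - P" and s: "f has_fps_expansion s"
    and M: "\<And>z. z \<in> swiss p r J \<Longrightarrow> norm (f z) \<le> M"
  shows "norm (fps_nth s k) \<le> (\<Sum>j\<in>J. r j * (norm (p j) + 2 * sum r J) ^ k) / r j0 * M"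
proof -
  obtain Pt c where Pt: "partition_on J Pt"
    and in_disc: "\<And>S j. S \<in> Pt \<Longrightarrow> j \<in> S \<Longrightarrow> dist (c S) (p j) + r j \<le> sum r S"
    and apart: "\<And>S T. S \<in> Pt \<Longrightarrow> T \<in> Pt \<Longrightarrow> S \<noteq> T \<Longrightarrow> sum r S + sum r T < dist (c S) (c T)"
    using merge_discs[of J r p, OF fin r] by metis
  have finPt: "finite Pt" using finite_elements[OF fin Pt] .
  have sub: "S \<subseteq> J" "finite S" "S \<noteq> {}" if "S \<in> Pt" for S
    using that Pt fin by (auto simp: partition_on_def intro: finite_subset)
  have cover: "\<exists>S\<in>Pt. j \<in> S" if "j \<in> J" for j
    using that Pt by (auto simp: partition_on_def)
  have Rpos: "0 < sum r S" if "S \<in> Pt" for S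
    using sub[OF that] r by (intro sum_pos) auto
  have Rle: "sum r S \<le> sum r J" if "S \<in> Pt" for S
    using sub[OF that] fin r by (intro sum_mono2) (auto intro: less_imp_le)
  have r0: "0 < r j0" using r j0 by simp
  have M0: "0 \<le> M" using order_trans[OF norm_ge_zero M[of 0]] by simp
  define h where "h w = f (1 / w) * w ^ k / w" for w
  \<comment> \<open>The point 0 is included because of the factor \<open>1 / w\<close> and because
    \<open>f (1 / w)\<close> is uncontrolled there; the disc of \<open>j0\<close> contains
    it.\<close>
  define Q where "Q = insert 0 ((\<lambda>z. 1 / z) ` P)"
  have finQ: "finite Q" using P by (simp add: Q_def)
  have "0 \<notin> P" using P(2) by auto
  have inP: "1 / w \<notin> P" if "w \<notin> Q" for w
  proof
    assume "1 / w \<in> P"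
    then have "1 / (1 / w) \<in> Q" unfolding Q_def by blast
    then show False using that by simp
  qed
  have holo: "h holomorphic_on - Q"
  proof -
    have "(f \<circ> (\<lambda>w. 1 / w)) holomorphic_on - Q"
      using inP by (intro holomorphic_on_compose_gen[OF _ P(3)] holomorphic_intros) (auto simp: Q_def)
    then show ?thesis
      unfolding h_def o_def by (intro holomorphic_intros) (auto simp: Q_def)
  qed
  have Q_disc: "\<exists>j\<in>J. q \<in> ball (p j) (r j)" if "q \<in> Q" for q
  proof (cases "q = 0")
    case True
    then show ?thesis using j0 r0 by (intro bexI[of _ j0]) auto
  next
    case False
    then have "1 / q \<in> P" using that unfolding Q_def by auto
    then show ?thesis using P(2) inverse_in_swiss_iff[OF False, of p r J] by blast
  qed
  have in_ball: "w \<in> ball (c S) (sum r S)" if "S \<in> Pt" "j \<in> S" "w \<in> ball (p j) (r j)" for S j w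
    using that in_disc[OF that(1,2)] dist_triangle[of "c S" w "p j"] by simp
  have sphere: "\<forall>j\<in>J. w \<notin> ball (p j) (r j)" if S: "S \<in> Pt" "w \<in> sphere (c S) (sum r S)" for S w
  proof (intro ballI notI)
    fix j assume j: "j \<in> J" "w \<in> ball (p j) (r j)"
    then obtain T where T: "T \<in> Pt" "j \<in> T" using cover by blast
    have wT: "w \<in> ball (c T) (sum r T)" by (rule in_ball[OF T j(2)])
    show False
    proof (cases "T = S")
      case True then show ?thesis using wT S(2) by simp
    next
      case False
      then show ?thesis
        using apart[OF S(1) T(1)] wT S(2) dist_triangle[of "c S" "c T" w] by (simp add: dist_commute)
    qed
  qed
  have sphereQ: "sphere (c S) (sum r S) \<inter> Q = {}" if "S \<in> Pt" for S
    using sphere[OF that] Q_disc by blast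
  have circ: "contour_integral (circlepath (c S) (sum r S)) h
      = 2 * pi * \<i> * (\<Sum>q\<in>Q \<inter> ball (c S) (sum r S). residue h q)" if "S \<in> Pt" for S
    by (intro contour_integral_circle_residues finQ holo Rpos[OF that] sphereQ[OF that])
  obtain e where e: "0 < e" "ball 0 e \<subseteq> - P"
    using \<open>0 \<notin> P\<close> finite_imp_closed[OF P(1)] open_contains_ball[of "- P"] by (auto simp: open_Compl)
  \<comment> \<open>Small enough for the circle of radius \<open>1 / \<rho>\<close> in
    \<open>w\<close> to enclose all of \<open>Q\<close>.\<close>
  define \<rho> where "\<rho> = e / 2"
  have "cball 0 \<rho> \<subseteq> ball (0::complex) e" using e(1) by (auto simp: \<rho>_def)
  then have \<rho>: "0 < \<rho>" "cball 0 \<rho> \<subseteq> - P"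
    using e by (simp_all add: \<rho>_def)
  have Q_small: "norm q < 1 / \<rho>" if "q \<in> Q" for q
  proof (cases "q = 0")
    case False
    then have "1 / q \<in> P" using that unfolding Q_def by auto
    then have "1 / q \<notin> cball 0 \<rho>" using \<rho>(2) by blast
    then have "\<rho> < norm (1 / q)" by simp
    then show ?thesis using False \<rho> by (simp add: norm_divide field_simps)
  qed (use \<rho> in simp)
  have "2 * pi * \<i> * fps_nth s k = contour_integral (circlepath 0 (1 / \<rho>)) h"
    unfolding h_def
    using holomorphic_on_subset[OF P(3)] \<rho> s
    by (intro contour_integral_inverse_circle[symmetric] holomorphic_on_imp_continuous_on) (auto simp: subset_iff)
  also have "\<dots> = 2 * pi * \<i> * (\<Sum>q\<in>Q \<inter> ball 0 (1 / \<rho>). residue h q)"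
    using Q_small \<rho> by (intro contour_integral_circle_residues finQ holo) force+
  also have "Q \<inter> ball 0 (1 / \<rho>) = (\<Union>S\<in>Pt. Q \<inter> ball (c S) (sum r S))"
  proof
    show "Q \<inter> ball 0 (1 / \<rho>) \<subseteq> (\<Union>S\<in>Pt. Q \<inter> ball (c S) (sum r S))"
    proof
      fix q assume q: "q \<in> Q \<inter> ball 0 (1 / \<rho>)"
      then obtain j where j: "j \<in> J" "q \<in> ball (p j) (r j)" using Q_disc by blast
      then obtain S where S: "S \<in> Pt" "j \<in> S" using cover by blast
      show "q \<in> (\<Union>S\<in>Pt. Q \<inter> ball (c S) (sum r S))"
        using q S(1) in_ball[OF S j(2)] by blast
    qed
  qed (use Q_small in auto)
  also have "(\<Sum>q\<in>\<dots>. residue h q) = (\<Sum>S\<in>Pt. \<Sum>q\<in>Q \<inter> ball (c S) (sum r S). residue h q)"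
  proof (rule sum.UNION_disjoint)
    show "\<forall>S\<in>Pt. \<forall>T\<in>Pt. S \<noteq> T \<longrightarrow> Q \<inter> ball (c S) (sum r S) \<inter> (Q \<inter> ball (c T) (sum r T)) = {}"
    proof (intro ballI impI)
      fix S T assume ST: "S \<in> Pt" "T \<in> Pt" "S \<noteq> T"
      have "ball (c S) (sum r S) \<inter> ball (c T) (sum r T) = {}"
        by (rule disjoint_ballI) (use apart[OF ST] in simp)
      then show "Q \<inter> ball (c S) (sum r S) \<inter> (Q \<inter> ball (c T) (sum r T)) = {}" by blast
    qed
  qed (use finQ finPt in auto)
  finally have "2 * pi * \<i> * fps_nth s k = (\<Sum>S\<in>Pt. contour_integral (circlepath (c S) (sum r S)) h)"
    by (simp add: circ sum_distrib_left)
  moreover have "norm (contour_integral (circlepath (c S) (sum r S)) h)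
      \<le> 2 * pi * (M / r j0) * (\<Sum>j\<in>S. r j * (norm (p j) + 2 * sum r J) ^ k)" if S: "S \<in> Pt" for S
  proof -
    define B where "B = M * (norm (c S) + sum r S) ^ k / r j0"
    have B0: "0 \<le> B" using M0 Rpos[OF S] r0 by (auto simp: B_def intro!: divide_nonneg_pos mult_nonneg_nonneg zero_le_power)
    have "h contour_integrable_on circlepath (c S) (sum r S)"
    proof (rule contour_integrable_continuous_circlepath)
      show "continuous_on (path_image (circlepath (c S) (sum r S))) h"
        using sphereQ[OF S] Rpos[OF S]
        by (intro holomorphic_on_imp_continuous_on holomorphic_on_subset[OF holo]) (simp add: disjoint_eq_subset_Compl)
    qed
    then have "norm (contour_integral (circlepath (c S) (sum r S)) h) \<le> B * (2 * pi * sum r S)"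
    proof (rule has_contour_integral_bound_circlepath[OF has_contour_integral_integral B0 Rpos[OF S]])
      fix w assume w: "norm (w - c S) = sum r S"
      then have ws: "w \<in> sphere (c S) (sum r S)" by (simp add: dist_norm norm_minus_commute)
      note out = sphere[OF S ws]
      have w0: "r j0 \<le> norm w" using bspec[OF out j0(1)] j0(2) by simp
      then have wn0: "w \<noteq> 0" using r0 by auto
      have "norm (f (1 / w)) \<le> M"
        using out inverse_in_swiss_iff[OF wn0, of p r J] by (intro M) blast
      moreover have "norm w \<le> norm (c S) + sum r S"
        using norm_triangle_sub[of w "c S"] w by linarith
      ultimately show "norm (h w) \<le> B"
        unfolding h_def B_def norm_divide norm_mult norm_power
        using w0 r0 M0 by (intro frac_le mult_mono power_mono mult_nonneg_nonneg) auto
    qed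
    also have "\<dots> = 2 * pi * (M / r j0) * (\<Sum>j\<in>S. r j * (norm (c S) + sum r S) ^ k)"
      by (simp add: B_def sum_distrib_right[symmetric])
    also have "\<dots> \<le> 2 * pi * (M / r j0) * (\<Sum>j\<in>S. r j * (norm (p j) + 2 * sum r J) ^ k)"
    proof (intro mult_left_mono sum_mono power_mono)
      fix j assume j: "j \<in> S"
      have rj: "0 < r j" using r sub[OF S] j by blast
      then show "0 \<le> r j" by simp
      have "norm (c S) \<le> norm (p j) + dist (c S) (p j)"
        by (metis add.commute dist_norm norm_triangle_sub)
      then show "norm (c S) + sum r S \<le> norm (p j) + 2 * sum r J"
        using in_disc[OF S j] Rle[OF S] rj by simp
      show "0 \<le> norm (c S) + sum r S" using Rpos[OF S] by (simp add: less_imp_le)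
    qed (use M0 r0 in auto)
    finally show ?thesis .
  qed
  ultimately have "norm (2 * pi * \<i> * fps_nth s k)
      \<le> (\<Sum>S\<in>Pt. 2 * pi * (M / r j0) * (\<Sum>j\<in>S. r j * (norm (p j) + 2 * sum r J) ^ k))"
    by (simp only:) (rule sum_norm_le)
  also have "\<dots> = 2 * pi * (M / r j0) * (\<Sum>S\<in>Pt. \<Sum>j\<in>S. r j * (norm (p j) + 2 * sum r J) ^ k)"
    by (simp add: sum_distrib_left)
  also have "(\<Sum>S\<in>Pt. \<Sum>j\<in>S. r j * (norm (p j) + 2 * sum r J) ^ k) = (\<Sum>j\<in>J. r j * (norm (p j) + 2 * sum r J) ^ k)"
    using Pt sub by (subst sum.Union_disjoint[symmetric, unfolded o_def]) (auto simp: partition_on_def disjoint_def)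
  finally have "2 * pi * norm (fps_nth s k) \<le> 2 * pi * ((\<Sum>j\<in>J. r j * (norm (p j) + 2 * sum r J) ^ k) / r j0 * M)"
    by (simp add: norm_mult mult_ac)
  then show ?thesis by (rule mult_left_le_imp_le) simp
qed

text \<open>The disc about \<open>w = 0\<close> confines the cheese to
  \<open>cball 0 (1 / r j0)\<close>. The part of this ball outside \<open>U\<close> is compact and
  covered by the open sets that the discs remove, so finitely many discs suffice.\<close>

lemma swiss_finite_bound:
  assumes K: "swiss p r UNIV \<subseteq> U" "open U" and j0: "p j0 = 0" "0 < r j0"
  obtains J where "finite J" "j0 \<in> J" "swiss p r J \<subseteq> U"
proof -
  define Z where "Z = cball 0 (1 / r j0) - U"
  have "compact Z" unfolding Z_def using K(2) by (intro compact_diff) auto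
  moreover have "Z \<subseteq> (\<Union>j. - swiss p r {j})"
    using K(1) by (auto simp: Z_def swiss_def)
  ultimately obtain J where J: "finite J" "Z \<subseteq> (\<Union>j\<in>J. - swiss p r {j})"
    using closed_swiss[of p r] by (elim compactE_image[where f = "\<lambda>j. - swiss p r {j}"]) (auto simp: open_Compl)
  have "swiss p r (insert j0 J) \<subseteq> U"
  proof
    fix z assume z: "z \<in> swiss p r (insert j0 J)"
    then have "r j0 * norm z \<le> 1" using j0 by (simp add: swiss_def)
    then have "z \<in> cball 0 (1 / r j0)" using j0 by (simp add: field_simps)
    then show "z \<in> U" using z J(2) by (auto simp: Z_def swiss_def)
  qed
  then show ?thesis using that[of "insert j0 J"] J(1) by simp
qed

text \<open>A member of \<open>merom_on\<close> is continuous on a neighbourhood of the cheese, so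
  its bound \<open>M\<close>, enlarged by \<open>d\<close>, already holds on a cheese with finitely
  many discs. The weight hypothesis makes the estimate there uniform in the finite set.\<close>

lemma fps_bounded_merom_on:
  assumes r: "\<And>j. 0 \<le> r j" and j0: "p j0 = 0" "0 < r j0"
    and w: "\<And>k. \<exists>C. \<forall>J. finite J \<longrightarrow> (\<Sum>j\<in>J. r j * (1 + norm (p j)) ^ k) \<le> C"
  shows "fps_bounded (swiss p r UNIV) (merom_on (swiss p r UNIV))"
  unfolding fps_bounded_def
proof
  fix k
  obtain R where R: "\<And>J. finite J \<Longrightarrow> sum r J \<le> R" using w[of 0] by auto
  obtain C where C: "\<And>J. finite J \<Longrightarrow> (\<Sum>j\<in>J. r j * (1 + norm (p j)) ^ k) \<le> C" using w[of k] by auto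
  have R0: "0 \<le> R" using R[of "{}"] by simp
  have fin: "(\<Sum>j\<in>J. r j * (norm (p j) + 2 * sum r J) ^ k) \<le> (1 + 2 * R) ^ k * C" if J: "finite J" for J
  proof -
    have "(\<Sum>j\<in>J. r j * (norm (p j) + 2 * sum r J) ^ k) \<le> (\<Sum>j\<in>J. r j * ((1 + 2 * R) * (1 + norm (p j))) ^ k)"
    proof (intro sum_mono mult_left_mono power_mono r)
      fix j
      have "norm (p j) + 2 * sum r J \<le> norm (p j) + 2 * R" using R[OF J] by simp
      also have "\<dots> \<le> (1 + 2 * R) * (1 + norm (p j))" using R0 by (simp add: algebra_simps)
      finally show "norm (p j) + 2 * sum r J \<le> (1 + 2 * R) * (1 + norm (p j))" .
      show "0 \<le> norm (p j) + 2 * sum r J" using r by (simp add: sum_nonneg)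
    qed
    also have "\<dots> = (1 + 2 * R) ^ k * (\<Sum>j\<in>J. r j * (1 + norm (p j)) ^ k)"
      by (simp add: power_mult_distrib sum_distrib_left mult_ac)
    also have "\<dots> \<le> (1 + 2 * R) ^ k * C" using C[OF J] R0 by (intro mult_left_mono) auto
    finally show ?thesis .
  qed
  have C0: "0 \<le> C" using C[of "{}"] by simp
  define D where "D = (1 + 2 * R) ^ k * C / r j0"
  have D0: "0 \<le> D" using C0 R0 j0 by (simp add: D_def)
  have "norm (fps_nth s k) \<le> D * M"
    if fs: "(f, s) \<in> merom_on (swiss p r UNIV)" and M: "\<And>z. z \<in> swiss p r UNIV \<Longrightarrow> norm (f z) \<le> M" "0 \<le> M"
    for f s M
  proof (rule field_le_epsilon)
    fix e :: real assume "0 < e"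
    define d where "d = e / (D + 1)"
    have d: "0 < d" "D * d \<le> e" using \<open>0 < e\<close> D0 by (auto simp: d_def field_simps)
    obtain P where P: "finite P" "P \<inter> swiss p r UNIV = {}" "f holomorphic_on - P" "f has_fps_expansion s"
      using fs unfolding merom_on_def by blast
    have oP: "open (- P)" using finite_imp_closed[OF P(1)] by (simp add: open_Compl)
    define U where "U = {z \<in> - P. norm (f z) < M + d}"
    have "open U"
    proof -
      have "continuous_on (- P) (\<lambda>z. norm (f z))"
        by (intro continuous_intros holomorphic_on_imp_continuous_on P(3))
      then have "open (- P \<inter> (\<lambda>z. norm (f z)) -` {..<M + d})"
        using oP by (intro continuous_open_preimage) auto
      then show ?thesis by (simp add: U_def vimage_def Int_def)
    qed
    moreover have "swiss p r UNIV \<subseteq> U"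
      using M(1) P(2) d(1) by (fastforce simp: U_def)
    ultimately obtain J where J: "finite J" "j0 \<in> J" "swiss p r J \<subseteq> U"
      using swiss_finite_bound[where p = p and r = r and U = U, OF _ _ j0] by metis
    \<comment> \<open>Indices of radius 0 are dropped: the finite estimate is about genuine discs,
      and the cheese does not change.\<close>
    define J' where "J' = {j\<in>J. 0 < r j}"
    have eq: "swiss p r J' = swiss p r J"
      unfolding swiss_def J'_def using r
      by (auto simp: not_less) (metis antisym_conv2 mult_zero_left norm_ge_zero)
    have J': "finite J'" "j0 \<in> J'" using J j0 by (auto simp: J'_def)
    have "norm (fps_nth s k) \<le> (\<Sum>j\<in>J'. r j * (norm (p j) + 2 * sum r J') ^ k) / r j0 * (M + d)"
    proof (rule merom_bound_finite[where p = p and r = r and f = f and M = "M + d" and P = P, OF J'(1) _ J'(2) j0(1) P(1) _ P(3,4)])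
      show "P \<inter> swiss p r J' = {}" using J(3) by (auto simp: eq U_def)
      show "norm (f z) \<le> M + d" if "z \<in> swiss p r J'" for z
        using that J(3) by (auto simp: eq U_def)
    qed (simp add: J'_def)
    also have "\<dots> \<le> D * (M + d)"
      unfolding D_def using fin[OF J'(1)] j0 M d by (intro mult_right_mono divide_right_mono) auto
    also have "\<dots> \<le> D * M + e" using d by (simp add: algebra_simps)
    finally show "norm (fps_nth s k) \<le> D * M + e" .
  qed
  then show "\<exists>C. \<forall>f s M. (f, s) \<in> merom_on (swiss p r UNIV) \<longrightarrow> (\<forall>x\<in>swiss p r UNIV. norm (f x) \<le> M) \<longrightarrow>
      0 \<le> M \<longrightarrow> norm (fps_nth s k) \<le> C * M"
    by (intro exI[of _ D]) blast
qed

lemma fps_alg_merom_on: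
  assumes "compact K" "0 \<in> K"
  shows "fps_alg K (merom_on K)"
  unfolding fps_alg_def
proof (intro conjI allI impI)
  show "(\<lambda>_. c, fps_const c) \<in> merom_on K" for c
    unfolding merom_on_def by (auto intro!: exI[of _ "{}"] fps_expansion_intros)
next
  fix f s g t assume "(f, s) \<in> merom_on K" "(g, t) \<in> merom_on K"
  then obtain P Q where P: "finite P" "P \<inter> K = {}" "f holomorphic_on - P" "f has_fps_expansion s"
    and Q: "finite Q" "Q \<inter> K = {}" "g holomorphic_on - Q" "g has_fps_expansion t"
    unfolding merom_on_def by blast
  have h: "f holomorphic_on - (P \<union> Q)" "g holomorphic_on - (P \<union> Q)"
    using P(3) Q(3) by (auto intro: holomorphic_on_subset)
  have "finite (P \<union> Q)" "(P \<union> Q) \<inter> K = {}" using P Q by auto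
  then show "(\<lambda>x. f x + g x, s + t) \<in> merom_on K" "(\<lambda>x. f x * g x, s * t) \<in> merom_on K"
    unfolding merom_on_def using P(4) Q(4) h
    by (auto intro!: exI[of _ "P \<union> Q"] fps_expansion_intros holomorphic_intros)
next
  fix f s assume "(f, s) \<in> merom_on K"
  then obtain P where P: "P \<inter> K = {}" "f holomorphic_on - P" unfolding merom_on_def by blast
  then have "continuous_on K f"
    by (auto intro!: holomorphic_on_imp_continuous_on intro: holomorphic_on_subset)
  then have "bounded (f ` K)" using assms(1) compact_continuous_image compact_imp_bounded by blast
  then show "\<exists>M. \<forall>x\<in>K. norm (f x) \<le> M" by (auto simp: bounded_iff)
qed

lemma merom_onI:
  assumes "finite P" "P \<inter> K = {}" "f holomorphic_on - P" "0 \<in> K"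
  shows "(f, fps_expansion f 0) \<in> merom_on K"
proof -
  have "f has_fps_expansion fps_expansion f 0"
    using assms finite_imp_closed[OF assms(1)]
    by (intro has_fps_expansion_fps_expansion[of "- P"]) (auto simp: open_Compl)
  then show ?thesis using assms unfolding merom_on_def by blast
qed

lemma merom_on_antimono: "L \<subseteq> K \<Longrightarrow> merom_on K \<subseteq> merom_on L"
  unfolding merom_on_def by blast

section \<open>Bump functions\<close>

text \<open>With \<open>v\<close> the principal \<open>N\<close>-th root of \<open>u ^ N\<close>,
  the quotient \<open>u / v\<close> is an exact root of unity and \<open>v\<close> is within
  \<open>3 * \<eta> / N\<close> of 1. The gain of \<open>1 / N\<close> is decisive: \<open>N\<close>
  discs with radii proportional to \<open>1 / N\<close> have a total radius that does not depend on
  \<open>N\<close>.\<close>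

lemma near_root_of_unity:
  fixes u :: complex
  assumes "0 < N" "norm (1 - u ^ N) < \<eta>" "\<eta> \<le> 1 / 4"
  obtains l where "l < N" "norm (u - cis (2 * pi * real l / real N)) \<le> 3 * \<eta> / N"
proof -
  define s where "s = Ln (1 + (u ^ N - 1))"
  have small: "norm (u ^ N - 1) < \<eta>" using assms(2) by (simp add: norm_minus_commute)
  then have s: "norm s \<le> 2 * \<eta>"
    using norm_Ln_le[of "u ^ N - 1"] assms(3) by (simp add: s_def)
  have "u ^ N \<noteq> 0"
  proof
    assume "u ^ N = 0"
    then have "norm (u ^ N - 1) = 1" by (simp only: diff_0 norm_minus_cancel norm_one)
    then show False using small assms(3) by linarith
  qed
  then have es: "exp s = u ^ N" by (simp add: s_def)
  define v where "v = exp (s / N)"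
  have vN: "v ^ N = u ^ N"
    using assms(1) by (simp add: v_def es exp_of_nat_mult[symmetric])
  have v0: "v \<noteq> 0" by (simp add: v_def)
  have "(u / v) ^ N = 1"
    using vN \<open>u ^ N \<noteq> 0\<close> by (simp add: power_divide)
  then obtain l where l: "l < N" "u / v = cis (2 * pi * real l / real N)"
    using Complex.bij_betw_roots_unity[OF assms(1)] unfolding bij_betw_def by auto
  have "u - cis (2 * pi * real l / real N) = (u / v) * (v - 1)"
    using v0 unfolding l(2)[symmetric] by (simp add: field_simps)
  then have "norm (u - cis (2 * pi * real l / real N)) = norm (v - 1)"
    by (simp add: norm_mult l(2))
  also have "\<dots> \<le> 3 / 2 * norm (s / N)"
  proof -
    have "norm (s / N) \<le> norm s"
      using assms(1) by (simp add: norm_divide divide_le_eq mult_left_mono[of 1 N "norm s", simplified])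
    then show ?thesis
      unfolding v_def using s assms(3) by (intro norm_exp_bounds) simp
  qed
  also have "\<dots> \<le> 3 * \<eta> / N"
    using s assms(1) by (simp add: norm_divide field_simps)
  finally show ?thesis using l(1) by (intro that)
qed

text \<open>For \<open>z \<noteq> 0\<close> this is \<open>1 / (1 - ((1 / z - c) / \<rho>) ^ N)\<close>, which is close to \<open>1\<close> if
  \<open>\<bar>1 / z - c\<bar> < \<rho>\<close> and close to \<open>0\<close> if \<open>\<bar>1 / z - c\<bar> > \<rho>\<close>; the form below has the right value at \<open>z = 0\<close>.\<close>

definition disc_kernel :: "complex \<Rightarrow> real \<Rightarrow> nat \<Rightarrow> complex \<Rightarrow> complex" where
  "disc_kernel c \<rho> N z = (\<rho> * z) ^ N / ((\<rho> * z) ^ N - (1 - c * z) ^ N)"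

lemma disc_kernel_0 [simp]: "0 < N \<Longrightarrow> disc_kernel c \<rho> N 0 = 0"
  by (simp add: disc_kernel_def)

lemma disc_kernel_eq:
  assumes "z \<noteq> 0" "0 < \<rho>"
  shows "disc_kernel c \<rho> N z = 1 / (1 - ((1 / z - c) / \<rho>) ^ N)"
proof -
  have "(1 / z - c) / \<rho> = (1 - c * z) / (\<rho> * z)" using assms by (simp add: field_simps)
  moreover have "(\<rho> * z) ^ N \<noteq> 0" using assms by simp
  ultimately show ?thesis
    unfolding disc_kernel_def
    by (simp only: power_divide) (simp add: divide_simps)
qed

text \<open>If \<open>norm (1 - u ^ N)\<close> were below \<open>\<kappa> / 8\<close>, then
  \<open>u\<close> would be so close to a root of unity that \<open>1 / z\<close> would lie in a
  removed disc. Both the total removed radius \<open>\<rho> * \<kappa>\<close> and the bound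
  \<open>8 / \<kappa>\<close> are independent of \<open>N\<close>, so \<open>N\<close> can be chosen
  last, to meet any tolerance.\<close>

lemma disc_kernel_bound:
  assumes N: "0 < N" and \<rho>: "0 < \<rho>" and \<kappa>: "0 < \<kappa>" "\<kappa> \<le> 1" and z: "z \<noteq> 0"
    and far: "\<And>l. l < N \<Longrightarrow> \<rho> * \<kappa> / N \<le> norm (1 / z - (c + \<rho> * cis (2 * pi * real l / real N)))"
  shows "1 - ((1 / z - c) / \<rho>) ^ N \<noteq> 0" "norm (disc_kernel c \<rho> N z) \<le> 8 / \<kappa>"
proof -
  define u where "u = (1 / z - c) / \<rho>"
  have "\<not> norm (1 - u ^ N) < \<kappa> / 8"
  proof
    assume "norm (1 - u ^ N) < \<kappa> / 8"
    then obtain l where l: "l < N" "norm (u - cis (2 * pi * real l / real N)) \<le> 3 * (\<kappa> / 8) / N"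
      using near_root_of_unity[OF N, of u "\<kappa> / 8"] \<kappa> by auto
    have "1 / z - (c + \<rho> * cis (2 * pi * real l / real N)) = \<rho> * (u - cis (2 * pi * real l / real N))"
      using \<rho> by (simp add: u_def field_simps)
    then have "norm (1 / z - (c + \<rho> * cis (2 * pi * real l / real N))) = \<rho> * norm (u - cis (2 * pi * real l / real N))"
      using \<rho> by (simp add: norm_mult)
    then have "\<rho> * (\<kappa> / N) \<le> \<rho> * norm (u - cis (2 * pi * real l / real N))"
      using far[OF l(1)] by simp
    then have "\<kappa> / N \<le> norm (u - cis (2 * pi * real l / real N))"
      using \<rho> by (rule mult_left_le_imp_le)
    then have "\<kappa> / N \<le> 3 * (\<kappa> / 8) / N" using l(2) by linarith
    then show False using N \<kappa> by (simp add: field_simps)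
  qed
  then have ge: "\<kappa> / 8 \<le> norm (1 - u ^ N)" by simp
  then show "1 - ((1 / z - c) / \<rho>) ^ N \<noteq> 0" using \<kappa> unfolding u_def by auto
  have "norm (disc_kernel c \<rho> N z) = 1 / norm (1 - u ^ N)"
    unfolding disc_kernel_eq[OF z \<rho>] u_def by (simp add: norm_divide)
  also have "\<dots> \<le> 1 / (\<kappa> / 8)" using ge \<kappa> by (intro divide_left_mono mult_pos_pos) auto
  finally show "norm (disc_kernel c \<rho> N z) \<le> 8 / \<kappa>" by simp
qed

lemma disc_kernel_small:
  assumes "0 < \<sigma>1" "\<sigma>1 < \<rho>" "\<rho> < \<sigma>2" "0 < \<theta>"
  obtains N where "0 < N"
    "\<And>z. z \<noteq> 0 \<Longrightarrow> norm (1 / z - c) \<le> \<sigma>1 \<Longrightarrow> norm (disc_kernel c \<rho> N z - 1) \<le> \<theta>"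
    "\<And>z. z \<noteq> 0 \<Longrightarrow> \<sigma>2 \<le> norm (1 / z - c) \<Longrightarrow> norm (disc_kernel c \<rho> N z) \<le> \<theta>"
proof -
  define q where "q = max (\<sigma>1 / \<rho>) (\<rho> / \<sigma>2)"
  define \<tau> where "\<tau> = min (1/2) (\<theta> / 2)"
  have q: "0 \<le> q" "q < 1" "\<sigma>1 / \<rho> \<le> q" "\<rho> / \<sigma>2 \<le> q" using assms by (auto simp: q_def le_max_iff_disj)
  have \<tau>: "0 < \<tau>" "\<tau> \<le> 1/2" "\<tau> \<le> \<theta> / 2" using assms by (auto simp: \<tau>_def)
  have "(\<lambda>n. q ^ n) \<longlonglongrightarrow> 0" using q by (intro LIMSEQ_realpow_zero) auto
  then have "\<forall>\<^sub>F n in sequentially. q ^ n < \<tau>" using \<tau>(1) by (rule order_tendstoD)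
  then obtain n where "q ^ n < \<tau>" "0 < n"
    using eventually_happens'[OF sequentially_bot eventually_conj[OF _ eventually_gt_at_top[of 0]]] by blast
  then have n: "q ^ n \<le> \<tau>" "0 < n" by auto
  have rho: "0 < \<rho>" "0 < \<sigma>2" using assms by auto
  show ?thesis
  proof (rule that[OF n(2)])
    fix z :: complex assume z: "z \<noteq> 0" "norm (1 / z - c) \<le> \<sigma>1"
    define w where "w = ((1 / z - c) / \<rho>) ^ n"
    have "norm ((1 / z - c) / \<rho>) \<le> q"
      using z(2) rho q(3) divide_right_mono[OF z(2), of \<rho>] by (simp add: norm_divide)
    then have w: "norm w \<le> \<tau>"
      using n(1) power_mono[of "norm ((1 / z - c) / \<rho>)" q n] by (simp add: w_def norm_power)
    then have half: "1/2 \<le> norm (1 - w)"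
      using norm_triangle_ineq2[of 1 w] \<tau>(2) by simp
    then have "1 - w \<noteq> 0" by auto
    then have "disc_kernel c \<rho> n z - 1 = w / (1 - w)"
      unfolding disc_kernel_eq[OF z(1) rho(1)] w_def[symmetric] by (simp add: field_simps)
    also have "norm \<dots> \<le> \<tau> / (1/2)"
      unfolding norm_divide using w half \<tau> by (intro frac_le) auto
    finally show "norm (disc_kernel c \<rho> n z - 1) \<le> \<theta>" using \<tau>(3) by simp
  next
    fix z :: complex assume z: "z \<noteq> 0" "\<sigma>2 \<le> norm (1 / z - c)"
    define x where "x = (1 / z - c) / \<rho>"
    have x0: "x \<noteq> 0" using z(2) rho by (auto simp: x_def)
    define w where "w = (1 / x) ^ n"
    have "norm (1 / x) = \<rho> / norm (1 / z - c)" using rho by (simp add: x_def norm_divide)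
    also have "\<dots> \<le> \<rho> / \<sigma>2" using z(2) rho by (intro divide_left_mono mult_pos_pos) auto
    finally have "norm (1 / x) \<le> q" using q(4) by linarith
    then have w: "norm w \<le> \<tau>"
      using n(1) power_mono[of "norm (1 / x)" q n] by (simp add: w_def norm_power)
    then have half: "1/2 \<le> norm (w - 1)"
      using norm_triangle_ineq2[of 1 w] \<tau>(2) by (simp add: norm_minus_commute)
    have xn: "x ^ n \<noteq> 0" using x0 by simp
    have "1 - x ^ n = (w - 1) * x ^ n" using xn by (simp add: w_def power_divide left_diff_distrib)
    then have "disc_kernel c \<rho> n z = w / (w - 1)"
      unfolding disc_kernel_eq[OF z(1) rho(1)] x_def[symmetric] using xn
      by (simp add: w_def power_divide)
    also have "norm \<dots> \<le> \<tau> / (1/2)"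
      unfolding norm_divide using w half \<tau> by (intro frac_le) auto
    finally show "norm (disc_kernel c \<rho> n z) \<le> \<theta>" using \<tau>(3) by simp
  qed
qed

text \<open>If \<open>c + \<rho> * \<zeta> = 0\<close> for a root of unity \<open>\<zeta>\<close>,
  that pole sits at \<open>z = \<infinity>\<close>, and the convention \<open>1 / 0 = 0\<close>
  would misplace it at 0, where the denominator is \<open>- 1\<close>. Hence the removal of 0 from
  \<open>Z\<close>.\<close>

lemma disc_kernel_holomorphic:
  fixes c :: complex
  assumes "0 < N" "0 < \<rho>"
  defines "Z \<equiv> (\<lambda>l. 1 / (c + \<rho> * cis (2 * pi * real l / real N))) ` {..<N} - {0}"
  shows "finite Z" "disc_kernel c \<rho> N holomorphic_on - Z"
proof -
  show "finite Z" by (simp add: Z_def)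
  have "(\<rho> * z) ^ N - (1 - c * z) ^ N \<noteq> 0" if "z \<notin> Z" for z :: complex
  proof
    assume eq: "(\<rho> * z) ^ N - (1 - c * z) ^ N = 0"
    have z0: "z \<noteq> 0" using eq assms(1) by (auto simp: power_0_left)
    then have "(\<rho> * z) ^ N \<noteq> 0" using assms(2) by simp
    moreover have "(1 - c * z) ^ N = (\<rho> * z) ^ N" using eq by simp
    ultimately have "((1 - c * z) / (\<rho> * z)) ^ N = 1" by (simp add: power_divide)
    then obtain l where l: "l < N" "(1 - c * z) / (\<rho> * z) = cis (2 * pi * real l / real N)"
      using Complex.bij_betw_roots_unity[OF assms(1)] unfolding bij_betw_def by auto
    have "c + \<rho> * cis (2 * pi * real l / real N) = 1 / z"
      using z0 assms(2) unfolding l(2)[symmetric] by (simp add: field_simps)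
    then have "z = 1 / (c + \<rho> * cis (2 * pi * real l / real N))" by simp
    then show False using that l(1) z0 unfolding Z_def by blast
  qed
  then show "disc_kernel c \<rho> N holomorphic_on - Z"
    unfolding disc_kernel_def by (intro holomorphic_intros) auto
qed

text \<open>Each step pushes the function to \<open>0\<close> outside one circle and to \<open>1\<close> inside another one, and hardly
  changes it between them or where it is already close to \<open>0\<close> or \<open>1\<close>.\<close>

fun switch_seq :: "('a \<Rightarrow> complex) \<Rightarrow> (nat \<Rightarrow> 'a \<Rightarrow> complex) \<Rightarrow> (nat \<Rightarrow> 'a \<Rightarrow> complex) \<Rightarrow> nat \<Rightarrow> 'a \<Rightarrow> complex" where
  "switch_seq E G G' 0 x = E x"
| "switch_seq E G G' (Suc m) x = switch_seq E G G' m x * (G m x - G' m x) + G' m x"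

text \<open>The crude bound for the iterates: one step multiplies by a difference of two kernels, of
  size at most \<open>2 * H m\<close>, and adds a kernel.\<close>

fun switch_bound :: "(nat \<Rightarrow> real) \<Rightarrow> nat \<Rightarrow> real" where
  "switch_bound H 0 = H 0"
| "switch_bound H (Suc m) = switch_bound H m * (2 * H m) + H m"

lemma switch_bound_ge_1: "(\<And>m. 1 \<le> H m) \<Longrightarrow> 1 \<le> switch_bound H m"
proof (induction m)
  case (Suc m)
  have "0 \<le> switch_bound H m * (2 * H m)"
    using Suc.IH[OF Suc.prems] Suc.prems[of m] by (intro mult_nonneg_nonneg) auto
  then show ?case using Suc.prems[of m] unfolding switch_bound.simps by linarith
qed simp

text \<open>Expressed through the bounds \<open>H\<close> alone, hence fixed before the degrees of
  the kernels are. The constants make five times the tolerance at most the distance to 0 or 1 that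
  the next iterate must keep, and hold the change between the circles below
  \<open>(1/2) ^ m\<close>.\<close>

definition switch_tol :: "(nat \<Rightarrow> real) \<Rightarrow> nat \<Rightarrow> real" where
  "switch_tol H m = 1 / (2 ^ m * 10 * (1 + switch_bound H m + H (Suc m)))"

text \<open>Beyond its bound \<open>H m\<close>, a kernel of step \<open>m\<close> is uncontrolled
  only in a band outside \<open>\<beta> m\<close> or inside \<open>\<alpha> m\<close>. There the
  current function is already within \<open>\<tau> m\<close> of 0 or 1, and the factor that
  multiplies the wild kernel is correspondingly small. So each change is at most
  \<open>2 * (1/2) ^ m\<close>, at whatever rate the bounds \<open>H m\<close> grow.\<close>

lemma switch_seq_converges:
  fixes lev :: "'a \<Rightarrow> real"
  assumes H: "\<And>m. 1 \<le> H m"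
    and \<alpha>\<beta>: "\<And>m. \<alpha> m \<le> \<beta> m" "\<And>m. \<alpha> (Suc m) \<le> \<alpha> m" "\<And>m. \<beta> m \<le> \<beta> (Suc m)"
    and E: "\<And>x. x \<in> S \<Longrightarrow> norm (E x) \<le> H 0"
      "\<And>x. x \<in> S \<Longrightarrow> \<beta> 0 \<le> lev x \<Longrightarrow> norm (E x) \<le> 1 / (1 + H 0)"
      "\<And>x. x \<in> S \<Longrightarrow> lev x \<le> \<alpha> 0 \<Longrightarrow> norm (E x - 1) \<le> 1 / (1 + H 0)"
    and G: "\<And>m x. x \<in> S \<Longrightarrow> norm (G m x) \<le> H m"
      "\<And>m x. x \<in> S \<Longrightarrow> lev x \<le> \<beta> m \<Longrightarrow> norm (G m x - 1) \<le> switch_tol H m"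
      "\<And>m x. x \<in> S \<Longrightarrow> \<beta> (Suc m) \<le> lev x \<Longrightarrow> norm (G m x) \<le> switch_tol H m"
    and G': "\<And>m x. x \<in> S \<Longrightarrow> norm (G' m x) \<le> H m"
      "\<And>m x. x \<in> S \<Longrightarrow> lev x \<le> \<alpha> (Suc m) \<Longrightarrow> norm (G' m x - 1) \<le> switch_tol H m"
      "\<And>m x. x \<in> S \<Longrightarrow> \<alpha> m \<le> lev x \<Longrightarrow> norm (G' m x) \<le> switch_tol H m"
  obtains L where "uniform_limit S (switch_seq E G G') L sequentially"
    "\<And>x. x \<in> S \<Longrightarrow> (\<And>m. \<beta> m \<le> lev x) \<Longrightarrow> L x = 0"
    "\<And>x. x \<in> S \<Longrightarrow> (\<And>m. lev x \<le> \<alpha> m) \<Longrightarrow> L x = 1"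
proof -
  let ?E = "switch_seq E G G'" and ?B = "switch_bound H" and ?\<theta> = "switch_tol H"
  \<comment> \<open>The distance to 0 or 1 kept by the iteration; dividing by \<open>1 + H m\<close>
    pays for the uncontrolled kernel of the next step.\<close>
  define \<tau> where "\<tau> m = 1 / (2 ^ m * (1 + H m))" for m
  have B: "1 \<le> ?B m" for m using switch_bound_ge_1[OF H] .
  have \<theta>0: "0 \<le> ?\<theta> m" for m using B[of m] H[of "Suc m"] by (simp add: switch_tol_def)
  have \<theta>\<tau>: "5 * ?\<theta> m \<le> \<tau> (Suc m)" for m
  proof -
    have "5 * (1 / (2 ^ m * 10 * D)) = 1 / (2 ^ Suc m * D)" for D :: real
      by (simp add: field_simps)
    then have "5 * ?\<theta> m = 1 / (2 ^ Suc m * (1 + ?B m + H (Suc m)))"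
      unfolding switch_tol_def .
    also have "\<dots> \<le> 1 / (2 ^ Suc m * (1 + H (Suc m)))"
      using B[of m] H[of "Suc m"] by (intro divide_left_mono mult_left_mono mult_pos_pos) auto
    finally show ?thesis by (simp add: \<tau>_def)
  qed
  have \<theta>B: "?\<theta> m * (1 + 2 * ?B m) \<le> (1/2) ^ m" for m
  proof -
    have "(1 + 2 * ?B m) \<le> 10 * (1 + ?B m + H (Suc m))" using B[of m] H[of "Suc m"] by simp
    moreover have "0 < 10 * (1 + ?B m + H (Suc m))" using B[of m] H[of "Suc m"] by simp
    ultimately have "(1 + 2 * ?B m) / (10 * (1 + ?B m + H (Suc m))) \<le> 1" by simp
    then have "(1 + 2 * ?B m) / (10 * (1 + ?B m + H (Suc m))) / 2 ^ m \<le> 1 / 2 ^ m"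
      by (rule divide_right_mono) simp
    moreover have "1 / (2 ^ m * 10 * D) * x = x / (10 * D) / 2 ^ m" for D x :: real by simp
    ultimately show ?thesis unfolding switch_tol_def power_one_over by metis
  qed
  have \<theta>2: "2 * ?\<theta> m \<le> (1/2) ^ m" for m
    using \<theta>B[of m] mult_left_mono[OF B \<theta>0, of m m] \<theta>0[of m] by (simp add: distrib_left)
  have \<tau>0: "0 \<le> \<tau> m" "\<tau> m \<le> 1 / 2" for m
  proof -
    show "0 \<le> \<tau> m" using H[of m] by (simp add: \<tau>_def)
    have "1 * 2 \<le> 2 ^ m * (1 + H m)" using H[of m] by (intro mult_mono) auto
    then show "\<tau> m \<le> 1 / 2" unfolding \<tau>_def by (intro divide_left_mono) auto
  qed
  have \<tau>H: "\<tau> m * (1 + H m) = (1/2) ^ m" for m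
    using H[of m] by (simp add: \<tau>_def power_one_over)
  have inv: "norm (?E m x) \<le> ?B m \<and> (\<beta> m \<le> lev x \<longrightarrow> norm (?E m x) \<le> \<tau> m) \<and>
      (lev x \<le> \<alpha> m \<longrightarrow> norm (?E m x - 1) \<le> \<tau> m)" if x: "x \<in> S" for x m
  proof (induction m)
    case 0
    show ?case using E[OF x] by (simp add: \<tau>_def)
  next
    case (Suc m)
    have GG: "norm (G m x - G' m x) \<le> 2 * H m"
      using norm_triangle_ineq4[of "G m x" "G' m x"] G(1)[OF x, of m] G'(1)[OF x, of m] by linarith
    have "norm (?E (Suc m) x) \<le> norm (?E m x) * norm (G m x - G' m x) + norm (G' m x)"
      using norm_triangle_ineq[of "?E m x * (G m x - G' m x)" "G' m x"] by (simp add: norm_mult)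
    also have "\<dots> \<le> ?B m * (2 * H m) + H m"
      using Suc.IH GG G'(1)[OF x] B[of m] by (intro add_mono mult_mono) auto
    finally have 1: "norm (?E (Suc m) x) \<le> ?B (Suc m)" by simp
    have 2: "norm (?E (Suc m) x) \<le> \<tau> (Suc m)" if l: "\<beta> (Suc m) \<le> lev x"
    proof -
      have le: "\<beta> m \<le> lev x" "\<alpha> m \<le> lev x" using l \<alpha>\<beta>(3)[of m] \<alpha>\<beta>(1)[of m] by linarith+
      have b: "norm (G m x) \<le> ?\<theta> m" "norm (G' m x) \<le> ?\<theta> m" "norm (?E m x) \<le> 1"
        using G(3)[OF x l] G'(3)[OF x le(2)] Suc.IH le(1) \<tau>0(2)[of m] by auto
      have "norm (?E (Suc m) x) \<le> norm (?E m x) * norm (G m x - G' m x) + norm (G' m x)"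
        using norm_triangle_ineq[of "?E m x * (G m x - G' m x)" "G' m x"] by (simp add: norm_mult)
      also have "\<dots> \<le> 1 * (2 * ?\<theta> m) + ?\<theta> m"
        using b norm_triangle_ineq4[of "G m x" "G' m x"] by (intro add_mono mult_mono) auto
      finally show ?thesis using \<theta>\<tau>[of m] \<theta>0[of m] by simp
    qed
    have 3: "norm (?E (Suc m) x - 1) \<le> \<tau> (Suc m)" if l: "lev x \<le> \<alpha> (Suc m)"
    proof -
      have le: "lev x \<le> \<alpha> m" "lev x \<le> \<beta> m" using l \<alpha>\<beta>(2)[of m] \<alpha>\<beta>(1)[of m] by linarith+
      have b: "norm (G m x - 1) \<le> ?\<theta> m" "norm (G' m x - 1) \<le> ?\<theta> m" "norm (?E m x - 1) \<le> 1"
        using G(2)[OF x le(2)] G'(2)[OF x l] Suc.IH le(1) \<tau>0(2)[of m] by auto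
      have E2: "norm (?E m x) \<le> 2" using b(3) norm_triangle_sub[of "?E m x" 1] by simp
      have GG: "norm (G m x - G' m x) \<le> 2 * ?\<theta> m"
        using norm_triangle_ineq4[of "G m x - 1" "G' m x - 1"] b by simp
      have eq: "?E (Suc m) x - 1 = ?E m x * (G m x - G' m x) + (G' m x - 1)" by simp
      have "norm (?E (Suc m) x - 1) \<le> norm (?E m x) * norm (G m x - G' m x) + norm (G' m x - 1)"
        unfolding eq norm_mult[symmetric] by (rule norm_triangle_ineq)
      also have "\<dots> \<le> 2 * (2 * ?\<theta> m) + ?\<theta> m"
        using b E2 GG by (intro add_mono mult_mono) auto
      finally show ?thesis using \<theta>\<tau>[of m] by simp
    qed
    show ?case using 1 2 3 by blast
  qed
  have step: "norm (?E (Suc m) x - ?E m x) \<le> 2 * (1/2) ^ m" if x: "x \<in> S" for x m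
  proof -
    \<comment> \<open>In either outer region one term is small because \<open>?E m x\<close> or
      \<open>1 - ?E m x\<close> is, and the other because a kernel is accurate; between the circles
      both kernels are accurate.\<close>
    have "?E (Suc m) x - ?E m x = ?E m x * (G m x - 1) + G' m x * (1 - ?E m x)"
      by (simp add: algebra_simps)
    then have *: "norm (?E (Suc m) x - ?E m x) \<le> norm (?E m x) * norm (G m x - 1) + norm (G' m x) * norm (?E m x - 1)"
      using norm_triangle_ineq[of "?E m x * (G m x - 1)" "G' m x * (1 - ?E m x)"]
      by (simp add: norm_mult norm_minus_commute)
    consider "\<beta> m \<le> lev x" | "lev x \<le> \<alpha> m" | "\<alpha> m \<le> lev x" "lev x \<le> \<beta> m" by linarith
    then show ?thesis
    proof cases
      case 1
      then have b: "norm (?E m x) \<le> \<tau> m" "norm (G' m x) \<le> ?\<theta> m"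
        using inv[OF x, of m] G'(3)[OF x, of m] \<alpha>\<beta>(1)[of m] by auto
      have "norm (G m x - 1) \<le> 1 + H m" using norm_triangle_ineq4[of "G m x" 1] G(1)[OF x, of m] by simp
      moreover have "norm (?E m x - 1) \<le> 2"
        using norm_triangle_ineq4[of "?E m x" 1] b(1) \<tau>0(2)[of m] by simp
      ultimately have "norm (?E m x) * norm (G m x - 1) + norm (G' m x) * norm (?E m x - 1) \<le> \<tau> m * (1 + H m) + ?\<theta> m * 2"
        using b \<tau>0 \<theta>0 by (intro add_mono mult_mono) auto
      then show ?thesis using * \<tau>H[of m] \<theta>2[of m] by linarith
    next
      case 2
      then have b: "norm (?E m x - 1) \<le> \<tau> m" "norm (G m x - 1) \<le> ?\<theta> m"
        using inv[OF x, of m] G(2)[OF x, of m] \<alpha>\<beta>(1)[of m] by auto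
      have "norm (?E m x) \<le> 2" using norm_triangle_sub[of "?E m x" 1] b(1) \<tau>0(2)[of m] by simp
      moreover have "norm (G' m x) \<le> 1 + H m" using G'(1)[OF x, of m] by simp
      ultimately have "norm (?E m x) * norm (G m x - 1) + norm (G' m x) * norm (?E m x - 1) \<le> 2 * ?\<theta> m + (1 + H m) * \<tau> m"
        using b \<tau>0 \<theta>0 H[of m] by (intro add_mono mult_mono) auto
      then show ?thesis using * \<tau>H[of m] \<theta>2[of m] by (simp add: mult.commute)
    next
      case 3
      have b: "norm (?E m x) \<le> ?B m" "norm (G m x - 1) \<le> ?\<theta> m" "norm (G' m x) \<le> ?\<theta> m"
        using inv[OF x, of m] G(2)[OF x 3(2)] G'(3)[OF x 3(1)] by auto
      have "norm (?E m x - 1) \<le> 1 + ?B m"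
        using norm_triangle_ineq4[of "?E m x" 1] b(1) by simp
      then have "norm (?E m x) * norm (G m x - 1) + norm (G' m x) * norm (?E m x - 1) \<le> ?B m * ?\<theta> m + ?\<theta> m * (1 + ?B m)"
        using b \<theta>0 B[of m] by (intro add_mono mult_mono) auto
      also have "\<dots> = ?\<theta> m * (1 + 2 * ?B m)" by (simp add: algebra_simps)
      finally show ?thesis using * \<theta>B[of m] zero_le_power[of "1/2::real" m] by linarith
    qed
  qed
  define L where "L x = E x + (\<Sum>m. ?E (Suc m) x - ?E m x)" for x
  have "uniform_limit S (\<lambda>n x. \<Sum>m<n. ?E (Suc m) x - ?E m x) (\<lambda>x. \<Sum>m. ?E (Suc m) x - ?E m x) sequentially"
    by (rule Weierstrass_m_test[OF step]) (auto intro: summable_mult summable_geometric)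
  then have "uniform_limit S (\<lambda>n x. E x + (\<Sum>m<n. ?E (Suc m) x - ?E m x)) L sequentially"
    unfolding L_def by (intro uniform_limit_intros)
  moreover have "E x + (\<Sum>m<n. ?E (Suc m) x - ?E m x) = ?E n x" for n x
    using sum_lessThan_telescope[of "\<lambda>m. ?E m x" n] by (simp del: switch_seq.simps(2))
  ultimately have lim: "uniform_limit S ?E L sequentially" by simp
  have \<tau>lim: "\<tau> \<longlonglongrightarrow> 0"
  proof (rule tendsto_sandwich[OF _ _ tendsto_const])
    show "\<forall>\<^sub>F n in sequentially. 0 \<le> \<tau> n" using \<tau>0(1) by simp
    show "\<forall>\<^sub>F n in sequentially. \<tau> n \<le> (1/2) ^ n"
    proof (intro always_eventually allI)
      fix n
      have "\<tau> n * 1 \<le> \<tau> n * (1 + H n)" using \<tau>0(1)[of n] H[of n] by (intro mult_left_mono) auto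
      then show "\<tau> n \<le> (1/2) ^ n" using \<tau>H[of n] by simp
    qed
    show "(\<lambda>n. (1/2) ^ n) \<longlonglongrightarrow> (0::real)" by (intro LIMSEQ_realpow_zero) auto
  qed
  show ?thesis
  proof (rule that[OF lim])
    fix x assume x: "x \<in> S" and l: "\<And>m. \<beta> m \<le> lev x"
    have "(\<lambda>m. ?E m x) \<longlonglongrightarrow> 0"
      by (rule Lim_null_comparison[OF _ \<tau>lim]) (use inv[OF x] l in auto)
    then show "L x = 0" using tendsto_uniform_limitI[OF lim x] LIMSEQ_unique by blast
  next
    fix x assume x: "x \<in> S" and l: "\<And>m. lev x \<le> \<alpha> m"
    have "(\<lambda>m. ?E m x - 1) \<longlonglongrightarrow> 0"
      by (rule Lim_null_comparison[OF _ \<tau>lim]) (use inv[OF x] l in auto)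
    then have "(\<lambda>m. ?E m x) \<longlonglongrightarrow> 1" by (simp add: LIM_zero_iff)
    then show "L x = 1" using tendsto_uniform_limitI[OF lim x] LIMSEQ_unique by blast
  qed
qed

lemma holomorphic_switch_seq:
  assumes "finite P0" "P0 \<inter> K = {}" "E holomorphic_on - P0"
    and "\<And>m. \<exists>P. finite P \<and> P \<inter> K = {} \<and> G m holomorphic_on - P"
    and "\<And>m. \<exists>P. finite P \<and> P \<inter> K = {} \<and> G' m holomorphic_on - P"
  shows "\<exists>P. finite P \<and> P \<inter> K = {} \<and> switch_seq E G G' n holomorphic_on - P"
proof (induction n)
  case 0
  have "switch_seq E G G' 0 = E" by (rule ext) simp
  then show ?case using assms(1-3) by auto
next
  case (Suc n)
  obtain P where P: "finite P" "P \<inter> K = {}" "switch_seq E G G' n holomorphic_on - P" using Suc.IH by blast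
  obtain Q where Q: "finite Q" "Q \<inter> K = {}" "G n holomorphic_on - Q" using assms(4) by blast
  obtain R where R: "finite R" "R \<inter> K = {}" "G' n holomorphic_on - R" using assms(5) by blast
  let ?U = "P \<union> Q \<union> R"
  have h: "switch_seq E G G' n holomorphic_on - ?U" "G n holomorphic_on - ?U" "G' n holomorphic_on - ?U"
    by (rule holomorphic_on_subset[OF P(3)] holomorphic_on_subset[OF Q(3)] holomorphic_on_subset[OF R(3)]; blast)+
  have eq: "switch_seq E G G' (Suc n) = (\<lambda>x. switch_seq E G G' n x * (G n x - G' n x) + G' n x)"
    by (rule ext) simp
  have "switch_seq E G G' (Suc n) holomorphic_on - ?U"
    by (subst eq) (rule holomorphic_on_add[OF holomorphic_on_mult[OF h(1) holomorphic_on_diff[OF h(2,3)]] h(3)])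
  moreover have "finite ?U" "?U \<inter> K = {}" using P Q R by auto
  ultimately show ?case by (intro exI[of _ ?U] conjI)
qed

text \<open>The choices are made in the order circles, \<open>\<kappa>\<close>, bounds
  \<open>H\<close>, tolerances, degrees \<open>N\<close>. There is no circularity because neither
  the bounds nor the total removed radius depends on the degrees.\<close>

lemma swiss_bump:
  fixes c :: complex
  assumes ab: "0 < a" "a < b" and "0 < \<epsilon>"
  shows "\<exists>(p :: nat \<times> nat \<Rightarrow> complex) r (F :: nat \<Rightarrow> complex \<Rightarrow> complex) L.
     (\<forall>j. 0 \<le> r j) \<and> (\<forall>J. finite J \<longrightarrow> sum r J \<le> \<epsilon>) \<and> (\<forall>j. norm (p j) \<le> norm c + b) \<and>
     (\<forall>n. \<exists>P. finite P \<and> P \<inter> swiss p r UNIV = {} \<and> F n holomorphic_on - P) \<and>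
     uniform_limit (swiss p r UNIV) F L sequentially \<and> L 0 = 0 \<and>
     (\<forall>z\<in>swiss p r UNIV. z \<noteq> 0 \<longrightarrow> b \<le> norm (1 / z - c) \<longrightarrow> L z = 0) \<and>
     (\<forall>z\<in>swiss p r UNIV. z \<noteq> 0 \<longrightarrow> norm (1 / z - c) \<le> a \<longrightarrow> L z = 1)"
proof -
  \<comment> \<open>The shift by 3 keeps \<open>d m\<close> below \<open>(b - a) / 2\<close>, so
    that \<open>\<alpha> m < \<beta> m\<close>.\<close>
  define d where "d m = (b - a) / (real m + 3)" for m
  have d: "0 < d m" "d (Suc m) < d m" "d m < (b - a) / 2" for m
  proof -
    show "0 < d m" using ab by (simp add: d_def)
    show "d (Suc m) < d m" using ab unfolding d_def by (intro divide_strict_left_mono mult_pos_pos) auto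
    show "d m < (b - a) / 2" using ab unfolding d_def by (intro divide_strict_left_mono mult_pos_pos) auto
  qed
  define \<alpha> \<beta> where "\<alpha> m = a + d m" and "\<beta> m = b - d m" for m
  \<comment> \<open>Kernel 0 switches between \<open>\<alpha> 0\<close> and
    \<open>\<beta> 0\<close>, kernel \<open>2 * m + 1\<close> between \<open>\<beta> m\<close> and
    \<open>\<beta> (Suc m)\<close>, kernel \<open>2 * m + 2\<close> between
    \<open>\<alpha> (Suc m)\<close> and \<open>\<alpha> m\<close>: alternately, the circles approach
    \<open>b\<close> from inside and \<open>a\<close> from outside.\<close>
  define lo hi where "lo n = (if n = 0 then \<alpha> 0 else if odd n then \<beta> (n div 2) else \<alpha> (n div 2))"
    and "hi n = (if n = 0 then \<beta> 0 else if odd n then \<beta> (Suc (n div 2)) else \<alpha> (n div 2 - 1))" for n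
  have \<alpha>\<beta>: "\<alpha> m < \<beta> m" "\<alpha> (Suc m) < \<alpha> m" "\<beta> m < \<beta> (Suc m)" "a < \<alpha> m" "\<beta> m < b" for m
    using d[of m] by (auto simp: \<alpha>_def \<beta>_def)
  have a_m: "0 < \<alpha> m" "\<alpha> m < b" "0 < \<beta> m" for m using \<alpha>\<beta>[of m] ab by linarith+
  have lohi: "0 < lo n" "lo n < hi n" "hi n \<le> b" for n
  proof -
    show "0 < lo n" using a_m by (simp add: lo_def)
    show "hi n \<le> b" using a_m \<alpha>\<beta>(5) by (simp add: hi_def less_imp_le)
    show "lo n < hi n"
      using \<alpha>\<beta>(1)[of 0] \<alpha>\<beta>(3)[of "n div 2"] \<alpha>\<beta>(2)[of "n div 2 - 1"]
      by (auto simp: lo_def hi_def elim!: evenE)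
  qed
  define \<rho> where "\<rho> n = (lo n + hi n) / 2" for n
  have \<rho>: "0 < \<rho> n" "lo n < \<rho> n" "\<rho> n < hi n" "\<rho> n \<le> b" for n
    using lohi[of n] by (auto simp: \<rho>_def)
  define \<kappa> where "\<kappa> n = min 1 (\<epsilon> / b) / 2 ^ Suc n" for n
  have b0: "0 < b" using ab by simp
  have \<kappa>: "0 < \<kappa> n" "\<kappa> n \<le> 1" "\<kappa> n * b \<le> \<epsilon> * (1/2) ^ Suc n" "\<kappa> (Suc n) \<le> \<kappa> n" for n
  proof -
    show "0 < \<kappa> n" using \<open>0 < \<epsilon>\<close> b0 by (simp add: \<kappa>_def)
    have "\<kappa> n \<le> 1 / 2 ^ Suc n" unfolding \<kappa>_def by (intro divide_right_mono) auto
    also have "\<dots> \<le> 1" using one_le_power[of "2::real" "Suc n"] by simp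
    finally show "\<kappa> n \<le> 1" .
    have "\<kappa> n \<le> \<epsilon> / b / 2 ^ Suc n" unfolding \<kappa>_def by (intro divide_right_mono) auto
    then have "\<kappa> n * b \<le> \<epsilon> / b / 2 ^ Suc n * b" using b0 by (intro mult_right_mono) auto
    then show "\<kappa> n * b \<le> \<epsilon> * (1/2) ^ Suc n" using b0 by (simp add: power_one_over)
    show "\<kappa> (Suc n) \<le> \<kappa> n" using \<open>0 < \<kappa> n\<close> by (simp add: \<kappa>_def)
  qed
  \<comment> \<open>Step \<open>m\<close> uses the kernels \<open>2 * m + 1\<close> and
    \<open>2 * m + 2\<close>; since \<open>\<kappa>\<close> decreases, the bound of the later one
    serves both.\<close>
  define H where "H m = 8 / \<kappa> (2 * m + 2)" for m
  have H8: "8 / \<kappa> n \<le> 8 / \<kappa> k" if "n \<le> k" for n k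
    using \<kappa> that lift_Suc_antimono_le[of \<kappa>, OF \<kappa>(4) that] by (intro divide_left_mono mult_pos_pos) auto
  have H1: "1 \<le> H m" for m
    using \<kappa>[of "2 * m + 2"] by (simp add: H_def)
  define \<theta> where "\<theta> n = (if n = 0 then 1 / (1 + H 0) else switch_tol H ((n - 1) div 2))" for n
  have \<theta>: "0 < \<theta> n" for n
    using H1 switch_bound_ge_1[OF H1] unfolding \<theta>_def switch_tol_def
    by (auto intro!: divide_pos_pos mult_pos_pos add_pos_nonneg less_le_trans[OF zero_less_one H1]
        less_imp_le[OF less_le_trans[OF zero_less_one]])
  have "\<exists>N>0. (\<forall>z. z \<noteq> 0 \<longrightarrow> norm (1 / z - c) \<le> lo n \<longrightarrow> norm (disc_kernel c (\<rho> n) N z - 1) \<le> \<theta> n) \<and>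
      (\<forall>z. z \<noteq> 0 \<longrightarrow> hi n \<le> norm (1 / z - c) \<longrightarrow> norm (disc_kernel c (\<rho> n) N z) \<le> \<theta> n)" for n
    using disc_kernel_small[OF lohi(1)[of n] \<rho>(2)[of n] \<rho>(3)[of n] \<theta>[of n], where c = c] by metis
  then obtain N where N: "\<And>n. 0 < N n"
    "\<And>n z. z \<noteq> 0 \<Longrightarrow> norm (1 / z - c) \<le> lo n \<Longrightarrow> norm (disc_kernel c (\<rho> n) (N n) z - 1) \<le> \<theta> n"
    "\<And>n z. z \<noteq> 0 \<Longrightarrow> hi n \<le> norm (1 / z - c) \<Longrightarrow> norm (disc_kernel c (\<rho> n) (N n) z) \<le> \<theta> n"
    by metis
  define k where "k n = disc_kernel c (\<rho> n) (N n)" for n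
  define p where "p = (\<lambda>(n, l). c + \<rho> n * cis (2 * pi * real l / real (N n)))"
  \<comment> \<open>Pairs with \<open>l \<ge> N n\<close> only pad the index type, and radius 0
    removes nothing.\<close>
  define r where "r = (\<lambda>(n, l). if l < N n then \<rho> n * \<kappa> n / N n else 0)"
  let ?S = "swiss p r UNIV"
  have r0: "0 \<le> r j" for j using \<rho>(1) \<kappa>(1) by (auto simp: r_def split: prod.splits intro: less_imp_le)
  have pb: "norm (p j) \<le> norm c + b" for j
  proof (cases j)
    case (Pair n l)
    have "norm (p j) \<le> norm c + norm (\<rho> n * cis (2 * pi * real l / real (N n)))"
      unfolding Pair p_def by (simp only: prod.case) (rule norm_triangle_ineq)
    then show ?thesis using \<rho>(1,4)[of n] by (simp add: norm_mult)
  qed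
  have r_sum: "sum r J \<le> \<epsilon>" if J: "finite J" for J
  proof -
    obtain m where m: "J \<subseteq> {..<m} \<times> {..<m}"
    proof -
      have "finite (fst ` J \<union> snd ` J)" using J by simp
      then obtain m where "fst ` J \<union> snd ` J \<subseteq> {..<m}" using finite_nat_bounded by blast
      then have "J \<subseteq> {..<m} \<times> {..<m}" by (auto simp: image_subset_iff)
      then show ?thesis by (rule that)
    qed
    have "sum r J \<le> sum r ({..<m} \<times> {..<m})" using m r0 by (intro sum_mono2) auto
    also have "\<dots> = (\<Sum>n<m. \<Sum>l<m. r (n, l))" by (simp add: sum.cartesian_product)
    also have "\<dots> \<le> (\<Sum>n<m. \<epsilon> * (1/2) ^ Suc n)"
    proof (rule sum_mono)
      fix n
      have "(\<Sum>l<m. r (n, l)) = (\<Sum>l\<in>{l\<in>{..<m}. l < N n}. \<rho> n * \<kappa> n / N n)"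
        unfolding r_def prod.case by (rule sum.inter_filter[symmetric]) simp
      also have "\<dots> \<le> real (N n) * (\<rho> n * \<kappa> n / N n)"
        using card_mono[of "{..<N n}" "{l\<in>{..<m}. l < N n}", OF _ subsetI] \<rho>(1)[of n] \<kappa>(1)[of n]
        by (simp del: times_divide_eq_right) (intro mult_right_mono, simp_all)
      also have "\<dots> = \<kappa> n * \<rho> n" using N(1)[of n] by simp
      also have "\<dots> \<le> \<kappa> n * b" using \<rho>(4)[of n] \<kappa>(1)[of n] by simp
      also have "\<dots> \<le> \<epsilon> * (1/2) ^ Suc n" by (rule \<kappa>(3))
      finally show "(\<Sum>l<m. r (n, l)) \<le> \<epsilon> * (1/2) ^ Suc n" .
    qed
    also have "\<dots> = \<epsilon> * (\<Sum>n<m. (1/2) ^ Suc n)" by (simp add: sum_distrib_left)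
    also have "(\<Sum>n<m. (1/2::real) ^ Suc n) = 1 - (1/2) ^ m" by (induction m) (auto simp: field_simps)
    also have "\<epsilon> * (1 - (1/2) ^ m) \<le> \<epsilon>" using \<open>0 < \<epsilon>\<close> by (simp add: algebra_simps)
    finally show ?thesis .
  qed
  have far: "\<rho> n * \<kappa> n / N n \<le> norm (1 / z - (c + \<rho> n * cis (2 * pi * real l / real (N n))))"
    if "z \<in> ?S" "z \<noteq> 0" "l < N n" for z n l
  proof -
    have "1 / (1 / z) \<in> ?S" using that by simp
    then have "1 / z \<notin> ball (p (n, l)) (r (n, l))"
      using inverse_in_swiss_iff[of "1 / z" p r UNIV] that(2) by simp
    then show ?thesis using that(3) by (simp add: p_def r_def dist_norm norm_minus_commute)
  qed
  have kb: "norm (k n z) \<le> 8 / \<kappa> n" if "z \<in> ?S" for z n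
  proof (cases "z = 0")
    case True
    then show ?thesis using \<kappa>(1)[of n] N(1)[of n] by (simp add: k_def)
  next
    case False
    then show ?thesis unfolding k_def
      using disc_kernel_bound(2)[OF N(1) \<rho>(1) \<kappa>(1,2) False far[OF that False]] by simp
  qed
  have holo: "\<exists>P. finite P \<and> P \<inter> ?S = {} \<and> k n holomorphic_on - P" for n
  proof (intro exI conjI)
    let ?Z = "(\<lambda>l. 1 / (c + \<rho> n * cis (2 * pi * real l / real (N n)))) ` {..<N n} - {0}"
    show "finite ?Z" "k n holomorphic_on - ?Z"
      unfolding k_def using disc_kernel_holomorphic[OF N(1) \<rho>(1)] by auto
    show "?Z \<inter> ?S = {}"
    proof (rule equals0I)
      fix z assume z: "z \<in> ?Z \<inter> ?S"
      then obtain l where l: "l < N n" "z = 1 / (c + \<rho> n * cis (2 * pi * real l / real (N n)))" by auto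
      then have "norm (1 / z - (c + \<rho> n * cis (2 * pi * real l / real (N n)))) = 0" by simp
      then have "\<rho> n * \<kappa> n / N n \<le> 0" using far[of z l n] z l(1) by auto
      then show False using \<rho>(1)[of n] \<kappa>(1)[of n] N(1)[of n] by (simp add: divide_le_0_iff mult_le_0_iff not_le)
    qed
  qed
  \<comment> \<open>The point \<open>z = 0\<close> is \<open>w = \<infinity>\<close>. The value
    \<open>b\<close> puts it beyond every circle, in agreement with the kernels being 0
    there.\<close>
  define lev where "lev z = (if z = 0 then b else norm (1 / z - c))" for z :: complex
  have k_lo: "norm (k n z - 1) \<le> \<theta> n" if "lev z \<le> lo n" for n z
    using that N(2)[of z n] lohi(2,3)[of n] by (auto simp: lev_def k_def split: if_splits)
  have k_hi: "norm (k n z) \<le> \<theta> n" if "hi n \<le> lev z" for n z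
    using that N(3)[of z n] N(1)[of n] \<theta>[of n] by (auto simp: lev_def k_def less_imp_le split: if_splits)
  define G G' where "G m = k (2 * m + 1)" and "G' m = k (2 * m + 2)" for m
  have idx: "lo 0 = \<alpha> 0" "hi 0 = \<beta> 0" "lo (2 * m + 1) = \<beta> m" "hi (2 * m + 1) = \<beta> (Suc m)"
    "lo (2 * m + 2) = \<alpha> (Suc m)" "hi (2 * m + 2) = \<alpha> m"
    "\<theta> (2 * m + 1) = switch_tol H m" "\<theta> (2 * m + 2) = switch_tol H m" "\<theta> 0 = 1 / (1 + H 0)" for m
    by (simp_all add: lo_def hi_def \<theta>_def)
  obtain L where L: "uniform_limit ?S (switch_seq (k 0) G G') L sequentially"
    "\<And>z. z \<in> ?S \<Longrightarrow> (\<And>m. \<beta> m \<le> lev z) \<Longrightarrow> L z = 0"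
    "\<And>z. z \<in> ?S \<Longrightarrow> (\<And>m. lev z \<le> \<alpha> m) \<Longrightarrow> L z = 1"
  proof (rule switch_seq_converges[where S = ?S and lev = lev and H = H and \<alpha> = \<alpha> and \<beta> = \<beta> and E = "k 0" and G = G and G' = G'])
    show "norm (k 0 z) \<le> H 0" if "z \<in> ?S" for z
      using kb[OF that, of 0] H8[of 0 2] by (simp add: H_def numeral_2_eq_2)
    show "norm (G m z) \<le> H m" if "z \<in> ?S" for m z
      using kb[OF that, of "2 * m + 1"] H8[of "2 * m + 1" "2 * m + 2"] by (simp add: H_def G_def)
    show "norm (G' m z) \<le> H m" if "z \<in> ?S" for m z
      using kb[OF that, of "2 * m + 2"] by (simp add: H_def G'_def)
    show "norm (k 0 z) \<le> 1 / (1 + H 0)" if "\<beta> 0 \<le> lev z" for z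
      using k_hi[of 0 z] that by (simp only: idx)
    show "norm (k 0 z - 1) \<le> 1 / (1 + H 0)" if "lev z \<le> \<alpha> 0" for z
      using k_lo[of z 0] that by (simp only: idx)
    show "norm (G m z - 1) \<le> switch_tol H m" if "lev z \<le> \<beta> m" for m z
      unfolding G_def using k_lo[of z "2 * m + 1"] that by (simp only: idx)
    show "norm (G m z) \<le> switch_tol H m" if "\<beta> (Suc m) \<le> lev z" for m z
      unfolding G_def using k_hi[of "2 * m + 1" z] that by (simp only: idx)
    show "norm (G' m z - 1) \<le> switch_tol H m" if "lev z \<le> \<alpha> (Suc m)" for m z
      unfolding G'_def using k_lo[of z "2 * m + 2"] that by (simp only: idx)
    show "norm (G' m z) \<le> switch_tol H m" if "\<alpha> m \<le> lev z" for m z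
      unfolding G'_def using k_hi[of "2 * m + 2" z] that by (simp only: idx)
  qed (use \<alpha>\<beta> H1 in \<open>auto intro: less_imp_le\<close>)
  obtain P0 where P0: "finite P0" "P0 \<inter> ?S = {}" "k 0 holomorphic_on - P0" using holo[of 0] by blast
  show ?thesis
  proof (intro exI conjI)
    show "\<forall>j. 0 \<le> r j" "\<forall>J. finite J \<longrightarrow> sum r J \<le> \<epsilon>" "\<forall>j. norm (p j) \<le> norm c + b"
      using r0 r_sum pb by auto
    show "\<forall>n. \<exists>P. finite P \<and> P \<inter> ?S = {} \<and> switch_seq (k 0) G G' n holomorphic_on - P"
      by (intro allI holomorphic_switch_seq[OF P0]) (simp_all add: G_def G'_def holo)
    show "uniform_limit ?S (switch_seq (k 0) G G') L sequentially" by (rule L(1))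
    show "L 0 = 0" using L(2)[of 0] \<alpha>\<beta>(5) by (simp add: lev_def less_imp_le)
    show "\<forall>z\<in>?S. z \<noteq> 0 \<longrightarrow> b \<le> norm (1 / z - c) \<longrightarrow> L z = 0"
    proof (intro ballI impI)
      fix z assume z: "z \<in> ?S" "z \<noteq> 0" "b \<le> norm (1 / z - c)"
      have "\<beta> m \<le> lev z" for m using z(2,3) \<alpha>\<beta>(5)[of m] by (simp add: lev_def)
      then show "L z = 0" by (rule L(2)[OF z(1)])
    qed
    show "\<forall>z\<in>?S. z \<noteq> 0 \<longrightarrow> norm (1 / z - c) \<le> a \<longrightarrow> L z = 1"
    proof (intro ballI impI)
      fix z assume z: "z \<in> ?S" "z \<noteq> 0" "norm (1 / z - c) \<le> a"
      have "lev z \<le> \<alpha> m" for m using z(2,3) \<alpha>\<beta>(4)[of m] by (simp add: lev_def)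
      then show "L z = 1" by (rule L(3)[OF z(1)])
    qed
  qed
qed

section \<open>The planar algebra\<close>

lemma fps_closure_continuous:
  fixes S :: "'a::topological_space set"
  assumes "\<And>f s. (f, s) \<in> G \<Longrightarrow> continuous_on S f" and f: "(f, s) \<in> fps_closure S G"
  shows "continuous_on S f"
proof -
  have "\<exists>g. continuous_on S g \<and> (\<forall>x\<in>S. norm (f x - g x) \<le> inverse (Suc n))" for n
  proof -
    have "0 < inverse (real (Suc n))" by simp
    then obtain g t where "(g, t) \<in> G" "\<And>x. x \<in> S \<Longrightarrow> norm (f x - g x) \<le> inverse (Suc n)"
      by (rule fps_closureD[OF f, where n = 0]) blast
    then show ?thesis using assms(1) by blast
  qed
  then obtain g where g: "\<And>n. continuous_on S (g n)" "\<And>n x. x \<in> S \<Longrightarrow> norm (f x - g n x) \<le> inverse (Suc n)"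
    by metis
  have "uniform_limit S g f sequentially"
  proof (rule uniform_limitI)
    fix e :: real assume "0 < e"
    have "\<forall>\<^sub>F n in sequentially. inverse (real (Suc n)) < e"
      by (rule order_tendstoD(2)[OF LIMSEQ_inverse_real_of_nat \<open>0 < e\<close>])
    then show "\<forall>\<^sub>F n in sequentially. \<forall>x\<in>S. dist (g n x) (f x) < e"
    proof (rule eventually_mono, intro ballI)
      fix n x assume "inverse (real (Suc n)) < e" "x \<in> S"
      then show "dist (g n x) (f x) < e"
        using g(2)[of x n] by (simp add: dist_norm norm_minus_commute)
    qed
  qed
  then show ?thesis
    by (rule uniform_limit_theorem[rotated]) (auto simp: g(1) intro: always_eventually)
qed

lemma merom_on_continuous: "(f, s) \<in> merom_on K \<Longrightarrow> continuous_on K f"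
  unfolding merom_on_def
  by (auto intro!: holomorphic_on_imp_continuous_on intro: holomorphic_on_subset)

lemma rational_complex_near:
  fixes w :: complex
  assumes "0 < e"
  obtains x y :: rat where "norm (w - Complex (of_rat x) (of_rat y)) < e"
proof -
  obtain x where x: "Re w < real_of_rat x" "real_of_rat x < Re w + e / 2"
    using of_rat_dense[of "Re w" "Re w + e / 2"] assms by auto
  obtain y where y: "Im w < real_of_rat y" "real_of_rat y < Im w + e / 2"
    using of_rat_dense[of "Im w" "Im w + e / 2"] assms by auto
  have "norm (w - Complex (of_rat x) (of_rat y)) < e"
    using cmod_le[of "w - Complex (of_rat x) (of_rat y)"] x y by simp
  then show ?thesis by (rule that)
qed

text \<open>An enumeration of all rational centres and pairs of radii; the default values secure
  \<open>0 < a\<close> and \<open>a < b\<close> for every index.\<close>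

definition bump_data :: "nat \<Rightarrow> complex \<times> real \<times> real" where
  "bump_data i = (case from_nat i :: rat \<times> rat \<times> rat \<times> rat of (x, y, s, t) \<Rightarrow>
     let a = (if 0 < s then of_rat s else 1); b = (if a < of_rat t then of_rat t else a + 1)
     in (Complex (of_rat x) (of_rat y), a, b))"

lemma bump_data_pos: "bump_data i = (c, a, b) \<Longrightarrow> 0 < a \<and> a < b"
  by (auto simp: bump_data_def Let_def split: prod.splits if_splits)

lemma bump_data_surj:
  assumes "0 < s" "s < t"
  shows "\<exists>i. bump_data i = (Complex (of_rat x) (of_rat y), of_rat s, of_rat t)"
  by (rule exI[of _ "to_nat (x, y, s, t)"]) (use assms in \<open>simp add: bump_data_def of_rat_less\<close>)

text \<open>\<open>K\<close> is the intersection of the cheeses of all bump data, with a disc of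
  radius 1 about \<open>w = 0\<close> also removed to make it bounded. Each bump function is a
  uniform limit on its own cheese, hence on \<open>K\<close>, and the radii are so small that every
  Taylor coefficient is bounded on the intersection.\<close>

lemma planar_algebra:
  shows "\<exists>(K :: complex set) G v. compact K \<and> 0 \<in> K \<and> fps_alg K G \<and> fps_bounded K G \<and>
    (\<lambda>z. z, fps_X) \<in> G \<and> (\<forall>f s. (f, s) \<in> G \<longrightarrow> continuous_on K f) \<and> (\<forall>f s. (f, s) \<in> G \<longrightarrow> fps_nth s 0 = f 0) \<and> (\<forall>i::nat. (v i, 0) \<in> G) \<and>
    (\<forall>y\<in>K - {0}. \<forall>U. open U \<longrightarrow> y \<in> U \<longrightarrow> (\<exists>i W. open W \<and> y \<in> W \<and> (\<forall>z\<in>K \<inter> W. v i z = 1) \<and> (\<forall>z\<in>K - U. v i z = 0))) \<and>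
    (\<forall>U. open U \<longrightarrow> 0 \<in> U \<longrightarrow> (\<exists>i W. open W \<and> 0 \<in> W \<and> (\<forall>z\<in>K \<inter> W. v i z = 0) \<and> (\<forall>z\<in>K - U. v i z = 1)))"
proof -
  define c a b where "c i = fst (bump_data i)" and "a i = fst (snd (bump_data i))" and "b i = snd (snd (bump_data i))" for i
  have ab: "0 < a i" "a i < b i" for i
    using bump_data_pos[of i "c i" "a i" "b i"] by (simp_all add: c_def a_def b_def)
  define D where "D i = 1 + norm (c i) + b i" for i
  have D: "1 \<le> D i" for i using ab[of i] by (simp add: D_def)
  \<comment> \<open>\<open>D i\<close> dominates \<open>1 + norm\<close> of all centres of the
    \<open>i\<close>-th cheese. Division by \<open>D i ^ i\<close> makes the weighted radii summable
    for every power \<open>k\<close> at once: from \<open>i = k\<close> on they are at most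
    \<open>(1/2) ^ Suc i\<close>, and only finitely many \<open>i\<close> remain.\<close>
  define \<epsilon> where "\<epsilon> i = (1/2) ^ Suc i / D i ^ i" for i
  have \<epsilon>: "0 < \<epsilon> i" for i using D[of i] by (simp add: \<epsilon>_def)
  define Q where "Q i p r F L \<longleftrightarrow>
     (\<forall>j. 0 \<le> r j) \<and> (\<forall>J. finite J \<longrightarrow> sum r J \<le> \<epsilon> i) \<and> (\<forall>j. norm (p j) \<le> norm (c i) + b i) \<and>
     (\<forall>n. \<exists>P. finite P \<and> P \<inter> swiss p r UNIV = {} \<and> F n holomorphic_on - P) \<and>
     uniform_limit (swiss p r UNIV) F L sequentially \<and> L 0 = 0 \<and>
     (\<forall>z\<in>swiss p r UNIV. z \<noteq> 0 \<longrightarrow> b i \<le> norm (1 / z - c i) \<longrightarrow> L z = 0) \<and>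
     (\<forall>z\<in>swiss p r UNIV. z \<noteq> 0 \<longrightarrow> norm (1 / z - c i) \<le> a i \<longrightarrow> L z = 1)"
    for i and p :: "nat \<times> nat \<Rightarrow> complex" and r and F :: "nat \<Rightarrow> complex \<Rightarrow> complex" and L
  have "\<exists>p r F L. Q i p r F L" for i
    unfolding Q_def using swiss_bump[OF ab \<epsilon>] by blast
  then obtain p r F v where Q: "\<And>i. Q i (p i) (r i) (F i) (v i)" by metis
  note Q' = Q[unfolded Q_def]
  have r0: "0 \<le> r i j" and pb: "norm (p i j) \<le> norm (c i) + b i" for i j using Q' by blast+
  have rsum: "sum (r i) J \<le> \<epsilon> i" if "finite J" for i J using Q' that by blast
  have holo: "\<exists>P. finite P \<and> P \<inter> swiss (p i) (r i) UNIV = {} \<and> F i n holomorphic_on - P" for i n using Q' by blast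
  have lim: "uniform_limit (swiss (p i) (r i) UNIV) (F i) (v i) sequentially" and v_0: "v i 0 = 0" for i using Q' by blast+
  have v_out: "v i z = 0" if "z \<in> swiss (p i) (r i) UNIV" "z \<noteq> 0" "b i \<le> norm (1 / z - c i)" for i z
    using Q'[of i] that by blast
  have v_in: "v i z = 1" if "z \<in> swiss (p i) (r i) UNIV" "z \<noteq> 0" "norm (1 / z - c i) \<le> a i" for i z
    using Q'[of i] that by blast
  define PP where "PP = (\<lambda>j. case j of None \<Rightarrow> 0 | Some (i, l) \<Rightarrow> p i l)"
  \<comment> \<open>The radius about \<open>w = 0\<close> stays a parameter: it is 1 for
    \<open>K\<close>, and larger where the Taylor data of a bump function are determined close to
    \<open>z = 0\<close>.\<close>
  define RR where "RR \<rho> = (\<lambda>j. case j of None \<Rightarrow> \<rho> | Some (i, l) \<Rightarrow> r i l)" for \<rho> :: real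
  define KK where "KK \<rho> = swiss PP (RR \<rho>) UNIV" for \<rho>
  have KK_iff: "z \<in> KK \<rho> \<longleftrightarrow> \<rho> * norm z \<le> 1 \<and> (\<forall>i. z \<in> swiss (p i) (r i) UNIV)" for \<rho> z
    unfolding KK_def swiss_def PP_def RR_def by (auto split: option.splits)
  have weights: "\<exists>C. \<forall>J. finite J \<longrightarrow> (\<Sum>j\<in>J. RR \<rho> j * (1 + norm (PP j)) ^ k) \<le> C" if "0 < \<rho>" for \<rho> k
  proof (intro exI allI impI)
    fix J :: "(nat \<times> nat \<times> nat) option set" assume J: "finite J"
    define I where "I = Some -` J"
    have finI: "finite I" unfolding I_def using J by (intro finite_vimageI) auto
    have "finite (fst ` I)" using finI by simp
    then obtain n where "fst ` I \<subseteq> {..<n}" using finite_nat_bounded by blast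
    then have I: "I \<subseteq> {..<n} \<times> snd ` I" by (auto simp: image_subset_iff) force
    define t where "t j = RR \<rho> j * (1 + norm (PP j)) ^ k" for j
    have t0: "0 \<le> t j" for j
      unfolding t_def RR_def using r0 that by (auto split: option.splits)
    have "sum t J \<le> sum t (insert None (Some ` ({..<n} \<times> snd ` I)))"
    proof (rule sum_mono2)
      show "J \<subseteq> insert None (Some ` ({..<n} \<times> snd ` I))"
      proof
        fix j assume "j \<in> J"
        then show "j \<in> insert None (Some ` ({..<n} \<times> snd ` I))"
        proof (cases j)
          case (Some w)
          then have "w \<in> {..<n} \<times> snd ` I" using I \<open>j \<in> J\<close> by (auto simp: I_def)
          then show ?thesis using Some by blast
        qed simp
      qed
    qed (use t0 finI in auto)
    also have "\<dots> = \<rho> + (\<Sum>j\<in>{..<n} \<times> snd ` I. t (Some j))"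
      using finI by (subst sum.insert) (auto simp: sum.reindex t_def RR_def PP_def)
    also have "(\<Sum>j\<in>{..<n} \<times> snd ` I. t (Some j)) = (\<Sum>i<n. \<Sum>l\<in>snd ` I. t (Some (i, l)))"
      by (simp add: sum.cartesian_product)
    also have "\<dots> \<le> (\<Sum>i<n. (if i < k then D i ^ k else 0) + (1/2) ^ Suc i)"
    proof (rule sum_mono)
      fix i
      have "(\<Sum>l\<in>snd ` I. t (Some (i, l))) \<le> (\<Sum>l\<in>snd ` I. r i l * D i ^ k)"
        unfolding t_def RR_def PP_def D_def option.case prod.case
        using pb r0 by (intro sum_mono mult_left_mono power_mono) (auto simp: add.assoc)
      also have "\<dots> = sum (r i) (snd ` I) * D i ^ k" by (simp add: sum_distrib_right)
      also have "\<dots> \<le> \<epsilon> i * D i ^ k" using rsum finI D[of i] by (intro mult_right_mono) auto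
      also have "\<dots> \<le> (if i < k then D i ^ k else 0) + (1/2) ^ Suc i"
      proof (cases "i < k")
        case True
        have "(1/2::real) ^ Suc i \<le> 1" by (rule power_le_one) auto
        then have "\<epsilon> i \<le> 1 / 1"
          unfolding \<epsilon>_def using one_le_power[OF D, of i i] by (intro frac_le) auto
        then have "\<epsilon> i * D i ^ k \<le> 1 * D i ^ k" using D[of i] by (intro mult_right_mono) auto
        moreover have "0 \<le> (1/2::real) ^ Suc i" by (rule zero_le_power) simp
        ultimately have "\<epsilon> i * D i ^ k \<le> D i ^ k + (1/2) ^ Suc i" by linarith
        then show ?thesis using True by (simp del: power_Suc)
      next
        case False
        then have "\<epsilon> i * D i ^ k \<le> \<epsilon> i * D i ^ i"
          using D[of i] \<epsilon>[of i] by (intro mult_left_mono power_increasing) auto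
        also have "\<dots> = (1/2) ^ Suc i" using D[of i] by (simp add: \<epsilon>_def)
        finally show ?thesis using False by simp
      qed
      finally show "(\<Sum>l\<in>snd ` I. t (Some (i, l))) \<le> (if i < k then D i ^ k else 0) + (1/2) ^ Suc i" .
    qed
    also have "\<dots> = (\<Sum>i<n. if i < k then D i ^ k else 0) + (\<Sum>i<n. (1/2) ^ Suc i)"
      by (rule sum.distrib)
    also have "\<dots> \<le> (\<Sum>i<k. D i ^ k) + 1"
    proof (rule add_mono)
      have "(\<Sum>i<n. if i < k then D i ^ k else 0) = (\<Sum>i\<in>{i\<in>{..<n}. i < k}. D i ^ k)"
        by (rule sum.inter_filter[symmetric]) simp
      also have "\<dots> \<le> (\<Sum>i<k. D i ^ k)"
        using D by (intro sum_mono2) (auto intro!: zero_le_power order_trans[OF zero_le_one])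
      finally show "(\<Sum>i<n. if i < k then D i ^ k else 0) \<le> (\<Sum>i<k. D i ^ k)" .
      have "(\<Sum>i<n. (1/2::real) ^ Suc i) = 1 - (1/2) ^ n" by (induction n) (auto simp: field_simps)
      then show "(\<Sum>i<n. (1/2::real) ^ Suc i) \<le> 1" by simp
    qed
    finally show "sum t J \<le> \<rho> + ((\<Sum>i<k. D i ^ k) + 1)" by simp
  qed
  have RR0: "0 \<le> RR \<rho> j" if "0 < \<rho>" for \<rho> j using that r0 by (auto simp: RR_def split: option.splits)
  have bounded: "fps_bounded (KK \<rho>) (merom_on (KK \<rho>))" if "0 < \<rho>" for \<rho>
    unfolding KK_def
    by (rule fps_bounded_merom_on[OF RR0[OF that], where ?j0.0 = None]) (use that weights in \<open>auto simp: PP_def RR_def\<close>)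
  define K where "K = KK 1"
  define G where "G = fps_closure K (merom_on K)"
  have K01: "0 \<in> K" "K \<subseteq> cball 0 1" by (auto simp: K_def KK_iff)
  have "closed K" by (simp add: K_def KK_def closed_swiss)
  then have "compact K" using K01(2) compact_Int_closed[OF compact_cball] by (metis inf.absorb2)
  have algM: "fps_alg K (merom_on K)" by (rule fps_alg_merom_on[OF \<open>compact K\<close> K01(1)])
  have bdM: "fps_bounded K (merom_on K)" unfolding K_def by (rule bounded) simp
  have Kp: "z \<in> swiss (p i) (r i) UNIV" if "z \<in> K" for z i using that by (simp add: K_def KK_iff)
  have v0: "(v i, 0) \<in> G" for i
  proof -
    have "\<exists>g t. (g, t) \<in> merom_on K \<and> (\<forall>x\<in>K. norm (v i x - g x) \<le> e)" if "0 < e" for e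
    proof -
      have "\<forall>\<^sub>F n in sequentially. \<forall>x\<in>swiss (p i) (r i) UNIV. dist (F i n x) (v i x) < e"
        using lim that by (rule uniform_limitD)
      then obtain n where n: "\<forall>x\<in>swiss (p i) (r i) UNIV. dist (F i n x) (v i x) < e"
        using eventually_happens'[OF sequentially_bot] by blast
      obtain P where P: "finite P" "P \<inter> swiss (p i) (r i) UNIV = {}" "F i n holomorphic_on - P"
        using holo by blast
      have "P \<inter> K = {}" using P(2) Kp by blast
      then have "(F i n, fps_expansion (F i n) 0) \<in> merom_on K"
        using P K01(1) by (intro merom_onI) auto
      moreover have "\<forall>x\<in>K. norm (v i x - F i n x) \<le> e"
        using n Kp by (auto simp: dist_norm norm_minus_commute less_imp_le)
      ultimately show ?thesis by blast
    qed
    then obtain s where s: "(v i, s) \<in> G"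
      unfolding G_def using fps_closure_complete[OF algM bdM, of "v i"] by blast
    \<comment> \<open>On \<open>KK \<rho>\<close>, a smaller set that still contains 0, the distance
      of \<open>1 / z\<close> from \<open>c i\<close> is at least \<open>b i\<close>, so
      \<open>v i\<close> vanishes. The coefficients are bounded by the supremum over
      \<open>KK \<rho>\<close> as well, which forces them to be 0.\<close>
    define \<rho> where "\<rho> = 1 + norm (c i) + b i"
    have "1 \<le> \<rho>" using ab[of i] by (simp add: \<rho>_def)
    then have \<rho>: "1 \<le> \<rho>" "0 < \<rho>" by linarith+
    have "KK \<rho> \<subseteq> K"
    proof
      fix z assume z: "z \<in> KK \<rho>"
      have "1 * norm z \<le> \<rho> * norm z" using \<rho> by (intro mult_right_mono) auto
      then show "z \<in> K" using z by (simp add: K_def KK_iff)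
    qed
    then have "merom_on K \<subseteq> merom_on (KK \<rho>)" "fps_closure K (merom_on K) \<subseteq> fps_closure (KK \<rho>) (merom_on K)"
      using merom_on_antimono fps_closure_antimono by blast+
    moreover have "fps_closure (KK \<rho>) (merom_on K) \<subseteq> fps_closure (KK \<rho>) (merom_on (KK \<rho>))"
      using \<open>merom_on K \<subseteq> merom_on (KK \<rho>)\<close> by (rule fps_closure_mono)
    ultimately have s': "(v i, s) \<in> fps_closure (KK \<rho>) (merom_on (KK \<rho>))"
      using s unfolding G_def by blast
    have vz: "v i z = 0" if z: "z \<in> KK \<rho>" for z
    proof (cases "z = 0")
      case False
      have zi: "z \<in> swiss (p i) (r i) UNIV" and "\<rho> * norm z \<le> 1" using z by (auto simp: KK_iff)
      then have "\<rho> \<le> norm (1 / z)" using False by (simp add: norm_divide field_simps)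
      then have "b i \<le> norm (1 / z - c i)"
        using norm_triangle_sub[of "1 / z" "c i"] by (simp add: \<rho>_def)
      then show ?thesis by (rule v_out[OF zi False])
    qed (simp add: v_0)
    have "s = 0"
    proof (rule fps_ext)
      fix k
      obtain C where C: "\<And>f s M. (f, s) \<in> fps_closure (KK \<rho>) (merom_on (KK \<rho>)) \<Longrightarrow>
          (\<And>x. x \<in> KK \<rho> \<Longrightarrow> norm (f x) \<le> M) \<Longrightarrow> 0 \<le> M \<Longrightarrow> norm (fps_nth s k) \<le> C * M"
        by (rule fps_boundedE[OF fps_bounded_closure[OF bounded[OF \<rho>(2)]], where k = k]) blast
      have "norm (fps_nth s k) \<le> C * 0" by (rule C[OF s']) (use vz in auto)
      then show "fps_nth s k = fps_nth 0 k" by simp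
    qed
    then show ?thesis using s by simp
  qed
  show ?thesis
  proof (rule exI[of _ K], rule exI[of _ G], rule exI[of _ v], intro conjI allI ballI impI)
    show "compact K" "0 \<in> K" by fact+
    show "fps_alg K G" unfolding G_def by (rule fps_alg_closure[OF algM])
    show "fps_bounded K G" unfolding G_def by (rule fps_bounded_closure[OF bdM])
    have "((\<lambda>z. z), fps_X) \<in> merom_on K"
      unfolding merom_on_def by (auto intro!: exI[of _ "{}"] fps_expansion_intros holomorphic_intros)
    then show "((\<lambda>z. z), fps_X) \<in> G" unfolding G_def using fps_closure_superset by blast
    show "continuous_on K f" if "(f, s) \<in> G" for f s
      by (rule fps_closure_continuous[of "merom_on K" K f s]) (use merom_on_continuous that in \<open>auto simp: G_def\<close>)
    show "fps_nth s 0 = f 0" if "(f, s) \<in> G" for f s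
      by (rule fps_closure_eval[OF _ K01(1), of "merom_on K"])
        (use that in \<open>auto simp: G_def merom_on_def has_fps_expansion_imp_0_eq_fps_nth_0\<close>)
    show "(v i, 0) \<in> G" for i by fact
  next
    fix y U assume y: "y \<in> K - {0}" and U: "open U" "y \<in> U"
    define V where "V = {u. u \<noteq> 0 \<and> 1 / u \<in> U}"
    have "open (- {0} \<inter> (\<lambda>u. 1 / u) -` U)"
      by (intro continuous_open_preimage continuous_intros U) auto
    then have "open V" by (simp add: V_def vimage_def Int_def)
    moreover have "1 / y \<in> V" using y U by (simp add: V_def)
    ultimately obtain e where e: "0 < e" "ball (1 / y) e \<subseteq> V" using open_contains_ball by metis
    \<comment> \<open>With a centre within \<open>e / 8\<close> of \<open>1 / y\<close>, the inner
      disc contains \<open>1 / y\<close>, and the outer disc stays in the ball of radius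
      \<open>e\<close> because \<open>e / 2 + e / 8 < e\<close>.\<close>
    obtain s where s: "e / 8 < real_of_rat s" "real_of_rat s < e / 4" using of_rat_dense[of "e/8" "e/4"] e(1) by auto
    obtain t where t: "e / 4 < real_of_rat t" "real_of_rat t < e / 2" using of_rat_dense[of "e/4" "e/2"] e(1) by auto
    have st: "0 < s" "s < t"
    proof -
      have "0 < real_of_rat s" using s e(1) by linarith
      then show "0 < s" by simp
      have "real_of_rat s < real_of_rat t" using s t by linarith
      then show "s < t" by (simp only: of_rat_less)
    qed
    obtain x x' where near: "norm (1 / y - Complex (of_rat x) (of_rat x')) < e / 8"
      using rational_complex_near[of "e / 8" "1 / y"] e(1) by auto
    obtain i where "bump_data i = (Complex (of_rat x) (of_rat x'), of_rat s, of_rat t)"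
      using bump_data_surj[OF st] by blast
    then have i: "c i = Complex (of_rat x) (of_rat x')" "a i = of_rat s" "b i = of_rat t"
      by (simp_all add: c_def a_def b_def)
    define W where "W = {z. z \<noteq> 0 \<and> norm (1 / z - c i) < a i}"
    have "open (- {0} \<inter> (\<lambda>z. norm (1 / z - c i)) -` {..<a i})"
      by (intro continuous_open_preimage continuous_intros) auto
    then have "open W" by (simp add: W_def vimage_def Int_def)
    moreover have "y \<in> W" using y near s by (simp add: W_def i)
    moreover have "\<forall>z\<in>K \<inter> W. v i z = 1" using Kp v_in by (auto simp: W_def less_imp_le)
    moreover have "v i z = 0" if z: "z \<in> K - U" for z
    proof (cases "z = 0")
      case False
      have "b i \<le> norm (1 / z - c i)"
      proof (rule ccontr)
        assume "\<not> ?thesis"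
        then have "norm (1 / z - c i) < e / 2" using t i by simp
        moreover have "norm (c i - 1 / y) < e / 8" using near by (simp add: i norm_minus_commute)
        ultimately have "norm (1 / z - 1 / y) < e"
          using norm_triangle_ineq[of "1 / z - c i" "c i - 1 / y"] e(1) by simp
        then have "1 / z \<in> V" using e(2) by (auto simp: dist_norm norm_minus_commute)
        then show False using z by (simp add: V_def)
      qed
      then show ?thesis using z Kp by (intro v_out False) auto
    qed (simp add: v_0)
    ultimately show "\<exists>i W. open W \<and> y \<in> W \<and> (\<forall>z\<in>K \<inter> W. v i z = 1) \<and> (\<forall>z\<in>K - U. v i z = 0)" by blast
  next
    fix U :: "complex set" assume U: "open U" "0 \<in> U"
    obtain e where e: "0 < e" "ball 0 e \<subseteq> U" using U open_contains_ball by metis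
    \<comment> \<open>Centred at \<open>w = 0\<close> with inner radius above \<open>1 / e\<close>,
      the bump function is 1 for \<open>norm z \<ge> e\<close> and 0 near \<open>z = 0\<close>. So
      \<open>1 - v i\<close> is a cutoff at 0, while \<open>v i\<close> keeps its zero Taylor
      data.\<close>
    obtain s where s: "1 / e < real_of_rat s" using of_rat_dense[of "1/e" "1/e + 1"] by auto
    have st: "0 < s" "s < s + 1"
    proof -
      have "0 < real_of_rat s" using less_trans[OF _ s, of 0] e(1) by simp
      then show "0 < s" by simp
    qed simp
    obtain i where "bump_data i = (Complex (of_rat 0) (of_rat 0), of_rat s, of_rat (s + 1))"
      using bump_data_surj[OF st] by blast
    then have i: "c i = 0" "a i = of_rat s"
      by (simp_all add: c_def a_def b_def zero_complex.code)
    have "v i z = 0" if "z \<in> K" "z \<in> ball 0 (1 / b i)" for z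
    proof (cases "z = 0")
      case False
      have "b i \<le> norm (1 / z - c i)" using that(2) False ab[of i] by (simp add: i norm_divide field_simps)
      then show ?thesis using that Kp by (intro v_out False) auto
    qed (simp add: v_0)
    moreover have "v i z = 1" if z: "z \<in> K - U" for z
    proof -
      have "z \<noteq> 0" using z U(2) by auto
      have "e \<le> norm z" using z e(2) by (force simp: not_le)
      then have "norm (1 / z) \<le> 1 / e" using e(1) by (simp add: norm_divide frac_le)
      then show ?thesis using z Kp s \<open>z \<noteq> 0\<close> by (intro v_in) (auto simp: i)
    qed
    ultimately show "\<exists>i W. open W \<and> 0 \<in> W \<and> (\<forall>z\<in>K \<inter> W. v i z = 0) \<and> (\<forall>z\<in>K - U. v i z = 1)"
      using ab[of i] by (intro exI[of _ i] exI[of _ "ball 0 (1 / b i)"]) auto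
  qed
qed

section \<open>Adjoining roots\<close>

text \<open>A point of \<open>nat \<Rightarrow> real\<close> encodes the sequence \<open>n \<mapsto> cc n u\<close> of complex numbers: \<open>cc 0\<close> is the
  coordinate of the planar set and \<open>cc (Suc i)\<close> the adjoined root of \<open>v i\<close>.\<close>

definition cc :: "nat \<Rightarrow> (nat \<Rightarrow> real) \<Rightarrow> complex" where
  "cc n u = Complex (u (2 * n)) (u (2 * n + 1))"

definition cc_upd :: "nat \<Rightarrow> complex \<Rightarrow> (nat \<Rightarrow> real) \<Rightarrow> nat \<Rightarrow> real" where
  "cc_upd n w u = u(2 * n := Re w, 2 * n + 1 := Im w)"

lemma cc_upd_same [simp]: "cc n (cc_upd n w u) = w"
  by (simp add: cc_def cc_upd_def)

lemma cc_upd_other [simp]: "m \<noteq> n \<Longrightarrow> cc m (cc_upd n w u) = cc m u"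
proof -
  assume "m \<noteq> n"
  moreover have "2 * m \<noteq> 2 * n + 1" "2 * m + 1 \<noteq> 2 * n" by presburger+
  ultimately show ?thesis by (simp add: cc_def cc_upd_def)
qed

lemma continuous_cc [continuous_intros]: "continuous_on S (cc n)"
proof -
  have eq: "cc n = (\<lambda>u. of_real (u (2 * n)) + \<i> * of_real (u (2 * n + 1)))"
    by (rule ext) (simp add: cc_def complex_eq_iff)
  have "continuous_on S (\<lambda>u::nat \<Rightarrow> real. u i)" for i
    by (rule continuous_on_subset[OF continuous_on_product_coordinates]) simp
  then show ?thesis unfolding eq by (intro continuous_intros)
qed

lemma cc_surj: "\<exists>u. \<forall>n. cc n u = w n"
proof
  show "\<forall>n. cc n (\<lambda>k. if even k then Re (w (k div 2)) else Im (w (k div 2))) = w n"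
    by (simp add: cc_def)
qed

text \<open>A simultaneous root extension in the sense of Cole: the fibre over \<open>z\<close> is
  the product of the sets of \<open>N i\<close>-th roots of \<open>v i z\<close>.\<close>

definition root_cover :: "complex set \<Rightarrow> (nat \<Rightarrow> complex \<Rightarrow> complex) \<Rightarrow> (nat \<Rightarrow> nat) \<Rightarrow> (nat \<Rightarrow> real) set" where
  "root_cover K v N = {u. cc 0 u \<in> K \<and> (\<forall>i. cc (Suc i) u ^ N i = v i (cc 0 u))}"

text \<open>Level \<open>n\<close> uses only the first \<open>n\<close> roots. Positive powers of a
  root carry the data 0, in accordance with averaging, which turns such a power into 0 or a positive
  power of \<open>v n\<close>. Exponents are not reduced by the equation of the root, so one
  function on the cover has several representations; boundedness shows later that their data
  agree.\<close>

inductive root_rel :: "((complex \<Rightarrow> complex) \<times> complex fps) set \<Rightarrow> nat \<Rightarrow> ((nat \<Rightarrow> real) \<Rightarrow> complex) \<Rightarrow> complex fps \<Rightarrow> bool"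
  for G where
  base: "(p, t) \<in> G \<Longrightarrow> root_rel G 0 (\<lambda>u. p (cc 0 u)) t"
| monom: "root_rel G n h t \<Longrightarrow> root_rel G (Suc n) (\<lambda>u. h u * cc (Suc n) u ^ a) (if a = 0 then t else 0)"
| add: "root_rel G (Suc n) h t \<Longrightarrow> root_rel G (Suc n) h' t' \<Longrightarrow> root_rel G (Suc n) (\<lambda>u. h u + h' u) (t + t')"

lemma root_rel_indep: "root_rel G n h t \<Longrightarrow> n \<le> m \<Longrightarrow> h (cc_upd (Suc m) w u) = h u"
  by (induction rule: root_rel.induct) auto

lemma root_rel_Suc: "root_rel G n h t \<Longrightarrow> root_rel G (Suc n) h t"
  using root_rel.monom[of G n h t 0] by simp

lemma root_rel_le: "n \<le> m \<Longrightarrow> root_rel G n h t \<Longrightarrow> root_rel G m h t"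
  by (induction rule: dec_induct) (auto intro: root_rel_Suc)

lemma root_rel_0E:
  assumes "root_rel G 0 h t"
  obtains p where "(p, t) \<in> G" "h = (\<lambda>u. p (cc 0 u))"
  using assms by (cases rule: root_rel.cases) auto

lemma root_rel_add:
  assumes "fps_alg K G" "root_rel G n h t" "root_rel G n h' t'"
  shows "root_rel G n (\<lambda>u. h u + h' u) (t + t')"
proof (cases n)
  case 0
  obtain p q where "(p, t) \<in> G" "h = (\<lambda>u. p (cc 0 u))" "(q, t') \<in> G" "h' = (\<lambda>u. q (cc 0 u))"
    using assms(2,3) unfolding 0 by (elim root_rel_0E) blast
  then show ?thesis
    using root_rel.base[OF fps_algD(2)[OF assms(1)], of p t q t'] by (simp add: 0)
qed (use assms root_rel.add in auto)

text \<open>On the data the rules amount to setting the roots to 0, which is multiplicative because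
  \<open>a + b = 0\<close> means \<open>a = 0\<close> and \<open>b = 0\<close>. The core is the
  product of two monomials, one level down; sums on either side follow by induction.\<close>

lemma root_rel_mult:
  assumes alg: "fps_alg K G"
  shows "root_rel G n h t \<Longrightarrow> root_rel G n h' t' \<Longrightarrow> root_rel G n (\<lambda>u. h u * h' u) (t * t')"
proof (induction n arbitrary: h t h' t')
  case 0
  obtain p q where "(p, t) \<in> G" "h = (\<lambda>u. p (cc 0 u))" "(q, t') \<in> G" "h' = (\<lambda>u. q (cc 0 u))"
    using 0 by (elim root_rel_0E) blast
  then show ?case
    using root_rel.base[OF fps_algD(3)[OF alg], of p t q t'] by simp
next
  case (Suc n)
  have one: "root_rel G (Suc n) (\<lambda>u. h u * cc (Suc n) u ^ a * h' u) ((if a = 0 then t else 0) * t')"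
    if "root_rel G n h t" "root_rel G (Suc n) h' t'" for h t a h' t'
    using that(2)
  proof (induction "Suc n" h' t' rule: root_rel.induct)
    case (monom h' t' b)
    from root_rel.monom[OF Suc.IH[OF that(1) monom(1)], of "a + b"]
    have "root_rel G (Suc n) (\<lambda>u. h u * h' u * cc (Suc n) u ^ (a + b)) (if a + b = 0 then t * t' else 0)" .
    moreover have "(if a + b = 0 then t * t' else 0) = (if a = 0 then t else 0) * (if b = 0 then t' else 0)" by simp
    moreover have "(\<lambda>u. h u * h' u * cc (Suc n) u ^ (a + b)) = (\<lambda>u. h u * cc (Suc n) u ^ a * (h' u * cc (Suc n) u ^ b))"
      by (simp add: power_add mult_ac)
    ultimately show ?case by (simp only:)
  next
    case (add f s g s')
    from root_rel.add[OF add(2,4)] show ?case by (simp add: distrib_left)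
  qed
  show ?case
    using Suc.prems(1) Suc.prems(2)
  proof (induction "Suc n" h t rule: root_rel.induct)
    case (monom h t a)
    then show ?case by (intro one)
  next
    case (add f s g s')
    from root_rel.add[OF add(2)[OF add(5)] add(4)[OF add(5)]] show ?case by (simp add: distrib_right)
  qed
qed

lemma root_rel_const:
  assumes "fps_alg K G"
  shows "root_rel G n (\<lambda>_. c) (fps_const c)"
  using root_rel_le[OF le0 root_rel.base[OF fps_algD(1)[OF assms]]] .

lemma root_rel_power0:
  assumes alg: "fps_alg K G" and "(p, 0) \<in> G" "0 < a"
  shows "root_rel G n (\<lambda>u. p (cc 0 u) ^ a) 0"
  using assms(3)
proof (induction a rule: nat_induct_non_zero)
  case 1
  then show ?case using root_rel_le[OF le0 root_rel.base[OF assms(2)]] by simp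
next
  case (Suc a)
  have "root_rel G n (\<lambda>u. p (cc 0 u)) 0" using root_rel_le[OF le0 root_rel.base[OF assms(2)]] .
  from root_rel_mult[OF alg this Suc.IH] show ?case by simp
qed

lemma sum_roots_of_unity_power:
  fixes N a :: nat
  assumes "0 < N"
  shows "(\<Sum>j<N. (exp (2 * of_real pi * \<i> / of_nat N) ^ j) ^ a) = (if N dvd a then of_nat N else 0)"
proof -
  define w where "w = exp (2 * of_real pi * \<i> / of_nat N) ^ a"
  have w: "w = exp (2 * of_real pi * \<i> * of_nat a / of_nat N)"
    by (simp add: w_def exp_of_nat_mult[symmetric] mult_ac)
  have sum: "(\<Sum>j<N. (exp (2 * of_real pi * \<i> / of_nat N) ^ j) ^ a) = (\<Sum>j<N. w ^ j)"
    by (simp add: w_def power_mult[symmetric] mult.commute)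
  have "w ^ N = 1"
  proof -
    have "w ^ N = (exp (2 * of_real pi * \<i> / of_nat N) ^ N) ^ a"
      by (simp add: w_def power_mult[symmetric] mult.commute)
    also have "exp (2 * of_real pi * \<i> / of_nat N) ^ N = 1"
      using assms by (simp add: exp_of_nat_mult[symmetric])
    finally show ?thesis by simp
  qed
  moreover have "w = 1 \<longleftrightarrow> N dvd a"
    using complex_root_unity_eq_1[of N a] assms by (simp add: w)
  ultimately show ?thesis
    unfolding sum using geometric_sum[of w N] by auto
qed

lemma cc_upd_root_cover:
  assumes "u \<in> root_cover K v N" "w ^ N n = 1"
  shows "cc_upd (Suc n) (w * cc (Suc n) u) u \<in> root_cover K v N"
proof -
  have "cc (Suc i) (cc_upd (Suc n) (w * cc (Suc n) u) u) ^ N i = v i (cc 0 u)" for i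
    using assms by (cases "i = n") (auto simp: root_cover_def power_mult_distrib)
  then show ?thesis using assms(1) by (simp add: root_cover_def)
qed

text \<open>Averaging over the deck transformations of one root removes that root; only multiples of
  \<open>v n\<close>, whose Taylor data vanish, are produced on the way.\<close>

lemma root_rel_average:
  assumes alg: "fps_alg K G" and v: "(v n, 0) \<in> G" and N: "0 < N n"
    and h: "root_rel G (Suc n) h t"
  shows "\<exists>h'. root_rel G n h' t \<and> (\<forall>u\<in>root_cover K v N. h' u =
    (\<Sum>j<N n. h (cc_upd (Suc n) (exp (2 * of_real pi * \<i> / of_nat (N n)) ^ j * cc (Suc n) u) u)) / of_nat (N n))"
  using h
proof (induction "Suc n" h t rule: root_rel.induct)
  case (monom h t a)
  let ?\<omega> = "exp (2 * of_real pi * \<i> / of_nat (N n))"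
  have eq: "(\<Sum>j<N n. h (cc_upd (Suc n) (?\<omega> ^ j * cc (Suc n) u) u) * cc (Suc n) (cc_upd (Suc n) (?\<omega> ^ j * cc (Suc n) u) u) ^ a) / of_nat (N n)
     = (if N n dvd a then h u * v n (cc 0 u) ^ (a div N n) else 0)" if u: "u \<in> root_cover K v N" for u
  proof -
    have "(\<Sum>j<N n. h (cc_upd (Suc n) (?\<omega> ^ j * cc (Suc n) u) u) * cc (Suc n) (cc_upd (Suc n) (?\<omega> ^ j * cc (Suc n) u) u) ^ a)
        = h u * cc (Suc n) u ^ a * (\<Sum>j<N n. (?\<omega> ^ j) ^ a)"
      by (simp add: root_rel_indep[OF monom(1)] power_mult_distrib sum_distrib_left mult_ac)
    also have "\<dots> = h u * cc (Suc n) u ^ a * (if N n dvd a then of_nat (N n) else 0)"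
      by (simp only: sum_roots_of_unity_power[OF N])
    finally show ?thesis
      using N u by (auto simp: root_cover_def power_mult elim!: dvdE)
  qed
  consider "a = 0" | "N n dvd a" "0 < a" | "\<not> N n dvd a" by blast
  then show ?case
  proof cases
    case 1
    then show ?thesis using monom(1) eq by (intro exI[of _ h]) simp
  next
    case 2
    have "0 < a div N n" using 2 N by (simp add: div_greater_zero_iff dvd_imp_le)
    from root_rel_mult[OF alg monom(1) root_rel_power0[OF alg v this]]
    have "root_rel G n (\<lambda>u. h u * v n (cc 0 u) ^ (a div N n)) 0" by simp
    then show ?thesis using 2 eq by (intro exI[of _ "\<lambda>u. h u * v n (cc 0 u) ^ (a div N n)"]) simp
  next
    case 3
    then have "a \<noteq> 0" by (metis dvd_0_right)
    then show ?thesis using 3 eq root_rel_const[OF alg, of n 0] by (intro exI[of _ "\<lambda>_. 0"]) simp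
  qed
next
  case (add f s g s')
  obtain f' g' where f': "root_rel G n f' s" "\<forall>u\<in>root_cover K v N. f' u =
    (\<Sum>j<N n. f (cc_upd (Suc n) (exp (2 * of_real pi * \<i> / of_nat (N n)) ^ j * cc (Suc n) u) u)) / of_nat (N n)"
    and g': "root_rel G n g' s'" "\<forall>u\<in>root_cover K v N. g' u =
    (\<Sum>j<N n. g (cc_upd (Suc n) (exp (2 * of_real pi * \<i> / of_nat (N n)) ^ j * cc (Suc n) u) u)) / of_nat (N n)"
    using add by blast
  show ?case
    using root_rel_add[OF alg f'(1) g'(1)] f'(2) g'(2)
    by (intro exI[of _ "\<lambda>u. f' u + g' u"]) (auto simp: sum.distrib add_divide_distrib)
qed

text \<open>Every point of \<open>K\<close> is covered, so a bound on the cover yields a bound on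
  \<open>K\<close>.\<close>

lemma root_cover_fiber:
  assumes "\<And>i. 0 < N i" "z \<in> K"
  obtains u where "u \<in> root_cover K v N" "cc 0 u = z"
proof -
  have "\<exists>w. v i z = w ^ N i" for i using exists_complex_root[of "N i" "v i z"] assms(1)[of i] by auto
  then obtain w where w: "\<And>i. v i z = w i ^ N i" by metis
  obtain u where "\<And>n. cc n u = (case n of 0 \<Rightarrow> z | Suc i \<Rightarrow> w i)" using cc_surj by metis
  then show ?thesis using w assms(2) by (intro that[of u]) (simp_all add: root_cover_def)
qed

text \<open>Averaging over one root lowers the level, keeps the data and does not increase the
  bound. At level 0 the function comes from \<open>K\<close>, so the planar constant
  \<open>C\<close> holds at every level, and thus for infinitely many roots together.\<close>

lemma root_rel_bound:
  assumes alg: "fps_alg K G" and v: "\<And>i. (v i, 0) \<in> G" and N: "\<And>i. 0 < N i"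
    and C: "\<And>f s M. (f, s) \<in> G \<Longrightarrow> (\<And>x. x \<in> K \<Longrightarrow> norm (f x) \<le> M) \<Longrightarrow> 0 \<le> M \<Longrightarrow> norm (fps_nth s k) \<le> C * M"
  shows "root_rel G n h t \<Longrightarrow> (\<And>u. u \<in> root_cover K v N \<Longrightarrow> norm (h u) \<le> M) \<Longrightarrow> 0 \<le> M \<Longrightarrow> norm (fps_nth t k) \<le> C * M"
proof (induction n arbitrary: h)
  case 0
  obtain p where p: "(p, t) \<in> G" "h = (\<lambda>u. p (cc 0 u))" using 0(1) by (rule root_rel_0E)
  have "norm (p z) \<le> M" if z: "z \<in> K" for z
  proof -
    obtain u where "u \<in> root_cover K v N" "cc 0 u = z" by (rule root_cover_fiber[OF N z])
    then show ?thesis using 0(2)[of u] p(2) by simp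
  qed
  then show ?case using C[OF p(1)] 0(3) by blast
next
  case (Suc n)
  let ?\<omega> = "exp (2 * of_real pi * \<i> / of_nat (N n))"
  obtain h' where h': "root_rel G n h' t" "\<And>u. u \<in> root_cover K v N \<Longrightarrow> h' u =
    (\<Sum>j<N n. h (cc_upd (Suc n) (?\<omega> ^ j * cc (Suc n) u) u)) / of_nat (N n)"
    using root_rel_average[where N = N and v = v, OF alg v N Suc.prems(1)] by blast
  have "norm (h' u) \<le> M" if u: "u \<in> root_cover K v N" for u
  proof -
    have \<omega>N: "?\<omega> ^ N n = 1" using N[of n] by (simp add: exp_of_nat_mult[symmetric])
    have "(?\<omega> ^ j) ^ N n = 1" for j
      by (metis \<omega>N mult.commute power_mult power_one)
    then have "norm (\<Sum>j<N n. h (cc_upd (Suc n) (?\<omega> ^ j * cc (Suc n) u) u)) \<le> (\<Sum>j<N n. M)"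
      using u by (intro sum_norm_le Suc.prems(2) cc_upd_root_cover) auto
    then show ?thesis using N[of n] by (simp add: h'(2)[OF u] norm_divide field_simps)
  qed
  then show ?case using Suc.IH[OF h'(1)] Suc.prems(3) by blast
qed

definition root_alg :: "((complex \<Rightarrow> complex) \<times> complex fps) set \<Rightarrow> (((nat \<Rightarrow> real) \<Rightarrow> complex) \<times> complex fps) set" where
  "root_alg G = {(h, t). \<exists>n. root_rel G n h t}"

lemma root_algI_base: "(p, t) \<in> G \<Longrightarrow> (\<lambda>u. p (cc 0 u), t) \<in> root_alg G"
  unfolding root_alg_def using root_rel.base by blast

lemma root_algI_cc:
  assumes "fps_alg K G"
  shows "(cc (Suc i), 0) \<in> root_alg G"
  using root_rel.monom[OF root_rel_const[OF assms, of i 1], of 1] unfolding root_alg_def by auto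

lemma fps_bounded_root_alg:
  assumes "fps_alg K G" "fps_bounded K G" "\<And>i. (v i, 0) \<in> G" "\<And>i. 0 < N i"
  shows "fps_bounded (root_cover K v N) (root_alg G)"
  unfolding fps_bounded_def
proof
  fix k
  obtain C where C: "\<And>f s M. (f, s) \<in> G \<Longrightarrow> (\<And>x. x \<in> K \<Longrightarrow> norm (f x) \<le> M) \<Longrightarrow> 0 \<le> M \<Longrightarrow> norm (fps_nth s k) \<le> C * M"
    by (rule fps_boundedE[OF assms(2), where k = k]) blast
  show "\<exists>C. \<forall>f s M. (f, s) \<in> root_alg G \<longrightarrow> (\<forall>x\<in>root_cover K v N. norm (f x) \<le> M) \<longrightarrow> 0 \<le> M \<longrightarrow> norm (fps_nth s k) \<le> C * M"
  proof (intro exI allI impI)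
    fix f s and M :: real
    assume f: "(f, s) \<in> root_alg G" "\<forall>x\<in>root_cover K v N. norm (f x) \<le> M" "0 \<le> M"
    then obtain n where "root_rel G n f s" by (auto simp: root_alg_def)
    then show "norm (fps_nth s k) \<le> C * M"
      using f(2,3) by (intro root_rel_bound[where N = N and v = v, OF assms(1,3,4) C]) auto
  qed
qed

lemma root_rel_bounded_fun:
  assumes alg: "fps_alg K G" and v: "\<And>i. (v i, 0) \<in> G" and N: "\<And>i. 0 < N i"
  shows "root_rel G n h t \<Longrightarrow> \<exists>M. \<forall>u\<in>root_cover K v N. norm (h u) \<le> M"
proof (induction rule: root_rel.induct)
  case (base p t)
  then obtain M where "\<forall>z\<in>K. norm (p z) \<le> M" using fps_algD(4)[OF alg] by blast
  then show ?case by (auto simp: root_cover_def)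
next
  case (monom n h t a)
  obtain M where M: "\<forall>u\<in>root_cover K v N. norm (h u) \<le> M" using monom.IH by blast
  obtain M' where M': "\<forall>z\<in>K. norm (v n z) \<le> M'" using fps_algD(4)[OF alg v] by blast
  have cb: "norm (cc (Suc n) u) \<le> 1 + M'" if u: "u \<in> root_cover K v N" for u
  proof (cases "norm (cc (Suc n) u) \<le> 1")
    case True
    have "cc 0 u \<in> K" using u by (simp add: root_cover_def)
    then have "0 \<le> M'" using order_trans[OF norm_ge_zero bspec[OF M']] by blast
    then show ?thesis using True by simp
  next
    case False
    then have "norm (cc (Suc n) u) ^ 1 \<le> norm (cc (Suc n) u) ^ N n" using N[of n] by (intro power_increasing) auto
    also have "\<dots> = norm (v n (cc 0 u))" using u by (simp add: root_cover_def norm_power[symmetric])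
    also have "\<dots> \<le> M'" using M' u by (simp add: root_cover_def)
    finally show ?thesis by simp
  qed
  show ?case
  proof (intro exI ballI)
    fix u assume u: "u \<in> root_cover K v N"
    show "norm (h u * cc (Suc n) u ^ a) \<le> M * (1 + M') ^ a"
      unfolding norm_mult norm_power
      using bspec[OF M u] cb[OF u] order_trans[OF norm_ge_zero bspec[OF M u]]
      by (intro mult_mono power_mono) auto
  qed
next
  case (add n h t h' t')
  then obtain M M' where "\<forall>u\<in>root_cover K v N. norm (h u) \<le> M" "\<forall>u\<in>root_cover K v N. norm (h' u) \<le> M'" by blast
  then show ?case by (intro exI[of _ "M + M'"]) (auto intro!: norm_triangle_le add_mono)
qed

lemma fps_alg_root_alg:
  assumes alg: "fps_alg K G" and v: "\<And>i. (v i, 0) \<in> G" and N: "\<And>i. 0 < N i"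
  shows "fps_alg (root_cover K v N) (root_alg G)"
  unfolding fps_alg_def
proof (intro conjI allI impI)
  show "(\<lambda>_. c, fps_const c) \<in> root_alg G" for c
    using root_rel_const[OF alg] by (auto simp: root_alg_def)
next
  fix f s g t assume "(f, s) \<in> root_alg G" "(g, t) \<in> root_alg G"
  then obtain m n where "root_rel G m f s" "root_rel G n g t" by (auto simp: root_alg_def)
  then have "root_rel G (max m n) f s" "root_rel G (max m n) g t"
    by (auto intro: root_rel_le[rotated])
  then have "root_rel G (max m n) (\<lambda>x. f x + g x) (s + t)" "root_rel G (max m n) (\<lambda>x. f x * g x) (s * t)"
    by (rule root_rel_add[OF alg], rule root_rel_mult[OF alg])
  then show "(\<lambda>x. f x + g x, s + t) \<in> root_alg G" "(\<lambda>x. f x * g x, s * t) \<in> root_alg G"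
    by (auto simp: root_alg_def)
next
  fix f s assume "(f, s) \<in> root_alg G"
  then show "\<exists>M. \<forall>u\<in>root_cover K v N. norm (f u) \<le> M"
    using root_rel_bounded_fun[OF alg v N] by (auto simp: root_alg_def)
qed

lemma root_alg_continuous:
  assumes "\<And>f s. (f, s) \<in> G \<Longrightarrow> continuous_on K f" "(h, t) \<in> root_alg G"
  shows "continuous_on (root_cover K v N) h"
proof -
  obtain n where "root_rel G n h t" using assms(2) by (auto simp: root_alg_def)
  then show ?thesis
  proof (induction rule: root_rel.induct)
    case (base p t)
    show ?case
      by (rule continuous_on_compose2[OF assms(1)[OF base] continuous_cc]) (auto simp: root_cover_def)
  qed (auto intro!: continuous_intros)
qed

text \<open>The bound \<open>2 ^ N i\<close> on \<open>v i\<close> gives every root modulus at most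
  2, so the cover is a closed subset of a product of compact intervals. The same 2 later bounds the
  local units.\<close>

lemma compact_root_cover:
  assumes K: "compact K" and v: "\<And>i. continuous_on K (v i)" "\<And>i z. z \<in> K \<Longrightarrow> norm (v i z) \<le> 2 ^ N i" and N: "\<And>i. 0 < N i"
  shows "compact (root_cover K v N)" "u \<in> root_cover K v N \<Longrightarrow> norm (cc (Suc i) u) \<le> 2"
proof -
  have b: "norm (cc (Suc i) u) \<le> 2" if u: "u \<in> root_cover K v N" for u i
  proof -
    have "norm (cc (Suc i) u) ^ N i = norm (v i (cc 0 u))" using u by (simp add: root_cover_def norm_power[symmetric])
    also have "\<dots> \<le> 2 ^ N i" using v(2) u by (simp add: root_cover_def)
    finally show ?thesis using N[of i] power_mono_iff[of "norm (cc (Suc i) u)" 2 "N i"] by simp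
  qed
  then show "u \<in> root_cover K v N \<Longrightarrow> norm (cc (Suc i) u) \<le> 2" .
  obtain R where R: "\<And>z. z \<in> K \<Longrightarrow> norm z \<le> R" using compact_imp_bounded[OF K] by (auto simp: bounded_iff)
  define M where "M = max R 2"
  have cb: "norm (cc n u) \<le> M" if "u \<in> root_cover K v N" for n u
    using b[OF that] R that by (cases n) (auto simp: M_def root_cover_def intro: le_max_iff_disj[THEN iffD2])
  have sub: "root_cover K v N \<subseteq> Pi\<^sub>E UNIV (\<lambda>_. {-M..M})"
  proof
    fix u assume u: "u \<in> root_cover K v N"
    have "\<bar>u k\<bar> \<le> M" for k
    proof -
      have "\<bar>u k\<bar> \<le> norm (cc (k div 2) u)"
        using abs_Re_le_cmod[of "cc (k div 2) u"] abs_Im_le_cmod[of "cc (k div 2) u"]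
        by (cases "even k") (auto simp: cc_def)
      then show ?thesis using cb[OF u, of "k div 2"] by linarith
    qed
    then show "u \<in> Pi\<^sub>E UNIV (\<lambda>_. {-M..M})" by (auto simp: PiE_def abs_le_iff minus_le_iff)
  qed
  have "compactin (product_topology (\<lambda>_::nat. euclidean) UNIV) (Pi\<^sub>E UNIV (\<lambda>_. {-M..M}))"
    by (simp add: compactin_PiE)
  then have comp: "compact (Pi\<^sub>E (UNIV :: nat set) (\<lambda>_. {-M..M}))"
    by (simp add: euclidean_product_topology)
  have clK: "closed K" using K by (rule compact_imp_closed)
  let ?D = "cc 0 -` K"
  have clD: "closed ?D" using continuous_closed_vimage[OF clK, of "cc 0"] continuous_cc[of UNIV 0]
    by (simp add: continuous_on_eq_continuous_at)
  have "closed {u \<in> ?D. cc (Suc i) u ^ N i - v i (cc 0 u) = 0}" for i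
    by (intro continuous_closed_preimage_constant clD continuous_intros continuous_on_compose2[OF v(1) continuous_cc]) auto
  moreover have "root_cover K v N = ?D \<inter> (\<Inter>i. {u \<in> ?D. cc (Suc i) u ^ N i - v i (cc 0 u) = 0})"
    by (auto simp: root_cover_def)
  ultimately have "closed (root_cover K v N)" using clD by (metis (no_types, lifting) closed_INT closed_Int)
  then show "compact (root_cover K v N)"
    using compact_Int_closed[OF comp] sub by (metis inf.absorb2)
qed

section \<open>Local units\<close>

text \<open>Taylor data are left free here: on part of the cover no bound controls them, and on the
  whole cover completeness supplies them.\<close>

definition unif_approx :: "'a set \<Rightarrow> (('a \<Rightarrow> complex) \<times> complex fps) set \<Rightarrow> ('a \<Rightarrow> complex) \<Rightarrow> bool" where
  "unif_approx S G f \<longleftrightarrow> (\<forall>e>0. \<exists>g t. (g, t) \<in> G \<and> (\<forall>x\<in>S. norm (f x - g x) \<le> e))"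

lemma unif_approx_subset: "unif_approx S G f \<Longrightarrow> T \<subseteq> S \<Longrightarrow> unif_approx T G f"
  unfolding unif_approx_def by (meson subsetD)

lemma unif_approx_mem: "(f, s) \<in> G \<Longrightarrow> unif_approx S G f"
  unfolding unif_approx_def by (intro allI impI exI[of _ f] exI[of _ s]) simp

lemma unif_approx_mult:
  assumes G: "fps_alg R G" and f: "unif_approx S G f" and g: "unif_approx S G g"
    and b: "\<And>x. x \<in> S \<Longrightarrow> norm (f x) \<le> M" "\<And>x. x \<in> S \<Longrightarrow> norm (g x) \<le> M" and "0 \<le> M"
  shows "unif_approx S G (\<lambda>x. f x * g x)"
  unfolding unif_approx_def
proof (intro allI impI)
  fix e :: real assume "0 < e"
  define d where "d = min 1 (e / (2 * M + 1))"
  have d: "0 < d" "d \<le> 1" using \<open>0 < e\<close> \<open>0 \<le> M\<close> by (auto simp: d_def)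
  have "d \<le> e / (2 * M + 1)" by (simp add: d_def)
  then have de: "(2 * M + 1) * d \<le> e" using \<open>0 \<le> M\<close> by (simp add: pos_le_divide_eq mult.commute)
  obtain f' s where f': "(f', s) \<in> G" "\<forall>x\<in>S. norm (f x - f' x) \<le> d" using f d(1) unfolding unif_approx_def by blast
  obtain g' t where g': "(g', t) \<in> G" "\<forall>x\<in>S. norm (g x - g' x) \<le> d" using g d(1) unfolding unif_approx_def by blast
  show "\<exists>h t. (h, t) \<in> G \<and> (\<forall>x\<in>S. norm (f x * g x - h x) \<le> e)"
  proof (intro exI conjI ballI)
    show "(\<lambda>x. f' x * g' x, s * t) \<in> G" by (rule fps_algD(3)[OF G f'(1) g'(1)])
    fix x assume x: "x \<in> S"
    show "norm (f x * g x - f' x * g' x) \<le> e"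
      using norm_mult_diff_le[OF b[OF x] bspec[OF f'(2) x] bspec[OF g'(2) x] d(2)] de by linarith
  qed
qed

text \<open>Off \<open>S\<close> the factor \<open>g\<close> kills whatever \<open>f\<close> does,
  so a local approximation becomes a global one.\<close>

lemma unif_approx_localize:
  assumes G: "fps_alg R G" and g: "(g, t) \<in> G" "\<And>x. x \<in> R - S \<Longrightarrow> g x = 0" and f: "unif_approx S G f"
  shows "unif_approx R G (\<lambda>x. g x * f x)"
  unfolding unif_approx_def
proof (intro allI impI)
  fix e :: real assume "0 < e"
  obtain M where M: "\<forall>x\<in>R. norm (g x) \<le> M" using fps_algD(4)[OF G g(1)] by blast
  define d where "d = e / (\<bar>M\<bar> + 1)"
  have d: "0 < d" using \<open>0 < e\<close> by (simp add: d_def)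
  have de: "\<bar>M\<bar> * d \<le> e"
  proof -
    have "(\<bar>M\<bar> + 1) * d = e" by (simp add: d_def)
    then show ?thesis using d by (simp add: distrib_right)
  qed
  obtain f' s where f': "(f', s) \<in> G" "\<forall>x\<in>S. norm (f x - f' x) \<le> d" using f d unfolding unif_approx_def by blast
  show "\<exists>h t. (h, t) \<in> G \<and> (\<forall>x\<in>R. norm (g x * f x - h x) \<le> e)"
  proof (intro exI conjI ballI)
    show "(\<lambda>x. g x * f' x, t * s) \<in> G" by (rule fps_algD(3)[OF G g(1) f'(1)])
    fix x assume x: "x \<in> R"
    show "norm (g x * f x - g x * f' x) \<le> e"
    proof (cases "x \<in> S")
      case True
      have "norm (g x * f x - g x * f' x) = norm (g x) * norm (f x - f' x)"
        by (simp add: norm_mult[symmetric] right_diff_distrib)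
      also have "\<dots> \<le> \<bar>M\<bar> * d" using bspec[OF M x] bspec[OF f'(2) True] by (intro mult_mono) auto
      finally show ?thesis using de by simp
    qed (use g(2) x \<open>0 < e\<close> in auto)
  qed
qed

section \<open>Branches of roots as limits of polynomials\<close>

lemma fps_alg_poly:
  assumes G: "fps_alg R G" and f: "(f, s) \<in> G"
  shows "\<exists>t. (\<lambda>x. poly q (f x), t) \<in> G"
proof (induction q)
  case 0
  show ?case using fps_algD(1)[OF G, of 0] by auto
next
  case (pCons a q)
  then obtain t where t: "(\<lambda>x. poly q (f x), t) \<in> G" by blast
  show ?case
    using fps_algD(2)[OF G fps_algD(1)[OF G, of a] fps_algD(3)[OF G f t]] by auto
qed

lemma holomorphic_poly_approx:
  assumes f: "f holomorphic_on ball 1 1" and "0 < e"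
  shows "\<exists>q. \<forall>z\<in>cball 1 (1/2). norm (f z - poly q z) \<le> e"
proof -
  define a where "a n = (deriv ^^ n) f 1 / fact n" for n
  have sums: "(\<lambda>n. a n * (z - 1) ^ n) sums f z" if "z \<in> ball 1 1" for z
    unfolding a_def by (rule holomorphic_power_series[OF f that])
  \<comment> \<open>Convergence at a point of distance \<open>3/4\<close> from the centre puts the
    radius of convergence above \<open>1/2\<close>.\<close>
  have "(7/4 :: complex) \<in> ball 1 1" by (simp add: dist_norm)
  from sums[OF this] have "summable (\<lambda>n. a n * (3/4) ^ n)" by (simp add: sums_iff)
  then have "norm (3/4 :: complex) \<le> conv_radius a" by (rule conv_radius_geI)
  moreover have "ereal (1/2) < ereal (norm (3/4 :: complex))" by (simp add: norm_divide)
  ultimately have "ereal (1/2) < conv_radius a" by (rule less_le_trans[rotated])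
  then have "uniform_limit (cball 1 (1/2)) (\<lambda>n x. \<Sum>i<n. a i * (x - 1) ^ i) (\<lambda>x. \<Sum>i. a i * (x - 1) ^ i) sequentially"
    by (rule powser_uniform_limit)
  from uniform_limitD[OF this \<open>0 < e\<close>] obtain n where
    n: "\<forall>x\<in>cball 1 (1/2). dist (\<Sum>i<n. a i * (x - 1) ^ i) (\<Sum>i. a i * (x - 1) ^ i) < e"
    using eventually_happens'[OF sequentially_bot] by fast
  show ?thesis
  proof (intro exI[of _ "\<Sum>i<n. smult (a i) ([:-1, 1:] ^ i)"] ballI)
    fix z :: complex assume z: "z \<in> cball 1 (1/2)"
    then have "z \<in> ball 1 1" by simp
    then have "f z = (\<Sum>i. a i * (z - 1) ^ i)" using sums sums_unique by blast
    moreover have "poly (\<Sum>i<n. smult (a i) ([:-1, 1:] ^ i)) z = (\<Sum>i<n. a i * (z - 1) ^ i)"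
      by (simp add: poly_sum)
    ultimately show "norm (f z - poly (\<Sum>i<n. smult (a i) ([:-1, 1:] ^ i)) z) \<le> e"
      using bspec[OF n z] by (simp add: dist_norm norm_minus_commute)
  qed
qed

text \<open>The indicator of the branch near \<open>1\<close> of the \<open>N\<close>-th root is a uniform limit of polynomials on
  the set where \<open>t ^ N\<close> is close to \<open>1\<close>: with \<open>r\<close> the principal root of \<open>t ^ N\<close>, it is the mean of the
  powers of \<open>t / r\<close>.\<close>

lemma root_branch_polys:
  assumes N: "0 < N" and "0 < \<delta>"
  shows "\<exists>(\<psi> :: complex \<Rightarrow> complex) \<eta> \<rho>. 0 < \<eta> \<and> 0 < \<rho> \<and>
    (\<forall>t. norm (t ^ N - 1) \<le> \<eta> \<longrightarrow> (\<psi> t = 0 \<or> \<psi> t = 1) \<and>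
      (\<delta> \<le> norm (t - 1) \<longrightarrow> \<psi> t = 0) \<and> (norm (t - 1) < \<rho> \<longrightarrow> \<psi> t = 1)) \<and>
    (\<forall>e>0. \<exists>q. \<forall>t. norm (t ^ N - 1) \<le> \<eta> \<longrightarrow> norm (\<psi> t - poly q t) \<le> e)"
proof -
  define R where "R \<tau> = exp (Ln \<tau> / of_nat N)" for \<tau> :: complex
  define \<psi> where "\<psi> t = (\<Sum>j<N. (t / R (t ^ N)) ^ j) / of_nat N" for t
  have R0: "R \<tau> \<noteq> 0" for \<tau> by (simp add: R_def)
  have RN: "R \<tau> ^ N = \<tau>" if "\<tau> \<noteq> 0" for \<tau>
    using that N by (simp add: R_def exp_of_nat_mult[symmetric])
  have R1: "R 1 = 1" by (simp add: R_def)
  have "isCont R 1" unfolding R_def using N by (intro continuous_intros) auto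
  then obtain d where d: "0 < d" "\<And>\<tau>. dist \<tau> 1 < d \<Longrightarrow> dist (R \<tau>) 1 < \<delta>"
    using \<open>0 < \<delta>\<close> unfolding continuous_at_eps_delta R1 by metis
  \<comment> \<open>\<open>\<eta> \<le> 1/2\<close> keeps \<open>t ^ N\<close> in the disc where
    powers of \<open>1 / R\<close> are approximated by polynomials. \<open>\<eta> < d\<close> keeps
    the principal root within \<open>\<delta>\<close> of 1, so that a \<open>t\<close> at distance
    \<open>\<delta>\<close> or more lies on another branch.\<close>
  define \<eta> where "\<eta> = min (1/2) (d / 2)"
  have \<eta>: "0 < \<eta>" "\<eta> \<le> 1/2" "\<eta> < d" using d(1) by (auto simp: \<eta>_def)
  have nz: "t ^ N \<noteq> 0" if "norm (t ^ N - 1) \<le> \<eta>" for t :: complex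
  proof
    assume "t ^ N = 0"
    then have "norm (t ^ N - 1) = 1" by (simp only: diff_0 norm_minus_cancel norm_one)
    then show False using that \<eta>(2) by linarith
  qed
  have val: "\<psi> t = (if t = R (t ^ N) then 1 else 0)" if "norm (t ^ N - 1) \<le> \<eta>" for t
  proof (cases "t = R (t ^ N)")
    case True
    then have "t / R (t ^ N) = 1" using R0[of "t ^ N"] by (metis divide_self)
    then show ?thesis using True N by (simp add: \<psi>_def)
  next
    case False
    then have "t / R (t ^ N) \<noteq> 1" using R0[of "t ^ N"] by simp
    moreover have "(t / R (t ^ N)) ^ N = 1" using RN[OF nz[OF that]] nz[OF that] by (simp add: power_divide)
    ultimately have "(\<Sum>j<N. (t / R (t ^ N)) ^ j) = 0" using geometric_sum[of "t / R (t ^ N)" N] by simp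
    then show ?thesis using False by (simp add: \<psi>_def)
  qed
  have "isCont \<psi> 1"
    unfolding \<psi>_def R_def using N by (intro continuous_intros) auto
  moreover have "\<psi> 1 = 1" using N by (simp add: \<psi>_def R1)
  ultimately obtain \<rho> where \<rho>: "0 < \<rho>" "\<And>t. dist t 1 < \<rho> \<Longrightarrow> dist (\<psi> t) 1 < 1"
    unfolding continuous_at_eps_delta by (metis zero_less_one)
  show ?thesis
  proof (rule exI[of _ \<psi>], rule exI[of _ \<eta>], rule exI[of _ \<rho>], intro conjI allI impI)
    show "0 < \<eta>" "0 < \<rho>" by (rule \<eta>(1), rule \<rho>(1))
  next
    fix t :: complex assume t: "norm (t ^ N - 1) \<le> \<eta>"
    show "\<psi> t = 0 \<or> \<psi> t = 1" using val[OF t] by simp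
    show "\<psi> t = 0" if "\<delta> \<le> norm (t - 1)"
    proof -
      have "dist (R (t ^ N)) 1 < \<delta>" using t \<eta>(3) by (intro d(2)) (simp add: dist_norm)
      then have "t \<noteq> R (t ^ N)" using that by (auto simp: dist_norm)
      then show ?thesis using val[OF t] by simp
    qed
    show "\<psi> t = 1" if "norm (t - 1) < \<rho>"
      using \<rho>(2)[of t] that val[OF t] by (auto simp: dist_norm split: if_splits)
  next
    fix e :: real assume "0 < e"
    \<comment> \<open>The tolerance is divided by \<open>2 ^ N\<close> because the error will be
      multiplied by \<open>t ^ j\<close> with \<open>j < N\<close>, where
      \<open>norm t \<le> 2\<close>.\<close>
    have "\<exists>q. \<forall>\<tau>\<in>cball 1 (1/2). norm ((1 / R \<tau>) ^ j - poly q \<tau>) \<le> e / 2 ^ N" for j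
    proof (rule holomorphic_poly_approx)
      have "z \<notin> \<real>\<^sub>\<le>\<^sub>0" if "z \<in> ball 1 1" for z :: complex
      proof
        assume "z \<in> \<real>\<^sub>\<le>\<^sub>0"
        then have "Re z \<le> 0" by (auto simp: complex_nonpos_Reals_iff)
        then have "1 \<le> Re (1 - z)" by simp
        then have "1 \<le> norm (1 - z)" using complex_Re_le_cmod order_trans by blast
        then show False using that by (simp add: dist_norm)
      qed
      then show "(\<lambda>\<tau>. (1 / R \<tau>) ^ j) holomorphic_on ball 1 1"
        unfolding R_def using N by (intro holomorphic_intros) auto
    qed (use \<open>0 < e\<close> in simp)
    then obtain q where q: "\<And>j \<tau>. \<tau> \<in> cball 1 (1/2) \<Longrightarrow> norm ((1 / R \<tau>) ^ j - poly (q j) \<tau>) \<le> e / 2 ^ N"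
      by metis
    define Q where "Q = smult (1 / of_nat N) (\<Sum>j<N. monom 1 j * pcompose (q j) (monom 1 N))"
    have "norm (\<psi> t - poly Q t) \<le> e" if t: "norm (t ^ N - 1) \<le> \<eta>" for t
    proof -
      have t2: "norm t \<le> 2"
      proof (cases "norm t \<le> 1")
        case False
        then have "norm t ^ 1 \<le> norm t ^ N" using N by (intro power_increasing) auto
        also have "\<dots> \<le> 1 + norm (t ^ N - 1)"
          using norm_triangle_sub[of "t ^ N" 1] by (simp add: norm_power)
        finally show ?thesis using t \<eta>(2) by simp
      qed simp
      have tc: "t ^ N \<in> cball 1 (1/2)" using t \<eta>(2) by (simp add: dist_norm norm_minus_commute)
      have "\<psi> t - poly Q t = (\<Sum>j<N. t ^ j * ((1 / R (t ^ N)) ^ j - poly (q j) (t ^ N))) / of_nat N"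
        by (simp add: \<psi>_def Q_def poly_sum poly_monom poly_pcompose right_diff_distrib sum_subtractf
            power_divide diff_divide_distrib)
      then have "norm (\<psi> t - poly Q t) = norm (\<Sum>j<N. t ^ j * ((1 / R (t ^ N)) ^ j - poly (q j) (t ^ N))) / N"
        by (simp add: norm_divide)
      also have "\<dots> \<le> (\<Sum>j<N. e) / N"
      proof (intro divide_right_mono sum_norm_le)
        fix j assume j: "j \<in> {..<N}"
        have "norm t ^ j \<le> 2 ^ j" using t2 by (intro power_mono) auto
        also have "\<dots> \<le> 2 ^ N" using j by (intro power_increasing) auto
        finally have "norm t ^ j * norm ((1 / R (t ^ N)) ^ j - poly (q j) (t ^ N)) \<le> 2 ^ N * (e / 2 ^ N)"
          using q[OF tc, of j] by (intro mult_mono) auto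
        then show "norm (t ^ j * ((1 / R (t ^ N)) ^ j - poly (q j) (t ^ N))) \<le> e"
          by (simp add: norm_mult norm_power)
      qed simp
      also have "\<dots> = e" using N by simp
      finally show ?thesis .
    qed
    then show "\<exists>q. \<forall>t. norm (t ^ N - 1) \<le> \<eta> \<longrightarrow> norm (\<psi> t - poly q t) \<le> e" by blast
  qed
qed

section \<open>Idempotents over small planar sets, and local units\<close>

locale root_system =
  fixes K :: "complex set" and G :: "((complex \<Rightarrow> complex) \<times> complex fps) set"
    and v :: "nat \<Rightarrow> complex \<Rightarrow> complex" and N :: "nat \<Rightarrow> nat"
  assumes compact_K: "compact K" and zero_K: "0 \<in> K"
    and alg: "fps_alg K G" and bd: "fps_bounded K G"
    and id_G: "(\<lambda>z. z, fps_X) \<in> G"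
    and cont: "\<And>f s. (f, s) \<in> G \<Longrightarrow> continuous_on K f"
    and eval_0: "\<And>f s. (f, s) \<in> G \<Longrightarrow> fps_nth s 0 = f 0"
    and v_G: "\<And>i. (v i, 0) \<in> G"
    and N_pos: "\<And>i. 0 < N i"
    and v_bound: "\<And>i z. z \<in> K \<Longrightarrow> norm (v i z) \<le> 2 ^ N i"
    and bump: "\<And>y U. y \<in> K - {0} \<Longrightarrow> open U \<Longrightarrow> y \<in> U \<Longrightarrow>
      \<exists>i W. open W \<and> y \<in> W \<and> (\<forall>z\<in>K \<inter> W. v i z = 1) \<and> (\<forall>z\<in>K - U. v i z = 0)"
    and bump_0: "\<And>U. open U \<Longrightarrow> 0 \<in> U \<Longrightarrow>
      \<exists>i W. open W \<and> 0 \<in> W \<and> (\<forall>z\<in>K \<inter> W. v i z = 0) \<and> (\<forall>z\<in>K - U. v i z = 1)"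
begin

abbreviation "X \<equiv> root_cover K v N"
abbreviation "A \<equiv> root_alg G"

lemmas alg_A = fps_alg_root_alg[where v = v and N = N, OF alg v_G N_pos]
lemmas bd_A = fps_bounded_root_alg[where v = v and N = N, OF alg bd v_G N_pos]

lemma compact_X: "compact X"
  by (rule compact_root_cover(1)[OF compact_K cont[OF v_G] _ N_pos]) (rule v_bound)

lemma norm_cc_le: "u \<in> X \<Longrightarrow> norm (cc (Suc i) u) \<le> 2"
  by (rule compact_root_cover(2)[OF compact_K cont[OF v_G] _ N_pos]) (rule v_bound)

lemma cc_0_K: "u \<in> X \<Longrightarrow> cc 0 u \<in> K" and cc_Suc_power: "u \<in> X \<Longrightarrow> cc (Suc i) u ^ N i = v i (cc 0 u)"
  by (simp_all add: root_cover_def)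

lemma unif_approx_A_closure: "unif_approx X A f \<Longrightarrow> \<exists>s. (f, s) \<in> fps_closure X A"
  using fps_closure_complete[OF alg_A bd_A, of f] unfolding unif_approx_def by blast

text \<open>\<open>\<psi>\<close> is an idempotent over \<open>W\<close>, which keeps finite
  products within norm 1. Approximation is asked only over \<open>W\<close>, since the branches of a
  root come apart only where \<open>v i\<close> varies little.\<close>

definition sep :: "(nat \<Rightarrow> real) \<Rightarrow> (nat \<Rightarrow> real) set \<Rightarrow> bool" where
  "sep y V \<longleftrightarrow> (\<exists>W \<psi> V'. open W \<and> cc 0 y \<in> W \<and> open V' \<and> y \<in> V' \<and>
     (\<forall>u\<in>X. cc 0 u \<in> W \<longrightarrow> (\<psi> u = 0 \<or> \<psi> u = 1) \<and> (u \<in> V' \<longrightarrow> \<psi> u = 1) \<and> (u \<notin> V \<longrightarrow> \<psi> u = 0)) \<and>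
     unif_approx {u \<in> X. cc 0 u \<in> W} A \<psi>)"

lemma sep_mono: "sep y V \<Longrightarrow> V \<subseteq> V'' \<Longrightarrow> sep y V''"
proof -
  assume "sep y V" and sub: "V \<subseteq> V''"
  then obtain W \<psi> V' where *: "open W" "cc 0 y \<in> W" "open V'" "y \<in> V'"
     "\<forall>u\<in>X. cc 0 u \<in> W \<longrightarrow> (\<psi> u = 0 \<or> \<psi> u = 1) \<and> (u \<in> V' \<longrightarrow> \<psi> u = 1) \<and> (u \<notin> V \<longrightarrow> \<psi> u = 0)"
     "unif_approx {u \<in> X. cc 0 u \<in> W} A \<psi>"
    unfolding sep_def by blast
  then show "sep y V''"
    unfolding sep_def using sub
    by (intro exI[of _ W] exI[of _ \<psi>] exI[of _ V'] conjI) blast+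
qed

lemma unif_approx_1: "unif_approx S A (\<lambda>_. 1)"
  by (rule unif_approx_mem[OF fps_algD(1)[OF alg_A]])

lemma sepI_1:
  assumes "open W" "cc 0 y \<in> W" "\<And>u. u \<in> X \<Longrightarrow> cc 0 u \<in> W \<Longrightarrow> u \<in> V"
  shows "sep y V"
  unfolding sep_def
  by (rule exI[of _ W], rule exI[of _ "\<lambda>_. 1"], rule exI[of _ UNIV]) (use assms unif_approx_1 in auto)

lemma sep_Int:
  assumes "sep y V1" "sep y V2"
  shows "sep y (V1 \<inter> V2)"
proof -
  obtain W1 \<psi>1 V1' where 1: "open W1" "cc 0 y \<in> W1" "open V1'" "y \<in> V1'"
     "\<forall>u\<in>X. cc 0 u \<in> W1 \<longrightarrow> (\<psi>1 u = 0 \<or> \<psi>1 u = 1) \<and> (u \<in> V1' \<longrightarrow> \<psi>1 u = 1) \<and> (u \<notin> V1 \<longrightarrow> \<psi>1 u = 0)"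
     "unif_approx {u \<in> X. cc 0 u \<in> W1} A \<psi>1"
    using assms(1) unfolding sep_def by blast
  obtain W2 \<psi>2 V2' where 2: "open W2" "cc 0 y \<in> W2" "open V2'" "y \<in> V2'"
     "\<forall>u\<in>X. cc 0 u \<in> W2 \<longrightarrow> (\<psi>2 u = 0 \<or> \<psi>2 u = 1) \<and> (u \<in> V2' \<longrightarrow> \<psi>2 u = 1) \<and> (u \<notin> V2 \<longrightarrow> \<psi>2 u = 0)"
     "unif_approx {u \<in> X. cc 0 u \<in> W2} A \<psi>2"
    using assms(2) unfolding sep_def by blast
  let ?S = "{u \<in> X. cc 0 u \<in> W1 \<inter> W2}"
  have "unif_approx ?S A (\<lambda>u. \<psi>1 u * \<psi>2 u)"
  proof (rule unif_approx_mult[OF alg_A, where M = 1])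
    show "unif_approx ?S A \<psi>1" "unif_approx ?S A \<psi>2"
      by (rule unif_approx_subset[OF 1(6)], blast, rule unif_approx_subset[OF 2(6)], blast)
    show "norm (\<psi>1 u) \<le> 1" if "u \<in> ?S" for u using 1(5) that by force
    show "norm (\<psi>2 u) \<le> 1" if "u \<in> ?S" for u using 2(5) that by force
  qed simp
  moreover have "\<forall>u\<in>X. cc 0 u \<in> W1 \<inter> W2 \<longrightarrow> (\<psi>1 u * \<psi>2 u = 0 \<or> \<psi>1 u * \<psi>2 u = 1) \<and>
      (u \<in> V1' \<inter> V2' \<longrightarrow> \<psi>1 u * \<psi>2 u = 1) \<and> (u \<notin> V1 \<inter> V2 \<longrightarrow> \<psi>1 u * \<psi>2 u = 0)"
  proof (intro ballI impI)
    fix u assume "u \<in> X" "cc 0 u \<in> W1 \<inter> W2"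
    then have "(\<psi>1 u = 0 \<or> \<psi>1 u = 1) \<and> (u \<in> V1' \<longrightarrow> \<psi>1 u = 1) \<and> (u \<notin> V1 \<longrightarrow> \<psi>1 u = 0)"
      "(\<psi>2 u = 0 \<or> \<psi>2 u = 1) \<and> (u \<in> V2' \<longrightarrow> \<psi>2 u = 1) \<and> (u \<notin> V2 \<longrightarrow> \<psi>2 u = 0)"
      using 1(5) 2(5) by blast+
    then show "(\<psi>1 u * \<psi>2 u = 0 \<or> \<psi>1 u * \<psi>2 u = 1) \<and>
      (u \<in> V1' \<inter> V2' \<longrightarrow> \<psi>1 u * \<psi>2 u = 1) \<and> (u \<notin> V1 \<inter> V2 \<longrightarrow> \<psi>1 u * \<psi>2 u = 0)" by auto
  qed
  ultimately show ?thesis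
    unfolding sep_def using 1(1-4) 2(1-4)
    by (intro exI[of _ "W1 \<inter> W2"] exI[of _ "\<lambda>u. \<psi>1 u * \<psi>2 u"] exI[of _ "V1' \<inter> V2'"] conjI) auto
qed

text \<open>For the planar coordinate, and for a root that vanishes at \<open>y\<close> and is
  therefore small over a whole planar neighbourhood, the constant 1 serves. Otherwise division by
  the value \<open>s\<close> brings the \<open>N i\<close>-th power of the root close to 1, and
  \<open>root_branch_polys\<close> applies with \<open>\<delta> / norm s\<close>.\<close>

lemma sep_cc:
  assumes y: "y \<in> X" and "0 < \<delta>"
  shows "sep y {u. dist (cc n u) (cc n y) < \<delta>}"
proof (cases n)
  case 0
  show ?thesis
    by (rule sepI_1[of "ball (cc 0 y) \<delta>"]) (use \<open>0 < \<delta>\<close> in \<open>auto simp: 0 dist_commute\<close>)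
next
  case (Suc i)
  define s where "s = cc (Suc i) y"
  define c where "c = v i (cc 0 y)"
  have sc: "s ^ N i = c" using cc_Suc_power[OF y] by (simp add: s_def c_def)
  have contv: "\<exists>d>0. \<forall>z\<in>K. dist z (cc 0 y) < d \<longrightarrow> norm (v i z - c) < e" if "0 < e" for e
    using cont[OF v_G[of i]] cc_0_K[OF y] that unfolding continuous_on_iff c_def dist_norm by blast
  show ?thesis
  proof (cases "s = 0")
    case True
    then have c0: "c = 0" using sc N_pos[of i] by auto
    obtain d where d: "0 < d" "\<forall>z\<in>K. dist z (cc 0 y) < d \<longrightarrow> norm (v i z - c) < \<delta> ^ N i"
      using contv[of "\<delta> ^ N i"] \<open>0 < \<delta>\<close> by auto
    show ?thesis
    proof (rule sepI_1[of "ball (cc 0 y) d"])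
      fix u assume u: "u \<in> X" "cc 0 u \<in> ball (cc 0 y) d"
      then have "norm (cc (Suc i) u ^ N i) < \<delta> ^ N i"
        using d(2) cc_0_K[OF u(1)] c0 by (simp add: cc_Suc_power[OF u(1)] dist_commute)
      then have "norm (cc (Suc i) u) < \<delta>"
        unfolding norm_power by (rule power_less_imp_less_base) (use \<open>0 < \<delta>\<close> in simp)
      then show "u \<in> {u. dist (cc n u) (cc n y) < \<delta>}" using True by (simp add: Suc s_def dist_norm)
    qed (use d(1) in auto)
  next
    case False
    then have c0: "c \<noteq> 0" using sc by auto
    have "0 < \<delta> / norm s" using \<open>0 < \<delta>\<close> False by simp
    from root_branch_polys[OF N_pos[of i] this] obtain \<psi> :: "complex \<Rightarrow> complex" and \<eta> \<rho> :: real
      where r: "0 < \<eta>" "0 < \<rho>"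
        and r': "\<forall>t. norm (t ^ N i - 1) \<le> \<eta> \<longrightarrow> (\<psi> t = 0 \<or> \<psi> t = 1) \<and>
          (\<delta> / norm s \<le> norm (t - 1) \<longrightarrow> \<psi> t = 0) \<and> (norm (t - 1) < \<rho> \<longrightarrow> \<psi> t = 1)"
        and polys: "\<forall>e>0. \<exists>q. \<forall>t. norm (t ^ N i - 1) \<le> \<eta> \<longrightarrow> norm (\<psi> t - poly q t) \<le> e"
      by (elim exE conjE)
    obtain d where d: "0 < d" "\<forall>z\<in>K. dist z (cc 0 y) < d \<longrightarrow> norm (v i z - c) < \<eta> * norm c"
      using contv[of "\<eta> * norm c"] r(1) c0 by auto
    let ?W = "ball (cc 0 y) d"
    have T: "norm ((cc (Suc i) u / s) ^ N i - 1) \<le> \<eta>" if u: "u \<in> X" "cc 0 u \<in> ?W" for u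
    proof -
      have "(cc (Suc i) u / s) ^ N i - 1 = (v i (cc 0 u) - c) / c"
        using c0 by (simp add: power_divide cc_Suc_power[OF u(1)] sc diff_divide_distrib)
      also have "norm \<dots> \<le> \<eta>"
        using d(2) cc_0_K[OF u(1)] u(2) c0 by (simp add: norm_divide divide_le_eq dist_commute less_imp_le)
      finally show ?thesis .
    qed
    define V' where "V' = {u. norm (cc (Suc i) u / s - 1) < \<rho>}"
    have "open V'"
      unfolding V'_def using False by (intro open_Collect_less continuous_intros) simp
    have "unif_approx {u \<in> X. cc 0 u \<in> ?W} A (\<lambda>u. \<psi> (cc (Suc i) u / s))"
      unfolding unif_approx_def
    proof (intro allI impI)
      fix e :: real assume "0 < e"
      then obtain q where q: "\<forall>t. norm (t ^ N i - 1) \<le> \<eta> \<longrightarrow> norm (\<psi> t - poly q t) \<le> e" using polys by blast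
      have "(\<lambda>u. (1 / s) * cc (Suc i) u, fps_const (1 / s) * 0) \<in> A"
        by (rule fps_alg_scale[OF alg_A root_algI_cc[OF alg]])
      then obtain t where "(\<lambda>u. poly q ((1 / s) * cc (Suc i) u), t) \<in> A"
        using fps_alg_poly[OF alg_A] by blast
      then show "\<exists>g t. (g, t) \<in> A \<and> (\<forall>u\<in>{u \<in> X. cc 0 u \<in> ?W}. norm (\<psi> (cc (Suc i) u / s) - g u) \<le> e)"
        using q T by (intro exI[of _ "\<lambda>u. poly q ((1 / s) * cc (Suc i) u)"] exI[of _ t]) auto
    qed
    moreover have "\<forall>u\<in>X. cc 0 u \<in> ?W \<longrightarrow> (\<psi> (cc (Suc i) u / s) = 0 \<or> \<psi> (cc (Suc i) u / s) = 1) \<and>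
       (u \<in> V' \<longrightarrow> \<psi> (cc (Suc i) u / s) = 1) \<and> (u \<notin> {u. dist (cc n u) (cc n y) < \<delta>} \<longrightarrow> \<psi> (cc (Suc i) u / s) = 0)"
    proof (intro ballI impI conjI)
      fix u assume u: "u \<in> X" "cc 0 u \<in> ?W"
      show "\<psi> (cc (Suc i) u / s) = 0 \<or> \<psi> (cc (Suc i) u / s) = 1" using r' T[OF u] by blast
      show "\<psi> (cc (Suc i) u / s) = 1" if "u \<in> V'" using that r' T[OF u] by (simp add: V'_def)
      show "\<psi> (cc (Suc i) u / s) = 0" if "u \<notin> {u. dist (cc n u) (cc n y) < \<delta>}"
      proof -
        have "cc (Suc i) u / s - 1 = (cc (Suc i) u - s) / s" using False by (simp add: diff_divide_distrib)
        then have "norm (cc (Suc i) u / s - 1) = norm (cc (Suc i) u - s) / norm s" by (simp add: norm_divide)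
        moreover have "\<delta> \<le> norm (cc (Suc i) u - s)" using that by (simp add: Suc s_def dist_norm)
        ultimately have "\<delta> / norm s \<le> norm (cc (Suc i) u / s - 1)" by (simp add: divide_right_mono)
        then show ?thesis using r' T[OF u] by blast
      qed
    qed
    moreover have "y \<in> V'" using False r(2) by (simp add: V'_def s_def)
    ultimately show ?thesis
      unfolding sep_def using \<open>open V'\<close> d(1)
      by (intro exI[of _ ?W] exI[of _ "\<lambda>u. \<psi> (cc (Suc i) u / s)"] exI[of _ V'] conjI) auto
  qed
qed

text \<open>A basic open set restricts finitely many real coordinates, each of them the real or
  imaginary part of some \<open>cc n\<close>.\<close>

lemma sep_open:
  assumes y: "y \<in> X" and V: "open V" "y \<in> V"
  shows "sep y V"
proof -
  have "openin (product_topology (\<lambda>i. euclidean) UNIV) V" using V(1) by (simp add: open_fun_def)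
  from product_topology_open_contains_basis[OF this V(2)] obtain Z where
    Z: "y \<in> Pi\<^sub>E UNIV Z" "\<And>i. open (Z i)" "finite {i. Z i \<noteq> UNIV}" "Pi\<^sub>E UNIV Z \<subseteq> V"
    by auto
  have single: "sep y {u. u i \<in> Z i}" for i
  proof -
    have "y i \<in> Z i" using Z(1) by auto
    then obtain e where e: "0 < e" "ball (y i) e \<subseteq> Z i" using Z(2) open_contains_ball by metis
    have "{u. dist (cc (i div 2) u) (cc (i div 2) y) < e} \<subseteq> {u. u i \<in> Z i}"
    proof clarify
      fix u assume u: "dist (cc (i div 2) u) (cc (i div 2) y) < e"
      have "\<bar>u i - y i\<bar> \<le> norm (cc (i div 2) u - cc (i div 2) y)"
        using abs_Re_le_cmod[of "cc (i div 2) u - cc (i div 2) y"] abs_Im_le_cmod[of "cc (i div 2) u - cc (i div 2) y"]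
        by (cases "even i") (auto simp: cc_def)
      then have "u i \<in> ball (y i) e" using u by (simp add: dist_norm abs_minus_commute)
      then show "u i \<in> Z i" using e(2) by blast
    qed
    then show ?thesis using sep_mono[OF sep_cc[OF y e(1)]] by blast
  qed
  have "sep y {u. \<forall>i\<in>I. u i \<in> Z i}" if "finite I" for I
    using that
  proof (induction I)
    case empty
    show ?case by (rule sepI_1[of UNIV]) auto
  next
    case (insert i I)
    have "{u. \<forall>j\<in>insert i I. u j \<in> Z j} = {u. u i \<in> Z i} \<inter> {u. \<forall>j\<in>I. u j \<in> Z j}" by auto
    then show ?case using sep_Int[OF single insert.IH] by simp
  qed
  from this[OF Z(3)] show ?thesis
  proof (rule sep_mono)
    show "{u. \<forall>i\<in>{i. Z i \<noteq> UNIV}. u i \<in> Z i} \<subseteq> V" using Z(4) by fastforce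
  qed
qed

text \<open>The idempotent lives only over \<open>W\<close>, so it is multiplied by a cutoff
  \<open>g\<close> that vanishes off \<open>W\<close>. If \<open>cc 0 y\<close> is nonzero,
  \<open>g\<close> is a rescaled root of a bump function: it is 1 near \<open>y\<close> because the
  root is locally constant there, and its norm is at most 2. Over 0 the cutoff is
  \<open>1 - v i\<close> for some \<open>i\<close>, and no uniform bound is available.\<close>

lemma local_unit:
  assumes y: "y \<in> X" and U: "open U" "y \<in> U"
  shows "\<exists>e s V. (e, s) \<in> fps_closure X A \<and> open V \<and> y \<in> V \<and>
    (\<forall>u\<in>X. u \<in> V \<longrightarrow> e u = 1) \<and> (\<forall>u\<in>X. u \<notin> U \<longrightarrow> e u = 0) \<and>
    (cc 0 y \<noteq> 0 \<longrightarrow> (\<forall>u\<in>X. norm (e u) \<le> 2))"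
proof -
  obtain W \<psi> V' where W: "open W" "cc 0 y \<in> W" "open V'" "y \<in> V'"
    and \<psi>: "\<And>u. u \<in> X \<Longrightarrow> cc 0 u \<in> W \<Longrightarrow> \<psi> u = 0 \<or> \<psi> u = 1"
      "\<And>u. u \<in> X \<Longrightarrow> cc 0 u \<in> W \<Longrightarrow> u \<in> V' \<Longrightarrow> \<psi> u = 1"
      "\<And>u. u \<in> X \<Longrightarrow> cc 0 u \<in> W \<Longrightarrow> u \<notin> U \<Longrightarrow> \<psi> u = 0"
    and ap: "unif_approx {u \<in> X. cc 0 u \<in> W} A \<psi>"
    using sep_open[OF y U] unfolding sep_def by blast
  have "\<exists>g t V''. (g, t) \<in> A \<and> open V'' \<and> y \<in> V'' \<and> (\<forall>u\<in>X. u \<in> V'' \<longrightarrow> g u = 1) \<and>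
      (\<forall>u\<in>X. cc 0 u \<notin> W \<longrightarrow> g u = 0) \<and> (cc 0 y \<noteq> 0 \<longrightarrow> (\<forall>u\<in>X. norm (g u) \<le> 2))"
  proof (cases "cc 0 y = 0")
    case True
    obtain i W' where i: "open W'" "0 \<in> W'" "\<forall>z\<in>K \<inter> W'. v i z = 0" "\<forall>z\<in>K - W. v i z = 1"
      using bump_0[OF W(1)] W(2) True by auto
    have "(\<lambda>u. 1 - v i (cc 0 u), fps_const 1 - 0) \<in> A"
      by (rule fps_alg_diff[OF alg_A fps_algD(1)[OF alg_A] root_algI_base[OF v_G]])
    moreover have "open (cc 0 -` W')" by (rule open_vimage[OF i(1) continuous_cc])
    ultimately show ?thesis
      using True i cc_0_K by (intro exI[of _ "\<lambda>u. 1 - v i (cc 0 u)"] exI[of _ "fps_const 1 - 0"] exI[of _ "cc 0 -` W'"]) auto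
  next
    case False
    then have "cc 0 y \<in> K - {0}" using cc_0_K[OF y] by simp
    then obtain i W' where i: "open W'" "cc 0 y \<in> W'" "\<forall>z\<in>K \<inter> W'. v i z = 1" "\<forall>z\<in>K - W. v i z = 0"
      using bump[OF _ W(1,2)] by metis
    define \<omega> where "\<omega> = cc (Suc i) y"
    have \<omega>N: "\<omega> ^ N i = 1" using cc_Suc_power[OF y, of i] i(2,3) cc_0_K[OF y] by (simp add: \<omega>_def)
    then have \<omega>1: "norm \<omega> = 1"
      using N_pos[of i] by (metis norm_one norm_power norm_ge_zero power_eq_1_iff zero_less_iff_neq_zero abs_norm_cancel)
    \<comment> \<open>On this open set, which omits the finitely many other roots of unity, a value
      whose \<open>N i\<close>-th power is 1 can only be \<open>\<omega>\<close>.\<close>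
    define O' where "O' = - ({t. t ^ N i = 1} - {\<omega>})"
    have "finite ({t::complex. t ^ N i = 1} - {\<omega>})" using finite_roots_unity[of "N i"] N_pos[of i] by simp
    then have "open O'" unfolding O'_def by (intro open_Compl finite_imp_closed)
    define V'' where "V'' = cc (Suc i) -` O' \<inter> cc 0 -` W'"
    have "open V''" unfolding V''_def by (intro open_Int open_vimage \<open>open O'\<close> i(1) continuous_cc)
    moreover have "y \<in> V''" using i(2) by (simp add: V''_def O'_def \<omega>_def)
    moreover have "(1 / \<omega>) * cc (Suc i) u = 1" if "u \<in> X" "u \<in> V''" for u
    proof -
      have "cc (Suc i) u ^ N i = 1" using cc_Suc_power[OF that(1), of i] i(3) cc_0_K[OF that(1)] that(2) by (simp add: V''_def)
      then have "cc (Suc i) u = \<omega>" using that(2) by (auto simp: V''_def O'_def)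
      then show ?thesis using \<omega>1 by auto
    qed
    moreover have "(1 / \<omega>) * cc (Suc i) u = 0" if "u \<in> X" "cc 0 u \<notin> W" for u
      using cc_Suc_power[OF that(1), of i] i(4) cc_0_K[OF that(1)] that(2) N_pos[of i] by auto
    moreover have "norm ((1 / \<omega>) * cc (Suc i) u) \<le> 2" if "u \<in> X" for u
      using norm_cc_le[OF that, of i] \<omega>1 by (simp add: norm_mult norm_divide)
    moreover have "(\<lambda>u. (1 / \<omega>) * cc (Suc i) u, fps_const (1 / \<omega>) * 0) \<in> A"
      by (rule fps_alg_scale[OF alg_A root_algI_cc[OF alg]])
    ultimately show ?thesis by blast
  qed
  then obtain g t V'' where g: "(g, t) \<in> A" "open V''" "y \<in> V''" "\<And>u. u \<in> X \<Longrightarrow> u \<in> V'' \<Longrightarrow> g u = 1"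
      "\<And>u. u \<in> X \<Longrightarrow> cc 0 u \<notin> W \<Longrightarrow> g u = 0" "cc 0 y \<noteq> 0 \<Longrightarrow> \<forall>u\<in>X. norm (g u) \<le> 2" by blast
  have "unif_approx X A (\<lambda>u. g u * \<psi> u)"
    by (rule unif_approx_localize[OF alg_A g(1) _ ap]) (use g(5) in auto)
  then obtain s where s: "(\<lambda>u. g u * \<psi> u, s) \<in> fps_closure X A" using unif_approx_A_closure by blast
  show ?thesis
  proof (rule exI[of _ "\<lambda>u. g u * \<psi> u"], rule exI[of _ s], rule exI[of _ "V' \<inter> V'' \<inter> cc 0 -` W"], intro conjI impI ballI)
    show "(\<lambda>u. g u * \<psi> u, s) \<in> fps_closure X A" by (rule s)
    show "open (V' \<inter> V'' \<inter> cc 0 -` W)" by (intro open_Int W g open_vimage continuous_cc)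
    show "y \<in> V' \<inter> V'' \<inter> cc 0 -` W" using W g by simp
    show "g u * \<psi> u = 1" if "u \<in> X" "u \<in> V' \<inter> V'' \<inter> cc 0 -` W" for u using g(4) \<psi>(2) that by simp
    show "g u * \<psi> u = 0" if "u \<in> X" "u \<notin> U" for u using g(5) \<psi>(3) that by (cases "cc 0 u \<in> W") auto
    show "norm (g u * \<psi> u) \<le> 2" if "cc 0 y \<noteq> 0" and u: "u \<in> X" for u
    proof -
      have "norm (g u) \<le> 2" using g(6)[OF that(1)] u by blast
      then show "norm (g u * \<psi> u) \<le> 2" using \<psi>(1)[OF u] g(5)[OF u] by (cases "cc 0 u \<in> W") auto
    qed
  qed
qed

end

section \<open>The uniform algebra on the root cover\<close>

context root_system
begin

lemma eval_0_A: "(h, t) \<in> A \<Longrightarrow> fps_nth t 0 = h (\<lambda>_. 0)"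
proof -
  have cc0: "cc n (\<lambda>_. 0) = 0" for n by (simp add: cc_def complex_eq_iff)
  assume "(h, t) \<in> A"
  then obtain n where "root_rel G n h t" by (auto simp: root_alg_def)
  then show ?thesis
    by (induction rule: root_rel.induct) (auto simp: cc0 eval_0)
qed

definition base_point :: "nat \<Rightarrow> real" where "base_point = (\<lambda>_. 0)"

lemma v_0: "v i 0 = 0"
  using eval_0[OF v_G[of i]] by simp

lemma base_point_in: "base_point \<in> X"
proof -
  have "cc n base_point = 0" for n by (simp add: cc_def base_point_def complex_eq_iff)
  then show ?thesis using zero_K N_pos by (simp add: root_cover_def v_0)
qed

text \<open>All \<open>v i\<close> vanish at 0, hence so do their roots: the fibre over 0 is a
  single point, the only one where \<open>local_unit\<close> gives no norm bound.\<close>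

lemma cc_0_nonzero:
  assumes "y \<in> X" "y \<noteq> base_point"
  shows "cc 0 y \<noteq> 0"
proof
  assume z: "cc 0 y = 0"
  have "cc (Suc i) y = 0" for i
    using cc_Suc_power[OF assms(1), of i] v_0[of i] N_pos[of i] by (simp add: z)
  then have all: "cc n y = 0" for n using z by (cases n) auto
  have "y k = 0" for k
    using all[of "k div 2"] by (cases "even k") (auto simp: cc_def complex_eq_iff)
  then show False using assms(2) by (auto simp: base_point_def)
qed

abbreviation "T \<equiv> top_of_set X"
abbreviation "Ac \<equiv> fps_closure X A"

text \<open>Extensionality matches the encoding of the continuous functions on \<open>X\<close>; the
  closure itself ignores values off \<open>X\<close>.\<close>

definition B :: "((nat \<Rightarrow> real) \<Rightarrow> complex) set" where
  "B = {f \<in> extensional X. \<exists>s. (f, s) \<in> Ac}"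

definition taylor :: "((nat \<Rightarrow> real) \<Rightarrow> complex) \<Rightarrow> complex fps" where
  "taylor f = (THE s. (f, s) \<in> Ac)"

lemmas alg_Ac = fps_alg_closure[OF alg_A]
lemmas bd_Ac = fps_bounded_closure[OF bd_A]

lemma taylor_eq: "(f, s) \<in> Ac \<Longrightarrow> taylor f = s"
  unfolding taylor_def using fps_alg_unique[OF alg_Ac bd_Ac] by (intro the_equality) auto

lemma taylor_mem: "f \<in> B \<Longrightarrow> (f, taylor f) \<in> Ac"
  using taylor_eq by (auto simp: B_def)

lemma restrict_B:
  assumes "(f, s) \<in> Ac"
  shows "restrict f X \<in> B" "taylor (restrict f X) = s"
proof -
  have "(restrict f X, s) \<in> Ac" by (rule fps_closure_cong[OF assms]) simp
  then show "restrict f X \<in> B" "taylor (restrict f X) = s" by (auto simp: B_def taylor_eq)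
qed

lemma B_ops:
  shows "f \<in> B \<Longrightarrow> g \<in> B \<Longrightarrow> fun_add T f g \<in> B \<and> taylor (fun_add T f g) = taylor f + taylor g"
    and "f \<in> B \<Longrightarrow> g \<in> B \<Longrightarrow> fun_mult T f g \<in> B \<and> taylor (fun_mult T f g) = taylor f * taylor g"
    and "f \<in> B \<Longrightarrow> fun_scale T c f \<in> B \<and> taylor (fun_scale T c f) = fps_const c * taylor f"
    and "fun_const T c \<in> B"
proof -
  note defs = fun_add_def fun_mult_def fun_scale_def fun_const_def topspace_euclidean_subtopology
  show "fun_add T f g \<in> B \<and> taylor (fun_add T f g) = taylor f + taylor g" if "f \<in> B" "g \<in> B"
    unfolding defs by (intro conjI restrict_B[OF fps_algD(2)[OF alg_Ac that[THEN taylor_mem]]])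
  show "fun_mult T f g \<in> B \<and> taylor (fun_mult T f g) = taylor f * taylor g" if "f \<in> B" "g \<in> B"
    unfolding defs by (intro conjI restrict_B[OF fps_algD(3)[OF alg_Ac that[THEN taylor_mem]]])
  show "fun_scale T c f \<in> B \<and> taylor (fun_scale T c f) = fps_const c * taylor f" if "f \<in> B"
    unfolding defs by (intro conjI restrict_B[OF fps_alg_scale[OF alg_Ac taylor_mem[OF that]]])
  show "fun_const T c \<in> B"
    unfolding defs by (rule restrict_B(1)[OF fps_algD(1)[OF alg_Ac]])
qed

lemma continuous_Ac: "(f, s) \<in> Ac \<Longrightarrow> continuous_on X f"
  by (rule fps_closure_continuous[of A]) (auto intro: root_alg_continuous[OF cont])

lemma compact_space_T: "compact_space T"
  using compact_X by (simp add: compact_space_subtopology)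

lemma mspace_T:
  "mspace (cont_fun_metric T) = {f. f \<in> extensional X \<and> continuous_on X f}"
  using compactin_mspace_cfunspace[of T euclidean_metric] compact_space_T
  by (auto simp: compact_space_def)

lemma B_sub_mspace: "B \<subseteq> mspace (cont_fun_metric T)"
  unfolding mspace_T using continuous_Ac by (auto simp: B_def)

lemma unif_approx_Ac:
  assumes "\<And>e. 0 < e \<Longrightarrow> \<exists>g\<in>B. \<forall>x\<in>X. norm (f x - g x) \<le> e"
  shows "unif_approx X A f"
  unfolding unif_approx_def
proof (intro allI impI)
  fix e :: real assume "0 < e"
  then have e2: "0 < e / 2" by simp
  obtain g where g: "g \<in> B" "\<forall>x\<in>X. norm (f x - g x) \<le> e / 2" using assms[OF e2] by blast
  obtain h t where h: "(h, t) \<in> A" "\<And>x. x \<in> X \<Longrightarrow> norm (g x - h x) \<le> e / 2"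
    by (rule fps_closureD[OF taylor_mem[OF g(1)] e2, where n = 0]) blast
  have "norm (f x - h x) \<le> e" if "x \<in> X" for x
    using norm_triangle_ineq[of "f x - g x" "g x - h x"] bspec[OF g(2) that] h(2)[OF that] by simp
  then show "\<exists>g t. (g, t) \<in> A \<and> (\<forall>x\<in>X. norm (f x - g x) \<le> e)" using h(1) by blast
qed

text \<open>A function that no ball separates from \<open>B\<close> is a uniform limit of members of
  \<open>B\<close>, and completeness supplies its Taylor data.\<close>

lemma closed_B: "closedin (mtopology_of (cont_fun_metric T)) B"
proof -
  let ?M = "cont_fun_metric T"
  interpret M: Metric_space "mspace ?M" "mdist ?M" by (rule Metric_space_mspace_mdist)
  have "\<exists>r>0. disjnt B (M.mball f r)" if f: "f \<in> mspace ?M - B" for f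
  proof (rule ccontr)
    assume no: "\<not> ?thesis"
    have "unif_approx X A f"
    proof (rule unif_approx_Ac)
      fix e :: real assume "0 < e"
      then obtain g where g: "g \<in> B" "g \<in> M.mball f e" using no by (auto simp: disjnt_def)
      then have "mdist ?M f g \<le> e" "g \<in> mspace ?M" unfolding M.in_mball by linarith+
      then have "\<forall>x\<in>X. norm (f x - g x) \<le> e"
        using mdist_cfunspace_imp_mdist_le[of f T euclidean_metric g e] f by (auto simp: dist_norm)
      then show "\<exists>g\<in>B. \<forall>x\<in>X. norm (f x - g x) \<le> e" using g(1) by blast
    qed
    then obtain s where "(f, s) \<in> Ac" using unif_approx_A_closure by blast
    then show False using f by (auto simp: B_def mspace_T)
  qed
  then show ?thesis
    unfolding mtopology_of_def M.closedin_metric using B_sub_mspace by blast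
qed

text \<open>Finitely many local units cover \<open>K1\<close>. They are combined through
  \<open>1 - (1 - f) * (1 - e)\<close>, which is 1 where either function is 1 and 0 where both are
  0.\<close>

lemma normal_ext:
  assumes K0: "closedin T K0" and K1: "closedin T K1" and dis: "disjnt K0 K1"
  shows "\<exists>f\<in>B. (\<forall>x\<in>K0. f x = 0) \<and> (\<forall>x\<in>K1. f x = 1)"
proof -
  have cl: "closed K0" "closed K1" "K0 \<subseteq> X" "K1 \<subseteq> X"
    using K0 K1 compact_imp_closed[OF compact_X] closedin_closed_trans closedin_imp_subset by blast+
  have "compact K1" using cl compact_X by (metis compact_Int_closed inf.absorb2)
  define Q where "Q y e s V \<longleftrightarrow> (e, s) \<in> Ac \<and> open V \<and> y \<in> V \<and> (\<forall>u\<in>X. u \<in> V \<longrightarrow> e u = 1) \<and> (\<forall>u\<in>K0. e u = 0)" for y e s V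
  have "\<exists>e s V. Q y e s V" if y: "y \<in> K1" for y
  proof -
    have "y \<in> - K0" "y \<in> X" using y dis cl by (auto simp: disjnt_def)
    then obtain e s V where e: "(e, s) \<in> Ac" "open V" "y \<in> V"
      "\<forall>u\<in>X. u \<in> V \<longrightarrow> e u = 1" "\<forall>u\<in>X. u \<notin> - K0 \<longrightarrow> e u = 0"
      using local_unit[of y "- K0"] cl(1) by (metis open_Compl)
    then have "Q y e s V" using cl(3) unfolding Q_def by auto
    then show ?thesis by blast
  qed
  then obtain e s V where "\<And>y. y \<in> K1 \<Longrightarrow> Q y (e y) (s y) (V y)" by metis
  then have e: "(e y, s y) \<in> Ac" "open (V y)" "y \<in> V y"
    "\<forall>u\<in>X. u \<in> V y \<longrightarrow> e y u = 1" "\<forall>u\<in>K0. e y u = 0" if "y \<in> K1" for y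
    using that unfolding Q_def by blast+
  obtain C where C: "C \<subseteq> K1" "finite C" "K1 \<subseteq> (\<Union>y\<in>C. V y)"
    by (rule compactE_image[OF \<open>compact K1\<close>, of K1 V]) (use e(2,3) in auto)
  have "\<exists>f s. (f, s) \<in> Ac \<and> (\<forall>u\<in>K0. f u = 0) \<and> (\<forall>u\<in>X \<inter> (\<Union>y\<in>C. V y). f u = 1)"
    using C(2,1)
  proof (induction C)
    case empty
    show ?case using fps_algD(1)[OF alg_Ac, of 0] by (intro exI[of _ "\<lambda>_. 0"]) auto
  next
    case (insert y C)
    then obtain f t where f: "(f, t) \<in> Ac" "\<forall>u\<in>K0. f u = 0" "\<forall>u\<in>X \<inter> (\<Union>y\<in>C. V y). f u = 1" by auto
    have y: "y \<in> K1" using insert.prems by simp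
    have "(\<lambda>u. f u + (e y u - f u * e y u), t + (s y - t * s y)) \<in> Ac"
      by (intro fps_algD(2)[OF alg_Ac] fps_alg_diff[OF alg_Ac] fps_algD(3)[OF alg_Ac] f(1) e(1)[OF y])
    then show ?case
    proof (intro exI[of _ "\<lambda>u. f u + (e y u - f u * e y u)"] exI[of _ "t + (s y - t * s y)"] conjI ballI)
      show "f u + (e y u - f u * e y u) = 0" if "u \<in> K0" for u
        using bspec[OF f(2) that] bspec[OF e(5)[OF y] that] by simp
      fix u assume u: "u \<in> X \<inter> (\<Union>y\<in>insert y C. V y)"
      show "f u + (e y u - f u * e y u) = 1"
      proof (cases "u \<in> V y")
        case True
        then have "e y u = 1" using e(4)[OF y] u by blast
        then show ?thesis by simp
      next
        case False
        then have "f u = 1" using f(3) u by blast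
        then show ?thesis by simp
      qed
    qed
  qed
  then obtain f t where f: "(f, t) \<in> Ac" "\<forall>u\<in>K0. f u = 0" "\<forall>u\<in>X \<inter> (\<Union>y\<in>C. V y). f u = 1" by blast
  show ?thesis
    using restrict_B(1)[OF f(1)] f(2,3) cl C(3) by (intro bexI[of _ "restrict f X"]) (auto simp: subset_iff)
qed

lemma uniform_algebra_B: "uniform_algebra T B"
proof -
  have "\<exists>f\<in>B. f x \<noteq> f y" if xy: "x \<in> X" "y \<in> X" "x \<noteq> y" for x y
  proof -
    have "closedin T {x}" "closedin T {y}" using xy by (auto intro!: closed_subset)
    then obtain f where "f \<in> B" "f x = 0" "f y = 1" using normal_ext[of "{x}" "{y}"] xy(3) by auto
    then show ?thesis by (intro bexI[of _ f]) auto
  qed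
  then show ?thesis
    unfolding uniform_algebra_def
    using compact_space_T B_sub_mspace B_ops closed_B
    by (auto simp: Hausdorff_space_subtopology Hausdorff_space_euclidean)
qed

lemma point_eval_character:
  assumes "y \<in> X"
  shows "point_eval B y \<in> characters T B"
proof -
  have "fun_const T 1 \<in> B" by (rule B_ops(4))
  moreover have "point_eval B y (fun_const T 1) \<noteq> 0"
    using assms B_ops(4) by (simp add: point_eval_def fun_const_def)
  ultimately show ?thesis
    using assms B_ops(1-3)
    unfolding characters_def linear_functional_def point_eval_def
    by (auto simp: fun_add_def fun_mult_def fun_scale_def)
qed

lemma topspace_max_ideal: "topspace (max_ideal_space T B) = characters T B"
  by (auto simp: max_ideal_space_def characters_def PiE_def)

text \<open>If \<open>f\<close> vanishes on a neighbourhood \<open>V\<close> of \<open>y\<close> and \<open>e\<close> is supported in \<open>V\<close> with \<open>e y = 1\<close>, then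
  \<open>f e = 0\<close> forces every character that does not kill \<open>e\<close> to kill \<open>f\<close>.\<close>

lemma J_ideal_I:
  assumes y: "y \<in> X" and f: "f \<in> B" and V: "open V" "y \<in> V" "\<And>u. u \<in> X \<Longrightarrow> u \<in> V \<Longrightarrow> f u = 0"
  shows "f \<in> J_ideal T B (point_eval B y)"
proof -
  obtain e s V' where e: "(e, s) \<in> Ac" "y \<in> V'"
    "\<forall>u\<in>X. u \<in> V' \<longrightarrow> e u = 1" "\<forall>u\<in>X. u \<notin> V \<longrightarrow> e u = 0"
    using local_unit[OF y V(1,2)] by metis
  define g where "g = restrict e X"
  have g: "g \<in> B" using restrict_B(1)[OF e(1)] by (simp add: g_def)
  have fg: "fun_mult T f g = fun_scale T 0 f"
    using V(3) e(4) by (auto simp: fun_mult_def fun_scale_def g_def fun_eq_iff restrict_def)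
  let ?P = "product_topology (\<lambda>_. euclidean) B :: (((nat \<Rightarrow> real) \<Rightarrow> complex) \<Rightarrow> complex) topology"
  define U where "U = {\<psi> \<in> characters T B. \<psi> g \<noteq> 0}"
  have "openin ?P {\<psi> \<in> topspace ?P. \<psi> g \<in> - {0}}"
    by (rule openin_continuous_map_preimage[OF continuous_map_product_projection[OF g]]) (simp add: open_Compl)
  then have "openin (subtopology ?P (characters T B)) ({\<psi> \<in> topspace ?P. \<psi> g \<in> - {0}} \<inter> characters T B)"
    by (auto simp: openin_subtopology)
  moreover have "{\<psi> \<in> topspace ?P. \<psi> g \<in> - {0}} \<inter> characters T B = U"
    by (auto simp: U_def characters_def PiE_def)
  ultimately have "openin (max_ideal_space T B) U" by (simp add: max_ideal_space_def)
  moreover have "point_eval B y \<in> U"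
    using point_eval_character[OF y] g e(3) e(2) y by (simp add: U_def point_eval_def g_def)
  moreover have "gelfand f \<psi> = 0" if "\<psi> \<in> U" for \<psi>
  proof -
    have \<psi>: "\<psi> \<in> characters T B" "\<psi> g \<noteq> 0" using that by (auto simp: U_def)
    have "\<psi> f * \<psi> g = \<psi> (fun_mult T f g)" using \<psi>(1) f g by (simp add: characters_def)
    also have "\<dots> = 0 * \<psi> f" unfolding fg using \<psi>(1) f by (simp add: characters_def linear_functional_def)
    finally show ?thesis using \<psi>(2) by (simp add: gelfand_def)
  qed
  ultimately show ?thesis using f unfolding J_ideal_def by blast
qed

text \<open>The relative unit is \<open>1 - e\<close> with \<open>e\<close> a local unit at
  \<open>y\<close> that vanishes on the given compact set; the constant 3 is
  \<open>1 + 2\<close>.\<close>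

lemma bounded_relative_units_B:
  assumes y: "y \<in> X" "y \<noteq> base_point"
  shows "bounded_relative_units_at T B y"
  unfolding bounded_relative_units_at_def
proof (intro exI[of _ 3] conjI allI impI)
  fix L assume L: "compactin T L \<and> L \<subseteq> topspace T - {y}"
  then have "compact L" by (simp add: compactin_subtopology)
  then have "open (- L)" "y \<in> - L" using L by (auto simp: open_Compl compact_imp_closed)
  then obtain e s V where e: "(e, s) \<in> Ac" "open V" "y \<in> V"
    "\<forall>u\<in>X. u \<in> V \<longrightarrow> e u = 1" "\<forall>u\<in>X. u \<notin> - L \<longrightarrow> e u = 0"
    "cc 0 y \<noteq> 0 \<longrightarrow> (\<forall>u\<in>X. norm (e u) \<le> 2)"
    using local_unit[OF y(1), of "- L"] by metis
  have e2: "\<forall>u\<in>X. norm (e u) \<le> 2" using e(6) cc_0_nonzero[OF y] by blast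
  define f where "f = restrict (\<lambda>u. 1 - e u) X"
  have f: "f \<in> B"
    unfolding f_def by (rule restrict_B(1)[OF fps_alg_diff[OF alg_Ac fps_algD(1)[OF alg_Ac] e(1)]])
  show "\<exists>f\<in>J_ideal T B (point_eval B y). (\<forall>x\<in>L. f x = 1) \<and> sup_norm T f \<le> 3"
  proof (intro bexI[of _ f] conjI ballI)
    show "f \<in> J_ideal T B (point_eval B y)"
      by (rule J_ideal_I[OF y(1) f e(2,3)]) (simp add: f_def e(4))
    show "f x = 1" if "x \<in> L" for x
      using that e(5) L by (auto simp: f_def)
    show "sup_norm T f \<le> 3"
      unfolding sup_norm_def
    proof (rule cSUP_least)
      fix u assume "u \<in> topspace T"
      then show "norm (f u) \<le> 3"
        using norm_triangle_ineq4[of 1 "e u"] bspec[OF e2, of u] by (simp add: f_def)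
    qed (use y(1) in auto)
  qed
qed simp

lemma norm_le_sup_norm:
  assumes "f \<in> B" "u \<in> X"
  shows "norm (f u) \<le> sup_norm T f"
proof -
  obtain M where "\<forall>x\<in>X. norm (f x) \<le> M" using fps_algD(4)[OF alg_Ac taylor_mem[OF assms(1)]] by blast
  then have "bdd_above ((\<lambda>x. norm (f x)) ` X)" by (intro bdd_aboveI2) auto
  then show ?thesis unfolding sup_norm_def using cSUP_upper assms(2) by simp
qed

text \<open>The product rule is the Cauchy product of power series. The coordinate
  \<open>cc 0\<close> carries the data \<open>fps_X\<close>, so its first coefficient is 1.\<close>

lemma derivation_B:
  shows "infinite_order_point_derivation T B (point_eval B base_point) (\<lambda>k f. fps_nth (taylor f) k)"
    and "bounded_derivation T B (\<lambda>k f. fps_nth (taylor f) k)"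
    and "nondegenerate_derivation B (\<lambda>k f. fps_nth (taylor f) k)"
proof -
  have "fps_nth (taylor f) 0 = f base_point" if "f \<in> B" for f
    by (rule fps_closure_eval[where G = A, OF _ base_point_in taylor_mem[OF that]]) (simp add: eval_0_A base_point_def)
  moreover have nth_scale: "fps_nth (taylor (fun_scale T c f)) k = c * fps_nth (taylor f) k" if "f \<in> B" for c f k
    using B_ops(3)[OF that] by simp
  moreover have nth_mult: "fps_nth (taylor (fun_mult T f g)) k = (\<Sum>j=0..k. fps_nth (taylor f) j * fps_nth (taylor g) (k - j))"
    if "f \<in> B" "g \<in> B" for f g k
    using B_ops(2)[OF that] by (simp add: fps_mult_nth)
  ultimately show "infinite_order_point_derivation T B (point_eval B base_point) (\<lambda>k f. fps_nth (taylor f) k)"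
    unfolding infinite_order_point_derivation_def topspace_max_ideal linear_functional_def
    using point_eval_character[OF base_point_in] nth_scale nth_mult
    by (auto simp: gelfand_def point_eval_def B_ops(1))
  show "bounded_derivation T B (\<lambda>k f. fps_nth (taylor f) k)"
    unfolding bounded_derivation_def bounded_functional_def
  proof
    fix k
    obtain C where C: "\<And>f s M. (f, s) \<in> Ac \<Longrightarrow> (\<And>x. x \<in> X \<Longrightarrow> norm (f x) \<le> M) \<Longrightarrow> 0 \<le> M \<Longrightarrow> norm (fps_nth s k) \<le> C * M"
      by (rule fps_boundedE[OF bd_Ac, where k = k]) blast
    have "norm (fps_nth (taylor f) k) \<le> C * sup_norm T f" if "f \<in> B" for f
      using norm_le_sup_norm[OF that] order_trans[OF norm_ge_zero norm_le_sup_norm[OF that base_point_in]]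
      by (intro C[OF taylor_mem[OF that]]) auto
    then show "\<exists>M. \<forall>f\<in>B. norm (fps_nth (taylor f) k) \<le> M * sup_norm T f" by blast
  qed
  have "(\<lambda>u. cc 0 u, fps_X) \<in> Ac" using root_algI_base[OF id_G] fps_closure_superset by blast
  from restrict_B[OF this] show "nondegenerate_derivation B (\<lambda>k f. fps_nth (taylor f) k)"
    unfolding nondegenerate_derivation_def by (intro bexI[of _ "restrict (\<lambda>u. cc 0 u) X"]) simp_all
qed

end

theorem theorem1p3:
  shows "\<exists>(X :: hilbert_carrier topology) B x.
           compact_space X \<and> metrizable_space X \<and> Hausdorff_space X \<and>
           uniform_algebra X B \<and> normal_on X B \<and>
           x \<in> topspace X \<and>
           (\<exists>d. infinite_order_point_derivation X B (point_eval B x) d \<and>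
                bounded_derivation X B d \<and> nondegenerate_derivation B d) \<and>
           (\<forall>y \<in> topspace X - {x}. bounded_relative_units_at X B y)"
proof -
  obtain K :: "complex set" and G v where planar: "compact K" "0 \<in> K" "fps_alg K G" "fps_bounded K G"
    "(\<lambda>z. z, fps_X) \<in> G" "\<forall>f s. (f, s) \<in> G \<longrightarrow> continuous_on K f"
    "\<forall>f s. (f, s) \<in> G \<longrightarrow> fps_nth s 0 = f 0" "\<forall>i::nat. (v i, 0) \<in> G"
    "\<forall>y\<in>K - {0}. \<forall>U. open U \<longrightarrow> y \<in> U \<longrightarrow> (\<exists>i W. open W \<and> y \<in> W \<and> (\<forall>z\<in>K \<inter> W. v i z = 1) \<and> (\<forall>z\<in>K - U. v i z = 0))"
    "\<forall>U. open U \<longrightarrow> 0 \<in> U \<longrightarrow> (\<exists>i W. open W \<and> 0 \<in> W \<and> (\<forall>z\<in>K \<inter> W. v i z = 0) \<and> (\<forall>z\<in>K - U. v i z = 1))"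
    using planar_algebra by (elim exE conjE)
  \<comment> \<open>Larger bump functions receive roots of higher order, so that all roots have
    modulus at most 2.\<close>
  have "\<exists>n>0. \<forall>z\<in>K. norm (v i z) \<le> 2 ^ n" for i
  proof -
    obtain M where M: "\<forall>z\<in>K. norm (v i z) \<le> M" using fps_algD(4)[OF planar(3)] planar(8) by blast
    obtain n where "M < 2 ^ n" using real_arch_pow[of 2 M] by auto
    then have "M \<le> 2 ^ Suc n" using zero_le_power[of "2::real" n] unfolding power_Suc by linarith
    then have "\<forall>z\<in>K. norm (v i z) \<le> 2 ^ Suc n" using M order_trans by blast
    then show ?thesis by blast
  qed
  then obtain N where N: "\<And>i. 0 < N i" "\<And>i z. z \<in> K \<Longrightarrow> norm (v i z) \<le> 2 ^ N i" by metis
  interpret root_system K G v N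
  proof
    show "compact K" "0 \<in> K" "fps_alg K G" "fps_bounded K G" "(\<lambda>z. z, fps_X) \<in> G"
      by (rule planar)+
    show "continuous_on K f" if "(f, s) \<in> G" for f s using planar(6) that by blast
    show "fps_nth s 0 = f 0" if "(f, s) \<in> G" for f s using planar(7) that by blast
    show "(v i, 0) \<in> G" for i using planar(8) by blast
    show "0 < N i" for i by (rule N(1))
    show "norm (v i z) \<le> 2 ^ N i" if "z \<in> K" for i z by (rule N(2)[OF that])
    show "\<exists>i W. open W \<and> y \<in> W \<and> (\<forall>z\<in>K \<inter> W. v i z = 1) \<and> (\<forall>z\<in>K - U. v i z = 0)"
      if "y \<in> K - {0}" "open U" "y \<in> U" for y U
      using bspec[OF planar(9) that(1)] that(2,3) by blast
    show "\<exists>i W. open W \<and> 0 \<in> W \<and> (\<forall>z\<in>K \<inter> W. v i z = 0) \<and> (\<forall>z\<in>K - U. v i z = 1)"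
      if "open U" "0 \<in> U" for U
      using planar(10) that by blast
  qed
  show ?thesis
  proof (intro exI conjI ballI)
    show "compact_space T" by (rule compact_space_T)
    show "metrizable_space T" by (intro metrizable_space_subtopology metrizable_space_euclidean)
    show "Hausdorff_space T" by (intro Hausdorff_space_subtopology Hausdorff_space_euclidean)
    show "uniform_algebra T B" by (rule uniform_algebra_B)
    show "normal_on T B" unfolding normal_on_def using normal_ext by blast
    show "base_point \<in> topspace T" using base_point_in by simp
    show "bounded_relative_units_at T B y" if "y \<in> topspace T - {base_point}" for y
      using that by (intro bounded_relative_units_B) auto
  qed (rule derivation_B)+
qed

end
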